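(* Let $\rho_1(r)$ and $\rho_2(r)$ be two proximate orders for positive orders $\rho_1>0$ and $\rho_2>0$ respectively, satisfying $r^{\rho_1(r)}=O(r^{\rho_2(r)})$ as $r\to\infty$. (1) Suppose that $P=\sum_{\mathbf m\in\mathbb N_0^n}u_{\mathbf m}(\mathbf x)\odot_L\partial_{\mathbf x}^{\mathbf m}\in\mathbf D_{\rho_1\to\rho_2}$. For a left monogenic entire function $f\in A_{\rho_1}$, the series $$Pf=\sum_{\mathbf m\in\mathbb N_0^n}u_{\mathbf m}(\mathbf x)\odot_L\partial_{\mathbf x}^{\mathbf m}f$$ converges and $Pf\in A_{\rho_2}$. Moreover, $f\mapsto Pf$ defines a continuous right linear homomorphism $P:A_{\rho_1}\to A_{\rho_2}$. (2) Let $F:A_{\rho_1}\to A_{\rho_2}$ be a continuous right linear homomorphism. Then there is a unique $P\in\mathbf D_{\rho_1\to\rho_2}$ such that $Ff=Pf$ holds for any $f\in A_{\rho_1}$.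
   Context: Clifford algebra and monogenic functions: $\mathbb R_n$ is the real Clifford algebra over imaginary units $e_1,\dots,e_n$ with $e_i^2=-1$, $e_ie_j+e_je_i=0$ ($i\ne j$); for $y=\sum_A y_Ae_A$ put $\|y\|^2=\sum_A y_A^2$. Points $(x_0,\dots,x_n)\in\mathbb R^{n+1}$ are identified with paravectors $\mathbf x=x_0+\sum_{j=1}^n x_je_j$. An entire left monogenic function is $f\in C^1(\mathbb R^{n+1},\mathbb R_n)$ with $\partial_{x_0}f+\sum_{i=1}^n e_i\partial_{x_i}f=0$; the set of these is $\mathcal M_L(\mathbb R^{n+1})$. For $\mathbf m=(m_1,\dots,m_n)\in\mathbb N_0^n$: $|\mathbf m|=m_1+\dots+m_n$, $\mathbf m!=m_1!\cdots m_n!$, $\partial_{\mathbf x}^{\mathbf m}=\partial_{x_1}^{m_1}\cdots\partial_{x_n}^{m_n}$ (no $x_0$-derivative). Fueter polynomials: with $z_j=x_j-x_0e_j$, $V_{\mathbf m}(\mathbf x)=\frac{\mathbf m!}{|\mathbf m|!}\sum z_{j_1}z_{j_2}\cdots z_{j_{|\mathbf m|}}$, the sum being over all distinct sequences $(j_1,\dots,j_{|\mathbf m|})$ in which each index $i$ occurs exactly $m_i$ times ($V_{\mathbf 0}=1$). Every $f\in\mathcal M_L(\mathbb R^{n+1})$ has a unique Taylor expansion $f=\sum_{\mathbf m}V_{\mathbf m}(\mathbf x)a_{\mathbf m}$, $a_{\mathbf m}=\frac1{\mathbf m!}\partial^{\mathbf m}_{\mathbf x}f(0)\in\mathbb R_n$.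 The CK-product of $f=\sum V_{\mathbf m}a_{\mathbf m}$ and $g=\sum V_{\mathbf k}b_{\mathbf k}$ is $f\odot_L g=\sum_{\mathbf m}\sum_{\mathbf k}V_{\mathbf m+\mathbf k}(\mathbf x)a_{\mathbf m}b_{\mathbf k}$. Proximate orders: a differentiable function $\rho(r)\ge0$ on $r\ge0$ is a proximate order for the order $\rho\ge0$ if $\lim_{r\to+\infty}\rho(r)=\rho$ and $\lim_{r\to+\infty}\rho'(r)\,r\ln r=0$. A normalization $\hat\rho(r)$ of a proximate order $\rho(r)$ for $\rho>0$ is a proximate order such that $\hat\rho(r)=\rho(r)$ for all $r\ge r_1$, for some $r_1>0$, and $r\mapsto r^{\hat\rho(r)}$ is strictly increasing on $r>0$ and maps $(0,+\infty)$ onto $(0,+\infty)$ (such $\hat\rho$ exists; fix one). Let $\varphi$ be the inverse function of $t=r^{\hat\rho(r)}$ and $G_{\hat\rho,q}=\varphi(q)^q/(e\rho)^{q/\rho}$ for $q\in\mathbb N$, with $G_{\hat\rho,0}=1$. Spaces (here the subscript $\rho$ stands for the function $\rho(r)$): for $\sigma>0$, $A_{\rho,\sigma}=\{f\in\mathcal M_L(\mathbb R^{n+1}):\|f\|_{\rho,\sigma}:=\sup_{\mathbf x}\|f(\mathbf x)\|\exp(-\sigma\|\mathbf x\|^{\rho(\|\mathbf x\|)})<\infty\}$, a Banach space. $A_\rho=\bigcup_{\sigma>0}A_{\rho,\sigma}$ with the locally convex inductive limit topology (a sequence converges in $A_\rho$ iff it and its limit lie in some $A_{\rho,\sigma}$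 and it converges in the norm of that space). Operators: $\mathbf D_{\rho_1\to\rho_2}$ is the set of formal right linear differential operators $P=\sum_{\mathbf m\in\mathbb N_0^n}u_{\mathbf m}(\mathbf x)\odot_L\partial_{\mathbf x}^{\mathbf m}$ (identified with their coefficient families) with $u_{\mathbf m}\in A_{\rho_2}$ satisfying $$\forall\lambda>0\ \exists\sigma>0\ \exists C>0\ \forall\mathbf m\in\mathbb N_0^n:\quad \|u_{\mathbf m}\|_{\rho_2,\sigma}\le C\,\frac{G_{\hat\rho_1,|\mathbf m|}}{\mathbf m!}\lambda^{|\mathbf m|},$$ where $\hat\rho_1$ is a normalization of $\rho_1$. A right linear homomorphism $F$ is an additive map with $F(fa)=F(f)a$ for all $a\in\mathbb R_n$. *)

theory Defs
  imports "HOL-Analysis.Analysis" "HOL-Library.Landau_Symbols"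
begin

section \<open>The real Clifford algebra\<close>

text \<open>
  The imaginary units are indexed by a finite linearly ordered type \<open>'n\<close>, so that \<open>n = CARD('n)\<close>.
  An element \<open>y = (\<Sum>A. y\<^sub>A e\<^sub>A)\<close> of the Clifford algebra is its coefficient vector, indexed by the
  subsets \<open>A\<close> of the index type; \<open>norm\<close> is then the square root of \<open>\<Sum>A. y\<^sub>A\<^sup>2\<close>.
  The product on the type \<open>real ^ _\<close> in the library is componentwise and is not used here.
\<close>

type_synonym 'n clifford = "real ^ ('n set)"

definition blade :: "'n::finite set \<Rightarrow> 'n clifford" where
  "blade A = axis A 1"

abbreviation cl_one :: "'n::finite clifford" where
  "cl_one \<equiv> blade {}"

abbreviation cl_unit :: "'n::finite \<Rightarrow> 'n clifford" where
  "cl_unit i \<equiv> blade {i}"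

text \<open>
  \<open>e\<^sub>A e\<^sub>B = \<plusminus> e\<^sub>C\<close> with \<open>C\<close> the symmetric difference of \<open>A\<close> and \<open>B\<close>. Each pair \<open>b < a\<close> contributes
  a sign by anticommutation, each pair \<open>b = a\<close> a sign by \<open>e\<^sub>a\<^sup>2 = -1\<close>.
\<close>

definition blade_sign :: "'n::{finite,linorder} set \<Rightarrow> 'n set \<Rightarrow> real" where
  "blade_sign A B = (\<Prod>a\<in>A. \<Prod>b\<in>B. if b \<le> a then - 1 else 1)"

definition cmul :: "'n::{finite,linorder} clifford \<Rightarrow> 'n clifford \<Rightarrow> 'n clifford"
    (infixl "\<cdot>\<^sub>c" 70) where
  "x \<cdot>\<^sub>c y = (\<Sum>A\<in>UNIV. \<Sum>B\<in>UNIV. (blade_sign A B * x $ A * y $ B) *\<^sub>R blade (sym_diff A B))"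

lemma blade_mult: "blade A \<cdot>\<^sub>c blade B = blade_sign A B *\<^sub>R blade (sym_diff A B)"
proof -
  have "blade A \<cdot>\<^sub>c blade B =
      (\<Sum>A'\<in>UNIV. \<Sum>B'\<in>UNIV. if B' = B then
         (if A' = A then blade_sign A B *\<^sub>R blade (sym_diff A B) else 0) else 0)"
    unfolding cmul_def by (intro sum.cong refl) (auto simp: blade_def axis_def)
  then show ?thesis by simp
qed

lemma cl_unit_square: "cl_unit i \<cdot>\<^sub>c cl_unit i = - cl_one"
  by (simp add: blade_mult blade_sign_def)

lemma cl_unit_anticommute:
  assumes "i \<noteq> j"
  shows "cl_unit i \<cdot>\<^sub>c cl_unit j + cl_unit j \<cdot>\<^sub>c cl_unit i = 0"
proof -
  have "sym_diff {i} {j} = {i, j}" "sym_diff {j} {i} = {i, j}" using assms by auto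
  then show ?thesis using assms by (auto simp: blade_mult blade_sign_def)
qed

lemma bilinear_cmul: "bilinear (\<cdot>\<^sub>c)"
  unfolding bilinear_def cmul_def
  by (auto intro!: linearI simp: algebra_simps sum.distrib scaleR_sum_right scaleR_left_distrib)

lemma clifford_expand: "x = (\<Sum>A\<in>UNIV. (x $ A) *\<^sub>R blade A)"
  by (simp add: vec_eq_iff blade_def axis_def if_distrib cong: if_cong)

lemma prod_sym_diff:
  fixes s :: "'a::finite \<Rightarrow> real"
  assumes "\<And>a. s a * s a = 1"
  shows "prod s (sym_diff A B) = prod s A * prod s B"
proof -
  have "prod s A = prod s (A - B) * prod s (A \<inter> B)"
    by (subst prod.union_disjoint [symmetric]) (auto intro: arg_cong[where f = "prod s"])
  moreover have "prod s B = prod s (B - A) * prod s (A \<inter> B)"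
    by (subst prod.union_disjoint [symmetric]) (auto intro: arg_cong[where f = "prod s"])
  moreover have "prod s (A \<inter> B) * prod s (A \<inter> B) = 1"
    by (simp add: assms flip: prod.distrib)
  moreover have "prod s (sym_diff A B) = prod s (A - B) * prod s (B - A)"
    by (rule prod.union_disjoint) auto
  ultimately show ?thesis by (simp add: algebra_simps)
qed

lemma blade_sign_left:
  "blade_sign (sym_diff A B) C = blade_sign A C * blade_sign B C"
  unfolding blade_sign_def
  by (rule prod_sym_diff) (auto simp flip: prod.distrib intro: prod.neutral)

lemma blade_sign_right:
  "blade_sign C (sym_diff A B) = blade_sign C A * blade_sign C B"
  unfolding blade_sign_def prod.distrib [symmetric]
  by (intro prod.cong refl prod_sym_diff) auto

lemma clifford_induct [case_names blade add scale]:
  assumes "\<And>A. P (blade A)" and "\<And>x y. P x \<Longrightarrow> P y \<Longrightarrow> P (x + y)"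
    and "\<And>c x. P x \<Longrightarrow> P (c *\<^sub>R x)"
  shows "P (x :: 'n::finite clifford)"
proof -
  have "P (\<Sum>A\<in>S. (x $ A) *\<^sub>R blade A)" if "finite S" for S
    using that
  proof induction
    case empty
    show ?case using assms(3)[of "blade {}" 0] assms(1) by simp
  next
    case (insert A S)
    then show ?case by (simp add: assms)
  qed
  from this[of UNIV] show ?thesis by (subst clifford_expand) simp
qed

lemmas cmul_bilinear =
  bilinear_ladd[OF bilinear_cmul] bilinear_radd[OF bilinear_cmul]
  bilinear_lmul[OF bilinear_cmul] bilinear_rmul[OF bilinear_cmul]

lemma cmul_assoc: "(x \<cdot>\<^sub>c y) \<cdot>\<^sub>c z = x \<cdot>\<^sub>c (y \<cdot>\<^sub>c z)"
proof (induction x rule: clifford_induct)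
  case (blade A)
  show ?case
  proof (induction y rule: clifford_induct)
    case (blade B)
    show ?case
    proof (induction z rule: clifford_induct)
      case (blade C)
      have "sym_diff (sym_diff A B) C = sym_diff A (sym_diff B C)" by auto
      then show ?case
        by (simp only: blade_mult cmul_bilinear blade_sign_left blade_sign_right scaleR_scaleR mult_ac)
    qed (simp_all only: cmul_bilinear)
  qed (simp_all only: cmul_bilinear)
qed (simp_all only: cmul_bilinear)

lemma cl_one_cmul: "cl_one \<cdot>\<^sub>c x = x"
proof (induction x rule: clifford_induct)
  case (blade A)
  show ?case by (simp add: blade_mult blade_sign_def)
qed (simp_all only: cmul_bilinear)

lemma cmul_cl_one: "x \<cdot>\<^sub>c cl_one = x"
proof (induction x rule: clifford_induct)
  case (blade A)
  show ?case by (simp add: blade_mult blade_sign_def)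
qed (simp_all only: cmul_bilinear)

lemma blade_eq_prod: "blade A = foldr (\<lambda>i y. cl_unit i \<cdot>\<^sub>c y) (sorted_list_of_set A) cl_one"
proof -
  have "blade (set xs) = foldr (\<lambda>i y. cl_unit i \<cdot>\<^sub>c y) xs cl_one" if "sorted_wrt (<) xs"
    for xs :: "'a list"
    using that
  proof (induction xs)
    case (Cons i xs)
    then have "i \<notin> set xs" "\<forall>j\<in>set xs. \<not> j \<le> i" by (auto simp: not_le)
    then have "blade_sign {i} (set xs) = 1" "sym_diff {i} (set xs) = insert i (set xs)"
      by (auto simp: blade_sign_def intro!: prod.neutral)
    then show ?case using Cons by (simp add: blade_mult flip: Cons.IH)
  qed simp
  from this[of "sorted_list_of_set A"] show ?thesis by simp
qed


section \<open>Monogenic functions\<close>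

text \<open>A point of \<open>\<real>\<^bsup>n+1\<^esup>\<close> is the pair of \<open>x\<^sub>0\<close> and \<open>(x\<^sub>1, \<dots>, x\<^sub>n)\<close>; the product norm is Euclidean.\<close>

type_synonym 'n paravector = "real \<times> (real ^ 'n)"
type_synonym 'n cfun = "'n paravector \<Rightarrow> 'n clifford"
type_synonym 'n multi = "'n \<Rightarrow> nat"

definition dir_deriv :: "'n::finite paravector \<Rightarrow> 'n cfun \<Rightarrow> 'n cfun" where
  "dir_deriv v f x = frechet_derivative f (at x) v"

abbreviation partial0 :: "'n::finite cfun \<Rightarrow> 'n cfun" where
  "partial0 \<equiv> dir_deriv (1, 0)"

abbreviation partial :: "'n::finite \<Rightarrow> 'n cfun \<Rightarrow> 'n cfun" where
  "partial i \<equiv> dir_deriv (0, axis i 1)"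

definition C1_fun :: "'n::finite cfun \<Rightarrow> bool" where
  "C1_fun f \<longleftrightarrow> (\<forall>x. f differentiable at x) \<and> (\<forall>v. continuous_on UNIV (dir_deriv v f))"

definition monogenic :: "'n::{finite,linorder} cfun \<Rightarrow> bool" where
  "monogenic f \<longleftrightarrow> C1_fun f \<and>
     (\<forall>x. partial0 f x + (\<Sum>i\<in>UNIV. cl_unit i \<cdot>\<^sub>c partial i f x) = 0)"

definition multi_abs :: "'n::finite multi \<Rightarrow> nat" where
  "multi_abs m = (\<Sum>i\<in>UNIV. m i)"

definition multi_fact :: "'n::finite multi \<Rightarrow> real" where
  "multi_fact m = (\<Prod>i\<in>UNIV. fact (m i))"

definition multi_deriv :: "'n::{finite,linorder} multi \<Rightarrow> 'n cfun \<Rightarrow> 'n cfun" where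
  "multi_deriv m f = foldr (\<lambda>i. partial i ^^ m i) (sorted_list_of_set UNIV) f"


section \<open>Fueter polynomials and the CK-product\<close>

definition fueter_var :: "'n::finite \<Rightarrow> 'n cfun" where
  "fueter_var j x = (snd x $ j) *\<^sub>R cl_one - fst x *\<^sub>R cl_unit j"

definition fueter :: "'n::{finite,linorder} multi \<Rightarrow> 'n cfun" where
  "fueter m x = (multi_fact m / fact (multi_abs m)) *\<^sub>R
     (\<Sum>js | \<forall>i. count_list js i = m i. foldr (\<lambda>j y. fueter_var j x \<cdot>\<^sub>c y) js cl_one)"

definition taylor_coeff :: "'n::{finite,linorder} cfun \<Rightarrow> 'n multi \<Rightarrow> 'n clifford" where
  "taylor_coeff f m = (1 / multi_fact m) *\<^sub>R multi_deriv m f 0"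

definition CK_prod :: "'n::{finite,linorder} cfun \<Rightarrow> 'n cfun \<Rightarrow> 'n cfun"
    (infixl "\<odot>\<^sub>L" 70) where
  "(f \<odot>\<^sub>L g) x = (\<Sum>\<^sub>\<infinity>m. \<Sum>\<^sub>\<infinity>k.
     fueter (\<lambda>i. m i + k i) x \<cdot>\<^sub>c (taylor_coeff f m \<cdot>\<^sub>c taylor_coeff g k))"

lemma finite_fueter_sequences: "finite {js. \<forall>i. count_list js i = (m :: 'n::finite multi) i}"
proof (rule finite_subset)
  show "{js. \<forall>i. count_list js i = m i} \<subseteq> {js. set js \<subseteq> UNIV \<and> length js = multi_abs m}"
  proof safe
    fix js assume "\<forall>i. count_list js i = m i"
    then have "multi_abs m = (\<Sum>i\<in>UNIV. count_list js i)" by (simp add: multi_abs_def)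
    also have "\<dots> = (\<Sum>i\<in>set js. count_list js i)"
      by (rule sum.mono_neutral_right) (auto simp: count_list_0_iff)
    finally show "length js = multi_abs m" by (simp add: sum_count_set)
  qed simp
  show "finite {js. set js \<subseteq> (UNIV :: 'n set) \<and> length js = multi_abs m}"
    by (rule finite_lists_length_eq) simp
qed


section \<open>Proximate orders\<close>

definition proximate_order :: "(real \<Rightarrow> real) \<Rightarrow> real \<Rightarrow> bool" where
  "proximate_order \<rho> \<rho>\<^sub>0 \<longleftrightarrow> 0 \<le> \<rho>\<^sub>0 \<and> (\<forall>r\<ge>0. 0 \<le> \<rho> r) \<and> \<rho> differentiable_on {0..} \<and>
     (\<rho> \<longlongrightarrow> \<rho>\<^sub>0) at_top \<and> ((\<lambda>r. deriv \<rho> r * r * ln r) \<longlongrightarrow> 0) at_top"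

definition normalization :: "(real \<Rightarrow> real) \<Rightarrow> (real \<Rightarrow> real) \<Rightarrow> real \<Rightarrow> bool" where
  "normalization \<rho>' \<rho> \<rho>\<^sub>0 \<longleftrightarrow> proximate_order \<rho>' \<rho>\<^sub>0 \<and> (\<exists>r\<^sub>1>0. \<forall>r\<ge>r\<^sub>1. \<rho>' r = \<rho> r) \<and>
     strict_mono_on {0<..} (\<lambda>r. r powr \<rho>' r) \<and> (\<lambda>r. r powr \<rho>' r) ` {0<..} = {0<..}"

definition G_coeff :: "(real \<Rightarrow> real) \<Rightarrow> real \<Rightarrow> nat \<Rightarrow> real" where
  "G_coeff \<rho>' \<rho>\<^sub>0 q = (if q = 0 then 1 else
     (the_inv_into {0<..} (\<lambda>r. r powr \<rho>' r) (real q)) ^ q / (exp 1 * \<rho>\<^sub>0) powr (real q / \<rho>\<^sub>0))"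


section \<open>The spaces of entire monogenic functions\<close>

text \<open>
  In the origin \<open>0 powr \<rho> 0 = 0\<close>, also when \<open>\<rho> 0 = 0\<close>. In that degenerate case the other convention
  \<open>0\<^sup>0 = 1\<close> gives the same space and a norm that is equivalent for each \<open>\<sigma>\<close>.
\<close>

definition A_weighted :: "(real \<Rightarrow> real) \<Rightarrow> real \<Rightarrow> 'n::finite cfun \<Rightarrow> 'n paravector \<Rightarrow> real" where
  "A_weighted \<rho> \<sigma> f x = norm (f x) * exp (- \<sigma> * norm x powr \<rho> (norm x))"

definition A_norm :: "(real \<Rightarrow> real) \<Rightarrow> real \<Rightarrow> 'n::finite cfun \<Rightarrow> real" where
  "A_norm \<rho> \<sigma> f = (SUP x. A_weighted \<rho> \<sigma> f x)"

definition A_step :: "(real \<Rightarrow> real) \<Rightarrow> real \<Rightarrow> 'n::{finite,linorder} cfun set" where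
  "A_step \<rho> \<sigma> = {f. monogenic f \<and> bdd_above (range (A_weighted \<rho> \<sigma> f))}"

definition A_space :: "(real \<Rightarrow> real) \<Rightarrow> 'n::{finite,linorder} cfun set" where
  "A_space \<rho> = (\<Union>\<sigma>\<in>{0<..}. A_step \<rho> \<sigma>)"

text \<open>
  The locally convex inductive limit topology: a base of neighbourhoods of \<open>0\<close> is formed by the
  absolutely convex sets whose trace on each step is a neighbourhood of \<open>0\<close> in the norm of that step.
\<close>

definition A_nbhd :: "(real \<Rightarrow> real) \<Rightarrow> 'n::{finite,linorder} cfun set \<Rightarrow> bool" where
  "A_nbhd \<rho> W \<longleftrightarrow> W \<subseteq> A_space \<rho> \<and>
     (\<forall>f\<in>W. \<forall>g\<in>W. \<forall>s t. \<bar>s\<bar> + \<bar>t\<bar> \<le> 1 \<longrightarrow> (\<lambda>x. s *\<^sub>R f x + t *\<^sub>R g x) \<in> W) \<and>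
     (\<forall>\<sigma>>0. \<exists>\<epsilon>>0. \<forall>f\<in>A_step \<rho> \<sigma>. A_norm \<rho> \<sigma> f < \<epsilon> \<longrightarrow> f \<in> W)"

definition A_open :: "(real \<Rightarrow> real) \<Rightarrow> 'n::{finite,linorder} cfun set \<Rightarrow> bool" where
  "A_open \<rho> U \<longleftrightarrow> U \<subseteq> A_space \<rho> \<and>
     (\<forall>f\<in>U. \<exists>W. A_nbhd \<rho> W \<and> (\<forall>g\<in>W. (\<lambda>x. f x + g x) \<in> U))"

definition A_top :: "(real \<Rightarrow> real) \<Rightarrow> 'n::{finite,linorder} cfun topology" where
  "A_top \<rho> = topology (A_open \<rho>)"

lemma A_nbhd_Int:
  assumes "A_nbhd \<rho> V" "A_nbhd \<rho> W"
  shows "A_nbhd \<rho> (V \<inter> W)"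
  unfolding A_nbhd_def
proof (intro conjI allI impI)
  show "V \<inter> W \<subseteq> A_space \<rho>" using assms by (auto simp: A_nbhd_def)
  show "\<forall>f\<in>V \<inter> W. \<forall>g\<in>V \<inter> W. \<forall>s t. \<bar>s\<bar> + \<bar>t\<bar> \<le> 1 \<longrightarrow> (\<lambda>x. s *\<^sub>R f x + t *\<^sub>R g x) \<in> V \<inter> W"
    using assms unfolding A_nbhd_def by simp
  fix \<sigma> :: real assume "\<sigma> > 0"
  obtain a where a: "a > 0" "\<forall>f\<in>A_step \<rho> \<sigma>. A_norm \<rho> \<sigma> f < a \<longrightarrow> f \<in> V"
    using assms(1)[unfolded A_nbhd_def, THEN conjunct2, THEN conjunct2] \<open>\<sigma> > 0\<close> by blast
  obtain b where b: "b > 0" "\<forall>f\<in>A_step \<rho> \<sigma>. A_norm \<rho> \<sigma> f < b \<longrightarrow> f \<in> W"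
    using assms(2)[unfolded A_nbhd_def, THEN conjunct2, THEN conjunct2] \<open>\<sigma> > 0\<close> by blast
  from a b
  show "\<exists>\<epsilon>>0. \<forall>f\<in>A_step \<rho> \<sigma>. A_norm \<rho> \<sigma> f < \<epsilon> \<longrightarrow> f \<in> V \<inter> W"
    by (intro exI[of _ "min a b"]) auto
qed

lemma istopology_A_open: "istopology (A_open \<rho>)"
  unfolding istopology_def
proof (intro conjI allI impI)
  fix S T :: "'a cfun set" assume ST: "A_open \<rho> S" "A_open \<rho> T"
  show "A_open \<rho> (S \<inter> T)"
    unfolding A_open_def
  proof (intro conjI ballI)
    show "S \<inter> T \<subseteq> A_space \<rho>" using ST by (auto simp: A_open_def)
    fix f assume "f \<in> S \<inter> T"
    then have "f \<in> S" "f \<in> T" by auto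
    obtain V where V: "A_nbhd \<rho> V" "\<forall>g\<in>V. (\<lambda>x. f x + g x) \<in> S"
      using ST(1) \<open>f \<in> S\<close> unfolding A_open_def by blast
    obtain W where W: "A_nbhd \<rho> W" "\<forall>g\<in>W. (\<lambda>x. f x + g x) \<in> T"
      using ST(2) \<open>f \<in> T\<close> unfolding A_open_def by blast
    from V W A_nbhd_Int[OF V(1) W(1)]
    show "\<exists>W. A_nbhd \<rho> W \<and> (\<forall>g\<in>W. (\<lambda>x. f x + g x) \<in> S \<inter> T)"
      by (intro exI[of _ "V \<inter> W"]) simp
  qed
next
  fix K :: "'a cfun set set" assume "\<forall>S\<in>K. A_open \<rho> S"
  then have K: "A_open \<rho> S" if "S \<in> K" for S using that by blast
  show "A_open \<rho> (\<Union>K)"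
    unfolding A_open_def
  proof (intro conjI ballI)
    show "\<Union>K \<subseteq> A_space \<rho>" using K unfolding A_open_def by blast
    fix f assume "f \<in> \<Union>K"
    then obtain S where S: "S \<in> K" "f \<in> S" by blast
    then obtain W where "A_nbhd \<rho> W" "\<forall>g\<in>W. (\<lambda>x. f x + g x) \<in> S"
      using K[of S] unfolding A_open_def by blast
    with S show "\<exists>W. A_nbhd \<rho> W \<and> (\<forall>g\<in>W. (\<lambda>x. f x + g x) \<in> \<Union>K)" by blast
  qed
qed

lemma openin_A_top: "openin (A_top \<rho>) U \<longleftrightarrow> A_open \<rho> U"
  by (simp add: A_top_def istopology_A_open topology_inverse')


lemma monogenic_lincomb:
  assumes "monogenic f" "monogenic g"
  shows "monogenic (\<lambda>x. s *\<^sub>R f x + t *\<^sub>R g x)"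
proof -
  have d: "f differentiable at x" "g differentiable at x" for x
    using assms unfolding monogenic_def C1_fun_def by blast+
  have D: "dir_deriv v (\<lambda>x. s *\<^sub>R f x + t *\<^sub>R g x) = (\<lambda>x. s *\<^sub>R dir_deriv v f x + t *\<^sub>R dir_deriv v g x)" for v
  proof
    fix x
    have "((\<lambda>x. s *\<^sub>R f x + t *\<^sub>R g x) has_derivative
       (\<lambda>h. s *\<^sub>R frechet_derivative f (at x) h + t *\<^sub>R frechet_derivative g (at x) h)) (at x)"
      using d[of x] by (intro derivative_intros) (simp_all add: frechet_derivative_works[symmetric])
    from frechet_derivative_at[OF this]
    show "dir_deriv v (\<lambda>x. s *\<^sub>R f x + t *\<^sub>R g x) x = s *\<^sub>R dir_deriv v f x + t *\<^sub>R dir_deriv v g x"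
      unfolding dir_deriv_def by (rule fun_cong[OF sym])
  qed
  have "C1_fun (\<lambda>x. s *\<^sub>R f x + t *\<^sub>R g x)"
    using assms unfolding monogenic_def C1_fun_def D
    by (auto intro!: continuous_intros)
  moreover have "partial0 (\<lambda>x. s *\<^sub>R f x + t *\<^sub>R g x) x +
      (\<Sum>i\<in>UNIV. cl_unit i \<cdot>\<^sub>c partial i (\<lambda>x. s *\<^sub>R f x + t *\<^sub>R g x) x) = 0" for x
  proof -
    have "partial0 (\<lambda>x. s *\<^sub>R f x + t *\<^sub>R g x) x +
        (\<Sum>i\<in>UNIV. cl_unit i \<cdot>\<^sub>c partial i (\<lambda>x. s *\<^sub>R f x + t *\<^sub>R g x) x) =
      s *\<^sub>R (partial0 f x + (\<Sum>i\<in>UNIV. cl_unit i \<cdot>\<^sub>c partial i f x)) +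
      t *\<^sub>R (partial0 g x + (\<Sum>i\<in>UNIV. cl_unit i \<cdot>\<^sub>c partial i g x))"
      by (simp add: D cmul_bilinear sum.distrib scaleR_sum_right scaleR_right_distrib)
    also have "\<dots> = 0" using assms unfolding monogenic_def by (metis add_0_right scaleR_zero_right)
    finally show ?thesis .
  qed
  ultimately show ?thesis by (simp add: monogenic_def)
qed

lemma A_step_iff:
  "f \<in> A_step \<rho> \<sigma> \<longleftrightarrow>
     monogenic f \<and> (\<exists>C\<ge>0. \<forall>x. norm (f x) \<le> C * exp (\<sigma> * norm x powr \<rho> (norm x)))"
proof -
  have "A_weighted \<rho> \<sigma> f x \<le> C \<longleftrightarrow> norm (f x) \<le> C * exp (\<sigma> * norm x powr \<rho> (norm x))" for x C
    by (simp add: A_weighted_def exp_minus field_simps)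
  moreover have "bdd_above (range (A_weighted \<rho> \<sigma> f)) \<longleftrightarrow> (\<exists>C\<ge>0. \<forall>x. A_weighted \<rho> \<sigma> f x \<le> C)"
  proof
    assume "bdd_above (range (A_weighted \<rho> \<sigma> f))"
    then obtain C where C: "\<And>x. A_weighted \<rho> \<sigma> f x \<le> C"
      by (auto simp: bdd_above_def)
    have "0 \<le> A_weighted \<rho> \<sigma> f 0" by (simp add: A_weighted_def)
    then have "0 \<le> C" using C[of 0] by linarith
    then show "\<exists>C\<ge>0. \<forall>x. A_weighted \<rho> \<sigma> f x \<le> C" using C by blast
  next
    assume "\<exists>C\<ge>0. \<forall>x. A_weighted \<rho> \<sigma> f x \<le> C"
    then show "bdd_above (range (A_weighted \<rho> \<sigma> f))" by (metis bdd_aboveI2)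
  qed
  ultimately show ?thesis by (simp add: A_step_def)
qed

lemma A_space_lincomb:
  assumes "f \<in> A_space \<rho>" "g \<in> A_space \<rho>"
  shows "(\<lambda>x. s *\<^sub>R f x + t *\<^sub>R g x) \<in> A_space \<rho>"
proof -
  obtain a b where a: "a > 0" "f \<in> A_step \<rho> a" and b: "b > 0" "g \<in> A_step \<rho> b"
    using assms by (auto simp: A_space_def)
  obtain C where C: "C \<ge> 0" "\<And>x. norm (f x) \<le> C * exp (a * norm x powr \<rho> (norm x))"
    using a by (auto simp: A_step_iff)
  obtain D where D: "D \<ge> 0" "\<And>x. norm (g x) \<le> D * exp (b * norm x powr \<rho> (norm x))"
    using b by (auto simp: A_step_iff)
  have "norm (s *\<^sub>R f x + t *\<^sub>R g x) \<le>
      (\<bar>s\<bar> * C + \<bar>t\<bar> * D) * exp (max a b * norm x powr \<rho> (norm x))" for x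
  proof -
    have "norm (f x) \<le> C * exp (max a b * norm x powr \<rho> (norm x))"
      by (rule order_trans[OF C(2)]) (auto intro!: mult_left_mono mult_right_mono C(1))
    moreover have "norm (g x) \<le> D * exp (max a b * norm x powr \<rho> (norm x))"
      by (rule order_trans[OF D(2)]) (auto intro!: mult_left_mono mult_right_mono D(1))
    ultimately have "\<bar>s\<bar> * norm (f x) + \<bar>t\<bar> * norm (g x) \<le>
        \<bar>s\<bar> * (C * exp (max a b * norm x powr \<rho> (norm x))) +
        \<bar>t\<bar> * (D * exp (max a b * norm x powr \<rho> (norm x)))"
      by (intro add_mono mult_left_mono) auto
    then show ?thesis
      by (intro order_trans[OF norm_triangle_ineq]) (simp add: algebra_simps)
  qed
  moreover have "\<bar>s\<bar> * C + \<bar>t\<bar> * D \<ge> 0" using C D by simp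
  moreover have "monogenic (\<lambda>x. s *\<^sub>R f x + t *\<^sub>R g x)"
    using a b by (intro monogenic_lincomb) (auto simp: A_step_def)
  ultimately have "(\<lambda>x. s *\<^sub>R f x + t *\<^sub>R g x) \<in> A_step \<rho> (max a b)"
    unfolding A_step_iff by blast
  then show ?thesis using a by (auto simp: A_space_def intro!: bexI[of _ "max a b"])
qed

lemma topspace_A_top: "topspace (A_top \<rho>) = A_space \<rho>"
proof -
  have "A_nbhd \<rho> (A_space \<rho>)"
  proof -
    have "\<exists>\<epsilon>>0. \<forall>f\<in>A_step \<rho> \<sigma>. A_norm \<rho> \<sigma> f < \<epsilon> \<longrightarrow> f \<in> A_space \<rho>" if "\<sigma> > 0" for \<sigma>
      using that by (intro exI[of _ 1]) (auto simp: A_space_def)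
    then show ?thesis unfolding A_nbhd_def using A_space_lincomb by blast
  qed
  then have "A_open \<rho> (A_space \<rho>)"
    unfolding A_open_def using A_space_lincomb[of _ \<rho> _ 1 1] by auto
  then show ?thesis
    by (auto simp: topspace_def openin_A_top A_open_def)
qed


section \<open>Operators\<close>

text \<open>A formal operator \<open>\<Sum>m. u m \<odot>\<^sub>L \<partial>\<^sup>m\<close> is its coefficient family \<open>u\<close>.\<close>

definition D_ops ::
    "(real \<Rightarrow> real) \<Rightarrow> real \<Rightarrow> (real \<Rightarrow> real) \<Rightarrow> ('n::{finite,linorder} multi \<Rightarrow> 'n cfun) set" where
  "D_ops \<rho>\<^sub>1' o\<^sub>1 \<rho>\<^sub>2 = {u. (\<forall>m. u m \<in> A_space \<rho>\<^sub>2) \<and>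
     (\<forall>\<mu>>0. \<exists>\<sigma>>0. \<exists>C>0. \<forall>m. u m \<in> A_step \<rho>\<^sub>2 \<sigma> \<and>
        A_norm \<rho>\<^sub>2 \<sigma> (u m) \<le> C * (G_coeff \<rho>\<^sub>1' o\<^sub>1 (multi_abs m) / multi_fact m) * \<mu> ^ multi_abs m)}"

definition op_apply :: "('n::{finite,linorder} multi \<Rightarrow> 'n cfun) \<Rightarrow> 'n cfun \<Rightarrow> 'n cfun" where
  "op_apply u f x = (\<Sum>\<^sub>\<infinity>m. (u m \<odot>\<^sub>L multi_deriv m f) x)"

definition right_linear_hom ::
    "'n::{finite,linorder} cfun set \<Rightarrow> 'n cfun set \<Rightarrow> ('n cfun \<Rightarrow> 'n cfun) \<Rightarrow> bool" where
  "right_linear_hom A B F \<longleftrightarrow> (\<forall>f\<in>A. F f \<in> B) \<and>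
     (\<forall>f\<in>A. \<forall>g\<in>A. F (\<lambda>x. f x + g x) = (\<lambda>x. F f x + F g x)) \<and>
     (\<forall>f\<in>A. \<forall>a. F (\<lambda>x. f x \<cdot>\<^sub>c a) = (\<lambda>x. F f x \<cdot>\<^sub>c a))"

end

theory Submission
  imports Defs "HOL-Combinatorics.Multiset_Permutations"
begin

text \<open>
  The left factors \<open>1, e\<^sub>1, \<dots>, e\<^sub>n\<close> turn the radial derivative of a monogenic function into a combination of
  rotational derivatives. These integrate to zero against a radial kernel, so a function that is merely \<open>C\<^sup>1\<close>
  and monogenic equals its weighted averages over all balls. This gives smoothness and Cauchy estimates without a
  Cauchy integral formula. Along a ray the derivative of \<open>f\<close> is \<open>\<Sum>j. z\<^sub>j \<partial>\<^sub>j f\<close>, whose iteration is the Taylor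
  expansion in Fueter polynomials.

  On the hyperplane \<open>x\<^sub>0 = 0\<close> a Fueter polynomial is a monomial and the CK-product is the pointwise product, and
  monogenic functions are determined there. Algebraic identities are therefore checked on the hyperplane, while norms are
  controlled by the series of the norms of the Taylor terms, which is bounded by the maximum of the function on a
  proportionally larger ball. For a proximate order all constants that are geometric in \<open>|m|\<close> and all dilations of
  the argument are absorbed by changing \<open>\<sigma>\<close>.

  A continuous homomorphism \<open>F\<close> is bounded from each step into some step. The coefficients of its operator
  are \<open>u\<^sub>m = \<Sum>l\<le>m. (- 1)\<^bsup>|m - l|\<^esup> / (l! (m - l)!) F(V\<^sub>l) \<odot> V\<^bsub>m - l\<^esub>\<close>, the binomial inversion of
  \<open>F(V\<^sub>m) = P V\<^sub>m\<close>.
\<close>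

section \<open>Integration by parts for compactly supported functions\<close>

text \<open>Up to geometric factors, membership in \<open>A_space\<close> is a condition on the
  Taylor coefficients, with the reciprocal of \<open>Phi\<close> at the degree as gauge. One half is
  the Cauchy estimate on the ball of radius \<open>phi q\<close>: the growth function has the value
  q there, so the exponential weight costs only the q-th power of a constant. The other half is
  \<open>power_le_Phi\<close>: for every factor mu there are sigma and C, uniform in q and r, with
  (mu r)^q at most C Phi(q) exp(sigma growth(r)). The averaging kernel, the noncommuting Fueter
  variables and the norm of the product all lose geometric factors. The quantifier over every lambda
  in \<open>D_ops\<close> makes this harmless, and it is used in opposite orders in the two
  directions. For an operator acting on f, the step of f fixes the loss and lambda is then chosen
  small enough to beat it. For the operator of a homomorphism, lambda comes first; the Fueter
  polynomials are placed in a step depending on lambda, and boundedness of the homomorphism on that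
  step yields sigma.\<close>

abbreviation qbox :: "'a::euclidean_space set" where
  "qbox \<equiv> cbox (- 2 *\<^sub>R One) (2 *\<^sub>R One)"

text \<open>A cube replaces a ball because differentiation under the integral sign is applied on a
  \<open>cbox\<close>. Its size leaves room: a function supported in the unit ball and translated by
  a vector of norm at most 1 is still supported in the ball of radius 2.\<close>

lemma cball_subset_qbox: "cball 0 2 \<subseteq> (qbox :: 'a::euclidean_space set)"
proof
  fix x :: 'a assume "x \<in> cball 0 2"
  then have "\<bar>x \<bullet> b\<bar> \<le> 2" if "b \<in> Basis" for b
    using Basis_le_norm[OF that, of x] by simp
  then show "x \<in> qbox" by (fastforce simp: mem_box abs_le_iff)
qed

text \<open>Small translations of a function supported in the unit ball do not change its integral,
  so \<open>I t\<close> is constant near 0. Differentiating under the integral at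
  \<open>t = 0\<close> gives the claim.\<close>

lemma integral_derivative_compact_support:
  fixes g :: "'a::euclidean_space \<Rightarrow> 'b::euclidean_space"
  assumes der: "\<And>x. (g has_derivative g' x) (at x)"
    and cont: "continuous_on UNIV (\<lambda>x. g' x v)"
    and supp: "\<And>x. norm x \<ge> 1 \<Longrightarrow> g x = 0"
    and v: "norm v \<le> 1"
  shows "integral qbox (\<lambda>x. g' x v) = 0"
proof -
  define I where "I t = integral qbox (\<lambda>x. g (x + t *\<^sub>R v))" for t
  have gc: "continuous_on UNIV g"
    using der by (intro has_derivative_continuous_on) auto
  have gi: "(\<lambda>x. g (x + t *\<^sub>R v)) integrable_on qbox" for t
    by (intro integrable_continuous continuous_on_compose2[OF gc] continuous_intros) auto
  have const: "I t = I 0" if "\<bar>t\<bar> \<le> 1" for t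
  proof -
    have "(g has_integral I 0) qbox"
      unfolding I_def using gi[of 0] by (simp add: integrable_integral)
    from has_integral_affinity[OF this, of 1 "t *\<^sub>R v"]
    have "((\<lambda>x. g (x + t *\<^sub>R v)) has_integral I 0) ((\<lambda>x. x - t *\<^sub>R v) ` qbox)"
      by simp
    then have U: "((\<lambda>x. g (x + t *\<^sub>R v)) has_integral I 0) UNIV"
    proof (rule has_integral_on_superset)
      fix x assume "x \<notin> (\<lambda>x. x - t *\<^sub>R v) ` qbox"
      then have "x + t *\<^sub>R v \<notin> qbox" by (metis add_diff_cancel_right' image_eqI)
      then have "x + t *\<^sub>R v \<notin> cball 0 2" using cball_subset_qbox by blast
      then show "g (x + t *\<^sub>R v) = 0" by (intro supp) simp
    qed simp
    have "(\<lambda>x. if x \<in> qbox then g (x + t *\<^sub>R v) else 0) = (\<lambda>x. g (x + t *\<^sub>R v))"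
    proof
      fix x show "(if x \<in> qbox then g (x + t *\<^sub>R v) else 0) = g (x + t *\<^sub>R v)"
      proof (cases "x \<in> qbox")
        case False
        then have "norm x > 2" using cball_subset_qbox[where 'a = 'a] by (auto simp: subset_eq)
        moreover have "norm x \<le> norm (x + t *\<^sub>R v) + norm (t *\<^sub>R v)"
          by (metis add_diff_cancel_right' norm_triangle_ineq4)
        moreover have "norm (t *\<^sub>R v) \<le> 1" using that v by (simp add: mult_le_one)
        ultimately show ?thesis using False supp[of "x + t *\<^sub>R v"] by simp
      qed simp
    qed
    then have "((\<lambda>x. g (x + t *\<^sub>R v)) has_integral I 0) qbox"
      using U has_integral_restrict_UNIV[of qbox "\<lambda>x. g (x + t *\<^sub>R v)" "I 0"] by simp
    then show ?thesis by (simp add: I_def integral_unique)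
  qed
  have "(I has_vector_derivative integral qbox (\<lambda>x. g' (x + 0 *\<^sub>R v) v)) (at 0 within UNIV)"
    unfolding I_def
  proof (rule leibniz_rule_vector_derivative)
    show "((\<lambda>t. g (x + t *\<^sub>R v)) has_vector_derivative g' (x + t *\<^sub>R v) v) (at t within UNIV)" for t x
    proof -
      have "((\<lambda>t. g (x + t *\<^sub>R v)) has_derivative (\<lambda>h. g' (x + t *\<^sub>R v) (h *\<^sub>R v))) (at t)"
        by (rule has_derivative_compose[OF _ der]) (auto intro!: derivative_eq_intros)
      moreover have "linear (g' (x + t *\<^sub>R v))" using der has_derivative_linear by blast
      ultimately show ?thesis by (simp add: has_vector_derivative_def linear_cmul)
    qed
    show "continuous_on (UNIV \<times> qbox) (\<lambda>(t, x). g' (x + t *\<^sub>R v) v)"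
      unfolding split_beta by (intro continuous_on_compose2[OF cont] continuous_intros) auto
  qed (use gi in auto)
  then have "(I has_vector_derivative integral qbox (\<lambda>x. g' x v)) (at 0)" by simp
  then have "((\<lambda>t. I 0) has_vector_derivative integral qbox (\<lambda>x. g' x v)) (at 0)"
    by (rule has_vector_derivative_transform_within_open[of _ _ _ "{-1<..<1}"]) (auto intro: const)
  from vector_derivative_unique_at[OF has_vector_derivative_const this] show ?thesis by simp
qed

text \<open>The truncated paraboloid has a corner at the unit sphere, but its square is of class C^1
  with gradient \<open>- 4 * bump y\<close> times y. This suffices for one integration by parts, and
  a gradient parallel to y is what makes rotational derivatives integrate to zero.\<close>

definition bump :: "'a::euclidean_space \<Rightarrow> real" where
  "bump y = max 0 (1 - y \<bullet> y)"

lemma bump_nonneg: "bump y \<ge> 0" by (simp add: bump_def)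

lemma bump_eq_0: "norm y \<ge> 1 \<Longrightarrow> bump y = 0"
  using power_mono[of 1 "norm y" 2] by (simp add: bump_def power2_norm_eq_inner max_def)

lemma continuous_on_bump [continuous_intros]:
  "continuous_on S f \<Longrightarrow> continuous_on S (\<lambda>x. bump (f x))"
  unfolding bump_def by (intro continuous_intros)

lemma has_real_derivative_max0_sq: "((\<lambda>s::real. (max 0 s)\<^sup>2) has_real_derivative 2 * max 0 s) (at s)"
proof (cases s "0 :: real" rule: linorder_cases)
  case less
  have "((\<lambda>s::real. 0) has_real_derivative 0) (at s)" by simp
  from has_field_derivative_transform_within_open[OF this, of "{..<0}"] less
  show ?thesis by simp
next
  case greater
  have "((\<lambda>s::real. s\<^sup>2) has_real_derivative 2 * s) (at s)"
    by (auto intro!: derivative_eq_intros)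
  from has_field_derivative_transform_within_open[OF this, of "{0<..}"] greater
  show ?thesis by simp
next
  case equal
  have "((\<lambda>h::real. (max 0 h)\<^sup>2 / h) \<longlongrightarrow> 0) (at 0)"
  proof (rule Lim_null_comparison[where g = "\<lambda>h. \<bar>h\<bar>"])
    have "norm ((max 0 h)\<^sup>2 / h) \<le> \<bar>h\<bar>" for h :: real
      by (cases "h > 0") (auto simp: power2_eq_square max_def)
    then show "\<forall>\<^sub>F h in at 0. norm ((max 0 h)\<^sup>2 / h :: real) \<le> \<bar>h\<bar>" by simp
    show "((\<lambda>h::real. \<bar>h\<bar>) \<longlongrightarrow> 0) (at 0)" by (auto intro!: tendsto_eq_intros)
  qed
  then show ?thesis using equal by (simp add: DERIV_def)
qed

lemma has_derivative_bump_sq: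
  "((\<lambda>y. (bump y)\<^sup>2) has_derivative (\<lambda>v. - 4 * bump y * (y \<bullet> v))) (at y)"
proof -
  have "((\<lambda>y. 1 - y \<bullet> y) has_derivative (\<lambda>v. - 2 * (y \<bullet> v))) (at y)"
    by (auto intro!: derivative_eq_intros simp: inner_commute)
  from has_derivative_compose[OF this has_field_derivative_imp_has_derivative[OF has_real_derivative_max0_sq]]
  show ?thesis by (simp add: bump_def algebra_simps)
qed

definition bump_mass :: "'a::euclidean_space itself \<Rightarrow> real" where
  "bump_mass _ = integral (qbox :: 'a set) (\<lambda>y. (bump y)\<^sup>2)"

lemma bump_mass_pos: "bump_mass TYPE('a::euclidean_space) > 0"
proof -
  have c: "continuous_on qbox (\<lambda>y::'a. (bump y)\<^sup>2)" by (intro continuous_intros)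
  have "bump_mass TYPE('a) \<ge> 0"
    unfolding bump_mass_def by (intro integral_nonneg integrable_continuous c) auto
  moreover have "bump_mass TYPE('a) \<noteq> 0"
  proof
    assume "bump_mass TYPE('a) = 0"
    then have "((\<lambda>y::'a. (bump y)\<^sup>2) has_integral 0) qbox"
      unfolding bump_mass_def using integrable_integral[OF integrable_continuous[OF c]] by simp
    moreover have "box (- 2 *\<^sub>R One) (2 *\<^sub>R One) \<noteq> ({} :: 'a set)"
      by (auto simp: box_ne_empty)
    ultimately have "(bump (0::'a))\<^sup>2 = 0"
      using cball_subset_qbox[where 'a = 'a]
      by (intro has_integral_0_cbox_imp_0[OF c]) (auto simp: subset_eq)
    then show False by (simp add: bump_def)
  qed
  ultimately show ?thesis by simp
qed

section \<open>Monogenic functions are averages of themselves\<close>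

lemma C1_has_derivative:
  assumes "C1_fun f"
  shows "(f has_derivative (\<lambda>v. dir_deriv v f x)) (at x)"
proof -
  have "f differentiable at x" using assms unfolding C1_fun_def by blast
  then show ?thesis unfolding dir_deriv_def using frechet_derivative_works by blast
qed

lemma C1_continuous:
  assumes "C1_fun f"
  shows "continuous_on S (dir_deriv v f)" "continuous_on S f"
proof -
  show "continuous_on S (dir_deriv v f)"
    using assms continuous_on_subset[of UNIV _ S] unfolding C1_fun_def by blast
  show "continuous_on S f"
    by (rule has_derivative_continuous_on[OF has_derivative_at_withinI[OF C1_has_derivative[OF assms]]])
qed

lemma dir_deriv_eqI: "(f has_derivative f') (at x) \<Longrightarrow> dir_deriv v f x = f' v"
  unfolding dir_deriv_def by (rule fun_cong[OF frechet_derivative_at[symmetric]])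

lemma C1_funI:
  assumes "\<And>x. (f has_derivative f' x) (at x)" "\<And>v. continuous_on UNIV (\<lambda>x. f' x v)"
  shows "C1_fun f"
proof -
  have "dir_deriv v f = (\<lambda>x. f' x v)" for v
    by (rule ext) (rule dir_deriv_eqI[OF assms(1)])
  moreover have "f differentiable at x" for x
    using assms(1) unfolding differentiable_def by blast
  ultimately show ?thesis
    unfolding C1_fun_def using assms(2) by presburger
qed

text \<open>The derivative falls on \<open>f\<close>, so a merely continuous kernel is enough. It is
  bundled into a bounded linear map because the Leibniz rule for a vector parameter integrates such
  maps.\<close>

lemma has_derivative_conv:
  fixes f :: "'n::finite cfun"
  assumes f: "C1_fun f" and k: "continuous_on UNIV k"
  shows "((\<lambda>x. integral qbox (\<lambda>y. k y *\<^sub>R f (x + s *\<^sub>R y))) has_derivative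
           (\<lambda>v. integral qbox (\<lambda>y. k y *\<^sub>R dir_deriv v f (x + s *\<^sub>R y)))) (at x)"
proof -
  define D where "D x = Blinfun (\<lambda>v. dir_deriv v f x)" for x
  have D: "blinfun_apply (D x) v = dir_deriv v f x" for x v
    unfolding D_def
    by (subst bounded_linear_Blinfun_apply)
      (use has_derivative_bounded_linear[OF C1_has_derivative[OF f]] in auto)
  have Dc: "continuous_on UNIV D"
    by (intro continuous_on_blinfun_componentwise) (simp add: D C1_continuous[OF f])
  have "((\<lambda>x. integral qbox (\<lambda>y. k y *\<^sub>R f (x + s *\<^sub>R y))) has_derivative
      blinfun_apply (integral qbox (\<lambda>y. k y *\<^sub>R D (x + s *\<^sub>R y)))) (at x within UNIV)"
  proof (rule leibniz_rule)
    fix x y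
    have "((\<lambda>x. f (x + s *\<^sub>R y)) has_derivative (\<lambda>v. dir_deriv v f (x + s *\<^sub>R y))) (at x)"
      by (rule has_derivative_compose[OF has_derivative_add_const[OF has_derivative_ident] C1_has_derivative[OF f]])
    then show "((\<lambda>x. k y *\<^sub>R f (x + s *\<^sub>R y)) has_derivative
        blinfun_apply (k y *\<^sub>R D (x + s *\<^sub>R y))) (at x within UNIV)"
      by (auto intro!: derivative_eq_intros simp: scaleR_blinfun.rep_eq D)
  next
    fix x
    show "(\<lambda>y. k y *\<^sub>R f (x + s *\<^sub>R y)) integrable_on qbox"
      by (intro integrable_continuous continuous_intros continuous_on_compose2[OF k]
          continuous_on_compose2[OF C1_continuous(2)[OF f]]) auto
    show "continuous_on (UNIV \<times> qbox) (\<lambda>(x, y). k y *\<^sub>R D (x + s *\<^sub>R y))"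
      unfolding split_beta
      by (intro continuous_intros continuous_on_compose2[OF k] continuous_on_compose2[OF Dc]) auto
  qed auto
  moreover have "blinfun_apply (integral qbox (\<lambda>y. k y *\<^sub>R D (x + s *\<^sub>R y))) =
      (\<lambda>v. integral qbox (\<lambda>y. k y *\<^sub>R dir_deriv v f (x + s *\<^sub>R y)))"
  proof
    fix v
    show "blinfun_apply (integral qbox (\<lambda>y. k y *\<^sub>R D (x + s *\<^sub>R y))) v =
      integral qbox (\<lambda>y. k y *\<^sub>R dir_deriv v f (x + s *\<^sub>R y))"
      by (subst blinfun_apply_integral)
       (simp_all only: scaleR_blinfun.rep_eq D, intro integrable_continuous continuous_intros
        continuous_on_compose2[OF k] continuous_on_compose2[OF Dc], simp_all)
  qed
  ultimately show ?thesis by simp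
qed

text \<open>The affine factor serves two uses: \<open>c = 0\<close> with an inner product for
  \<open>l\<close> gives rotational derivatives, while \<open>c = 1\<close> with
  \<open>l = 0\<close> moves a single derivative onto the kernel. The factor \<open>s\<close> comes
  from the chain rule.\<close>

lemma integral_bump_sq_dir_deriv:
  fixes f :: "'n::finite cfun"
  assumes f: "C1_fun f" and v: "norm v \<le> 1" and l: "linear l"
  shows "s *\<^sub>R integral qbox (\<lambda>y. ((bump y)\<^sup>2 * (c + l y)) *\<^sub>R dir_deriv v f (x + s *\<^sub>R y)) =
    integral qbox (\<lambda>y. (4 * bump y * (y \<bullet> v) * (c + l y) - (bump y)\<^sup>2 * l v) *\<^sub>R f (x + s *\<^sub>R y))"
proof -
  have ld: "(l has_derivative l) (at y)" for y
    using l by (simp add: linear_imp_has_derivative)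
  have lc: "continuous_on S l" for S
    using l linear_continuous_on linear_conv_bounded_linear by blast
  note C = C1_continuous[OF f]
  define g where "g y = ((bump y)\<^sup>2 * (c + l y)) *\<^sub>R f (x + s *\<^sub>R y)" for y
  define g' where "g' y w = ((bump y)\<^sup>2 * (c + l y)) *\<^sub>R (s *\<^sub>R dir_deriv w f (x + s *\<^sub>R y)) -
      (4 * bump y * (y \<bullet> w) * (c + l y) - (bump y)\<^sup>2 * l w) *\<^sub>R f (x + s *\<^sub>R y)" for y w
  have dl: "linear (\<lambda>v. dir_deriv v f z)" for z
    by (rule has_derivative_linear[OF C1_has_derivative[OF f]])
  have fd: "((\<lambda>y. f (x + s *\<^sub>R y)) has_derivative (\<lambda>w. s *\<^sub>R dir_deriv w f (x + s *\<^sub>R y))) (at y)" for y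
  proof -
    have "((\<lambda>y. x + s *\<^sub>R y) has_derivative (\<lambda>w. s *\<^sub>R w)) (at y)"
      using has_derivative_add[OF has_derivative_const has_derivative_scaleR_right[OF has_derivative_ident]]
      by simp
    from has_derivative_compose[OF this C1_has_derivative[OF f]]
    show ?thesis unfolding linear_cmul[OF dl] .
  qed
  have "integral qbox (\<lambda>y. g' y v) = 0"
  proof (rule integral_derivative_compact_support[OF _ _ _ v])
    show "(g has_derivative g' y) (at y)" for y
    proof -
      have "((\<lambda>y. (bump y)\<^sup>2 * (c + l y)) has_derivative
          (\<lambda>w. (bump y)\<^sup>2 * l w + - 4 * bump y * (y \<bullet> w) * (c + l y))) (at y)"
        using has_derivative_mult[OF has_derivative_bump_sq has_derivative_add[OF has_derivative_const ld]]
        by simp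
      from has_derivative_scaleR[OF this fd[of y]]
      show ?thesis unfolding g_def g'_def by (rule has_derivative_eq_rhs) (rule ext, simp add: algebra_simps)
    qed
    show "continuous_on UNIV (\<lambda>y. g' y v)"
      unfolding g'_def
      by (intro continuous_intros lc continuous_on_compose2[OF C(1)[of UNIV]] continuous_on_compose2[OF C(2)[of UNIV]]) auto
    show "g y = 0" if "norm y \<ge> 1" for y
      using that by (simp add: g_def bump_eq_0)
  qed
  moreover have "integral qbox (\<lambda>y. g' y v) =
    integral qbox (\<lambda>y. s *\<^sub>R (((bump y)\<^sup>2 * (c + l y)) *\<^sub>R dir_deriv v f (x + s *\<^sub>R y))) -
    integral qbox (\<lambda>y. (4 * bump y * (y \<bullet> v) * (c + l y) - (bump y)\<^sup>2 * l v) *\<^sub>R f (x + s *\<^sub>R y))"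
    unfolding g'_def
    by (subst integral_diff[symmetric])
     (auto intro!: integrable_continuous continuous_intros lc continuous_on_compose2[OF C(1)[of UNIV]]
       continuous_on_compose2[OF C(2)[of UNIV]] simp: ac_simps)
  ultimately show ?thesis unfolding integral_cmul by simp
qed

section \<open>The radial derivative as a combination of rotations, and the mean value
  property\<close>

interpretation cmul: bounded_bilinear "(\<cdot>\<^sub>c) :: 'n::{finite,linorder} clifford \<Rightarrow> _"
  using bilinear_cmul by (simp add: bilinear_conv_bounded_bilinear)

lemma cl_unit_mult_swap:
  "cl_unit i \<cdot>\<^sub>c (cl_unit j \<cdot>\<^sub>c z) = - (cl_unit j \<cdot>\<^sub>c (cl_unit i \<cdot>\<^sub>c z)) - (if i = j then 2 *\<^sub>R z else 0)"
proof (cases "i = j")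
  case True
  then show ?thesis
    by (simp add: cl_unit_square cl_one_cmul cmul.minus_left scaleR_2 flip: cmul_assoc)
next
  case False
  then have "cl_unit i \<cdot>\<^sub>c cl_unit j = - (cl_unit j \<cdot>\<^sub>c cl_unit i)"
    using cl_unit_anticommute eq_neg_iff_add_eq_0 by blast
  then show ?thesis using False by (simp add: cmul.minus_left flip: cmul_assoc)
qed

text \<open>Here a and b stand for the partial derivatives at a point and (t, y) for the radial
  direction. Eliminating a from the first sum leaves - t a and the double sum of y_j e_j e_i b_i. In
  the second sum, e_j e_i + e_i e_j = -2 for i = j and 0 otherwise reproduces that double sum plus
  the missing sum of y_j b_j.\<close>

lemma clifford_radial_identity:
  fixes a :: "'n::{finite,linorder} clifford"
  assumes "a + (\<Sum>i\<in>UNIV. cl_unit i \<cdot>\<^sub>c b i) = 0"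
  shows "t *\<^sub>R a + (\<Sum>i\<in>UNIV. y i *\<^sub>R b i) =
    - (\<Sum>i\<in>UNIV. cl_unit i \<cdot>\<^sub>c (t *\<^sub>R b i - y i *\<^sub>R a)) +
    (\<Sum>j\<in>UNIV. \<Sum>i\<in>UNIV. (1/2) *\<^sub>R (cl_unit j \<cdot>\<^sub>c (cl_unit i \<cdot>\<^sub>c (y j *\<^sub>R b i - y i *\<^sub>R b j))))"
proof -
  have a: "a = - (\<Sum>i\<in>UNIV. cl_unit i \<cdot>\<^sub>c b i)" using assms eq_neg_iff_add_eq_0 by blast
  define e where "e j i = cl_unit j \<cdot>\<^sub>c (cl_unit i \<cdot>\<^sub>c b i)" for j i
  define e' where "e' j i = cl_unit i \<cdot>\<^sub>c (cl_unit j \<cdot>\<^sub>c b i)" for j i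
  have 1: "(\<Sum>i\<in>UNIV. cl_unit i \<cdot>\<^sub>c (t *\<^sub>R b i - y i *\<^sub>R a)) =
      t *\<^sub>R (- a) + (\<Sum>j\<in>UNIV. \<Sum>i\<in>UNIV. y j *\<^sub>R e j i)"
    by (simp add: a e_def cmul.diff_right cmul.add_right cmul.scaleR_right cmul.minus_right cmul.sum_right
        sum.distrib sum_subtractf sum_negf scaleR_sum_right)
  have sw: "(\<Sum>j\<in>UNIV. \<Sum>i\<in>UNIV. y i *\<^sub>R (cl_unit j \<cdot>\<^sub>c (cl_unit i \<cdot>\<^sub>c b j))) =
      (\<Sum>j\<in>UNIV. \<Sum>i\<in>UNIV. y j *\<^sub>R e' j i)"
    by (subst sum.swap) (simp add: e'_def)
  have "(\<Sum>j\<in>UNIV. \<Sum>i\<in>UNIV. (1/2) *\<^sub>R (cl_unit j \<cdot>\<^sub>c (cl_unit i \<cdot>\<^sub>c (y j *\<^sub>R b i - y i *\<^sub>R b j)))) =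
      (1/2) *\<^sub>R ((\<Sum>j\<in>UNIV. \<Sum>i\<in>UNIV. y j *\<^sub>R e j i) -
       (\<Sum>j\<in>UNIV. \<Sum>i\<in>UNIV. y i *\<^sub>R (cl_unit j \<cdot>\<^sub>c (cl_unit i \<cdot>\<^sub>c b j))))"
    by (simp add: e_def cmul.diff_right cmul.scaleR_right sum_subtractf scaleR_sum_right scaleR_diff_right)
  also have "\<dots> = (\<Sum>j\<in>UNIV. \<Sum>i\<in>UNIV. (1/2) *\<^sub>R (y j *\<^sub>R e j i - y j *\<^sub>R e' j i))"
    unfolding sw by (simp add: sum_subtractf scaleR_sum_right scaleR_diff_right)
  also have "\<dots> = (\<Sum>j\<in>UNIV. \<Sum>i\<in>UNIV. y j *\<^sub>R e j i + (if i = j then y j *\<^sub>R b i else 0))"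
  proof (intro sum.cong refl)
    fix i j
    have e': "e' j i = - e j i - (if i = j then 2 *\<^sub>R b i else 0)"
      unfolding e_def e'_def by (rule cl_unit_mult_swap)
    show "(1/2) *\<^sub>R (y j *\<^sub>R e j i - y j *\<^sub>R e' j i) = y j *\<^sub>R e j i + (if i = j then y j *\<^sub>R b i else 0)"
      unfolding e' by (auto simp: vec_eq_iff field_simps)
  qed
  also have "\<dots> = (\<Sum>j\<in>UNIV. \<Sum>i\<in>UNIV. y j *\<^sub>R e j i) + (\<Sum>j\<in>UNIV. y j *\<^sub>R b j)"
    by (simp add: sum.distrib)
  finally show ?thesis unfolding 1 by simp
qed

lemma monogenic_C1: "monogenic f \<Longrightarrow> C1_fun f"
  and monogenic_eq: "monogenic f \<Longrightarrow> partial0 f x + (\<Sum>i\<in>UNIV. cl_unit i \<cdot>\<^sub>c partial i f x) = 0"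
  unfolding monogenic_def by blast+

lemma dir_deriv_linear: "C1_fun f \<Longrightarrow> linear (\<lambda>v. dir_deriv v f x)"
  using has_derivative_linear[OF C1_has_derivative] by blast

lemma dir_deriv_expand:
  assumes "C1_fun f"
  shows "dir_deriv v f x = fst v *\<^sub>R partial0 f x + (\<Sum>i\<in>UNIV. (snd v $ i) *\<^sub>R partial i f x)"
proof -
  note l = dir_deriv_linear[OF assms, of x]
  have "v = fst v *\<^sub>R (1, 0) + (\<Sum>i\<in>UNIV. (snd v $ i) *\<^sub>R (0, axis i 1))"
    by (simp add: prod_eq_iff fst_sum snd_sum vec_eq_iff axis_def if_distrib cong: if_cong)
  then have "dir_deriv v f x = dir_deriv (fst v *\<^sub>R (1, 0) + (\<Sum>i\<in>UNIV. (snd v $ i) *\<^sub>R (0, axis i 1))) f x"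
    by simp
  also have "\<dots> = fst v *\<^sub>R partial0 f x + (\<Sum>i\<in>UNIV. (snd v $ i) *\<^sub>R partial i f x)"
    by (simp only: linear_add[OF l] linear_sum[OF l] linear_cmul[OF l])
  finally show ?thesis .
qed

text \<open>Integration by parts gives both halves the kernel 4 bump(y) (y.u)(y.v) - bump(y)^2
  (u.v), which is symmetric in u and v. Dividing by the chain rule factor requires
  \<open>s \<noteq> 0\<close>.\<close>

lemma has_integral_bump_rotation:
  fixes f :: "'n::finite cfun"
  assumes f: "C1_fun f" and u: "norm u \<le> 1" and v: "norm v \<le> 1" and s: "s \<noteq> 0"
  shows "((\<lambda>y. (bump y)\<^sup>2 *\<^sub>R ((y \<bullet> u) *\<^sub>R dir_deriv v f (x + s *\<^sub>R y) -
     (y \<bullet> v) *\<^sub>R dir_deriv u f (x + s *\<^sub>R y))) has_integral 0) qbox"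
proof -
  note C = C1_continuous[OF f, of UNIV]
  have i: "(\<lambda>y. ((bump y)\<^sup>2 * (0 + y \<bullet> a)) *\<^sub>R dir_deriv b f (x + s *\<^sub>R y)) integrable_on qbox" for a b
    by (intro integrable_continuous continuous_intros continuous_on_compose2[OF C(1)]) auto
  have "s *\<^sub>R integral qbox (\<lambda>y. ((bump y)\<^sup>2 * (0 + y \<bullet> u)) *\<^sub>R dir_deriv v f (x + s *\<^sub>R y)) =
     s *\<^sub>R integral qbox (\<lambda>y. ((bump y)\<^sup>2 * (0 + y \<bullet> v)) *\<^sub>R dir_deriv u f (x + s *\<^sub>R y))"
    unfolding integral_bump_sq_dir_deriv[OF f v bounded_linear.linear[OF bounded_linear_inner_left]]
      integral_bump_sq_dir_deriv[OF f u bounded_linear.linear[OF bounded_linear_inner_left]]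
    by (simp add: inner_commute mult_ac)
  then have "integral qbox (\<lambda>y. ((bump y)\<^sup>2 * (0 + y \<bullet> u)) *\<^sub>R dir_deriv v f (x + s *\<^sub>R y)) =
     integral qbox (\<lambda>y. ((bump y)\<^sup>2 * (0 + y \<bullet> v)) *\<^sub>R dir_deriv u f (x + s *\<^sub>R y))"
    using s by (simp only: real_vector.scale_cancel_left) simp
  with has_integral_diff[OF integrable_integral[OF i[of u v]] integrable_integral[OF i[of v u]]]
  show ?thesis by (simp add: scaleR_diff_right)
qed

lemma has_integral_bump_radial:
  fixes f :: "'n::{finite,linorder} cfun"
  assumes f: "monogenic f" and s: "s \<noteq> 0"
  shows "((\<lambda>y. (bump y)\<^sup>2 *\<^sub>R dir_deriv y f (x + s *\<^sub>R y)) has_integral 0) qbox"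
proof -
  note C1 = monogenic_C1[OF f]
  define R where "R u v y = (bump y)\<^sup>2 *\<^sub>R ((y \<bullet> u) *\<^sub>R dir_deriv v f (x + s *\<^sub>R y) -
     (y \<bullet> v) *\<^sub>R dir_deriv u f (x + s *\<^sub>R y))" for u v y
  let ?e = "\<lambda>i. (0, axis i 1) :: 'n paravector"
  have R: "(R u v has_integral 0) qbox" if "norm u \<le> 1" "norm v \<le> 1" for u v
    unfolding R_def using that by (intro has_integral_bump_rotation C1 s)
  have n: "norm ((1, 0) :: 'n paravector) \<le> 1" "norm (?e i) \<le> 1" for i
    by (simp_all add: norm_prod_def)
  have cm: "((\<lambda>y. a \<cdot>\<^sub>c g y) has_integral 0) qbox" if "(g has_integral 0) qbox" for a g
    using has_integral_linear[OF that cmul.bounded_linear_right[of a]] by (simp add: o_def cmul.zero_right)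
  have "((\<lambda>y. - (\<Sum>i\<in>UNIV. cl_unit i \<cdot>\<^sub>c R (1, 0) (?e i) y) +
      (\<Sum>j\<in>UNIV. \<Sum>i\<in>UNIV. (1/2) *\<^sub>R (cl_unit j \<cdot>\<^sub>c (cl_unit i \<cdot>\<^sub>c R (?e j) (?e i) y))))
      has_integral - (\<Sum>i\<in>(UNIV::'n set). 0) + (\<Sum>j\<in>(UNIV::'n set). \<Sum>i\<in>(UNIV::'n set). (1/2) *\<^sub>R 0)) qbox"
    by (intro has_integral_add has_integral_neg has_integral_sum has_integral_cmul cm R n) auto
  moreover have "- (\<Sum>i\<in>UNIV. cl_unit i \<cdot>\<^sub>c R (1, 0) (?e i) y) +
      (\<Sum>j\<in>UNIV. \<Sum>i\<in>UNIV. (1/2) *\<^sub>R (cl_unit j \<cdot>\<^sub>c (cl_unit i \<cdot>\<^sub>c R (?e j) (?e i) y))) =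
      (bump y)\<^sup>2 *\<^sub>R dir_deriv y f (x + s *\<^sub>R y)" for y
  proof -
    have in1: "y \<bullet> (1, 0) = fst y" "y \<bullet> ?e i = snd y $ i" for i
      by (simp_all add: inner_prod_def inner_axis)
    show ?thesis
      unfolding dir_deriv_expand[OF C1, of y]
        clifford_radial_identity[OF monogenic_eq[OF f, of "x + s *\<^sub>R y"], of "fst y" "\<lambda>i. snd y $ i"]
      unfolding R_def in1
      by (simp only: cmul.scaleR_right scaleR_add_right scaleR_minus_right scaleR_sum_right scaleR_scaleR mult.commute)
  qed
  ultimately show ?thesis by simp
qed

text \<open>The average over the ball of radius t has the radial integral of
  \<open>has_integral_bump_radial\<close> as its derivative in t. It is therefore independent of t
  and equals its value at scale 0.\<close>

lemma monogenic_bump_average: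
  fixes f :: "'n::{finite,linorder} cfun"
  assumes f: "monogenic f"
  shows "integral qbox (\<lambda>y. (bump y)\<^sup>2 *\<^sub>R f (x + s *\<^sub>R y)) = bump_mass TYPE('n paravector) *\<^sub>R f x"
proof -
  note C1 = monogenic_C1[OF f]
  note C = C1_continuous[OF C1, of UNIV]
  define M where "M t = integral qbox (\<lambda>y. (bump y)\<^sup>2 *\<^sub>R f (x + t *\<^sub>R y))" for t
  have d: "(M has_vector_derivative integral qbox (\<lambda>y. (bump y)\<^sup>2 *\<^sub>R dir_deriv y f (x + t *\<^sub>R y)))
      (at t within UNIV)" for t
    unfolding M_def
  proof (rule leibniz_rule_vector_derivative)
    fix t y
    have "((\<lambda>t. x + t *\<^sub>R y) has_derivative (\<lambda>h. h *\<^sub>R y)) (at t)"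
      by (auto intro!: derivative_eq_intros)
    from has_derivative_scaleR_right[OF has_derivative_compose[OF this C1_has_derivative[OF C1]], of "(bump y)\<^sup>2"]
    show "((\<lambda>t. (bump y)\<^sup>2 *\<^sub>R f (x + t *\<^sub>R y)) has_vector_derivative
        (bump y)\<^sup>2 *\<^sub>R dir_deriv y f (x + t *\<^sub>R y)) (at t within UNIV)"
      by (simp add: has_vector_derivative_def linear_cmul[OF dir_deriv_linear[OF C1]] mult_ac)
  next
    fix t
    show "(\<lambda>y. (bump y)\<^sup>2 *\<^sub>R f (x + t *\<^sub>R y)) integrable_on qbox"
      by (intro integrable_continuous continuous_intros continuous_on_compose2[OF C(2)]) auto
    show "continuous_on (UNIV \<times> qbox) (\<lambda>(t, y). (bump y)\<^sup>2 *\<^sub>R dir_deriv y f (x + t *\<^sub>R y))"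
      unfolding split_beta
      by (subst dir_deriv_expand[OF C1])
       (intro continuous_intros continuous_on_compose2[OF C(1)], auto)
  qed auto
  have "M s = M 0"
  \<comment> \<open>The scale 0, excluded in the rotation argument, is an admissible exceptional
    point because \<open>M\<close> is continuous there.\<close>
  proof (rule has_derivative_zero_unique_strong_convex[of UNIV "{0}" M])
    show "continuous_on UNIV M"
      using d has_vector_derivative_continuous continuous_at_imp_continuous_on by blast
    fix t :: real assume "t \<in> UNIV - {0}"
    then have "integral qbox (\<lambda>y. (bump y)\<^sup>2 *\<^sub>R dir_deriv y f (x + t *\<^sub>R y)) = 0"
      using has_integral_bump_radial[OF f] by (intro integral_unique) auto
    then show "(M has_derivative (\<lambda>h. 0)) (at t within UNIV)"
      using d[of t] by (simp add: has_vector_derivative_def)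
  qed auto
  also have "M 0 = bump_mass TYPE('n paravector) *\<^sub>R f x"
  proof -
    have "((\<lambda>y::'n paravector. (bump y)\<^sup>2) has_integral bump_mass TYPE('n paravector)) qbox"
      unfolding bump_mass_def by (intro integrable_integral integrable_continuous continuous_intros)
    from has_integral_linear[OF this bounded_linear_scaleR_left[of "f x"]]
    show ?thesis unfolding M_def by (intro integral_unique) (simp add: o_def)
  qed
  finally show ?thesis by (simp add: M_def)
qed

text \<open>Differentiating the averaging identity and moving the derivative to the kernel leaves
  \<open>f\<close> undifferentiated on the right. Cauchy estimates and higher smoothness both come
  from this formula.\<close>

lemma monogenic_dir_deriv_formula:
  fixes f :: "'n::{finite,linorder} cfun"
  assumes f: "monogenic f" and v: "norm v \<le> 1"
  shows "(s * bump_mass TYPE('n paravector)) *\<^sub>R dir_deriv v f x =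
    integral qbox (\<lambda>y. (4 * bump y * (y \<bullet> v)) *\<^sub>R f (x + s *\<^sub>R y))"
proof -
  note C1 = monogenic_C1[OF f]
  let ?m = "bump_mass TYPE('n paravector)"
  have "((\<lambda>x. ?m *\<^sub>R f x) has_derivative
      (\<lambda>v. integral qbox (\<lambda>y. (bump y)\<^sup>2 *\<^sub>R dir_deriv v f (x + s *\<^sub>R y)))) (at x)"
    using has_derivative_conv[OF C1, of "\<lambda>y. (bump y)\<^sup>2" s x]
    unfolding monogenic_bump_average[OF f] by (simp add: continuous_intros)
  moreover have "((\<lambda>x. ?m *\<^sub>R f x) has_derivative (\<lambda>v. ?m *\<^sub>R dir_deriv v f x)) (at x)"
    by (intro has_derivative_scaleR_right C1_has_derivative C1)
  ultimately have "?m *\<^sub>R dir_deriv v f x = integral qbox (\<lambda>y. (bump y)\<^sup>2 *\<^sub>R dir_deriv v f (x + s *\<^sub>R y))"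
    by (rule fun_cong[OF has_derivative_unique[symmetric]])
  then have "(s * ?m) *\<^sub>R dir_deriv v f x =
      s *\<^sub>R integral qbox (\<lambda>y. ((bump y)\<^sup>2 * (1 + 0)) *\<^sub>R dir_deriv v f (x + s *\<^sub>R y))"
    by (simp flip: scaleR_scaleR)
  also have "\<dots> = integral qbox (\<lambda>y. (4 * bump y * (y \<bullet> v)) *\<^sub>R f (x + s *\<^sub>R y))"
    by (subst integral_bump_sq_dir_deriv[OF C1 v, where l = "\<lambda>_. 0"]) (simp_all add: linear_zero)
  finally show ?thesis .
qed

text \<open>The 4 bounds the kernel in the derivative formula on the unit ball. The volume is that
  of the whole cube, a crude substitute for the support.\<close>

definition grad_const :: "'n::finite itself \<Rightarrow> real" where
  "grad_const _ = 4 * measure lborel (qbox :: 'n paravector set) / bump_mass TYPE('n paravector)"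

lemma monogenic_gradient_bound:
  fixes f :: "'n::{finite,linorder} cfun"
  assumes f: "monogenic f" and v: "norm v \<le> 1" and s: "s > 0"
    and B: "\<And>y. dist x y \<le> s \<Longrightarrow> norm (f y) \<le> B"
  shows "norm (dir_deriv v f x) \<le> grad_const TYPE('n) / s * B"
proof -
  note C = C1_continuous[OF monogenic_C1[OF f], of UNIV]
  let ?m = "bump_mass TYPE('n paravector)"
  have B0: "B \<ge> 0" using order_trans[OF norm_ge_zero B[of x]] s by simp
  have m: "?m > 0" by (rule bump_mass_pos)
  let ?g = "\<lambda>y. (4 * bump y * (y \<bullet> v)) *\<^sub>R f (x + s *\<^sub>R y)"
  have "?g integrable_on qbox"
    by (intro integrable_continuous continuous_intros continuous_on_compose2[OF C(2)]) auto
  then have "norm (integral qbox ?g) \<le> (4 * B) * measure lborel (qbox :: 'n paravector set)"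
  proof (rule has_integral_bound[OF _ integrable_integral, rotated])
    fix y :: "'n paravector"
    show "norm (?g y) \<le> 4 * B"
    proof (cases "norm y \<ge> 1")
      case False
      have "bump y \<le> 1" by (simp add: bump_def)
      moreover have "\<bar>y \<bullet> v\<bar> \<le> 1"
        using Cauchy_Schwarz_ineq2[of y v] mult_le_one[of "norm y" "norm v"] False v by simp
      ultimately have "bump y * \<bar>y \<bullet> v\<bar> \<le> 1" by (intro mult_le_one) auto
      moreover have "norm (f (x + s *\<^sub>R y)) \<le> B"
        using False s by (intro B) (simp add: dist_norm)
      ultimately have "(bump y * \<bar>y \<bullet> v\<bar>) * norm (f (x + s *\<^sub>R y)) \<le> 1 * B"
        by (intro mult_mono) auto
      then show ?thesis using bump_nonneg[of y] by (simp add: abs_mult)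
    qed (use B0 in \<open>simp add: bump_eq_0\<close>)
  qed (use B0 in auto)
  then have "(s * ?m) * norm (dir_deriv v f x) \<le> 4 * B * measure lborel (qbox :: 'n paravector set)"
    using s m unfolding monogenic_dir_deriv_formula[OF f v, symmetric] by simp
  then show ?thesis using s m by (simp add: grad_const_def field_simps)
qed

text \<open>At scale 1 the derivative appears as a convolution of \<open>f\<close> with a continuous
  kernel, hence can be differentiated once more.\<close>

lemma monogenic_dir_deriv_explicit:
  fixes f :: "'n::{finite,linorder} cfun"
  assumes f: "monogenic f" and v: "norm v \<le> 1"
  shows "dir_deriv v f = (\<lambda>x. (1 / bump_mass TYPE('n paravector)) *\<^sub>R
    integral qbox (\<lambda>y. (4 * bump y * (y \<bullet> v)) *\<^sub>R f (x + 1 *\<^sub>R y)))"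
  unfolding monogenic_dir_deriv_formula[OF f v, symmetric]
  using bump_mass_pos[where 'a = "'n paravector"] by (auto simp: fun_eq_iff)

lemma has_derivative_dir_deriv:
  fixes f :: "'n::{finite,linorder} cfun"
  assumes f: "monogenic f" and v: "norm v \<le> 1"
  shows "(dir_deriv v f has_derivative (\<lambda>w. (1 / bump_mass TYPE('n paravector)) *\<^sub>R
    integral qbox (\<lambda>y. (4 * bump y * (y \<bullet> v)) *\<^sub>R dir_deriv w f (x + 1 *\<^sub>R y)))) (at x)"
  unfolding monogenic_dir_deriv_explicit[OF assms]
  by (intro has_derivative_scaleR_right has_derivative_conv monogenic_C1[OF f] continuous_intros)

lemma monogenic_dir_deriv:
  fixes f :: "'n::{finite,linorder} cfun"
  assumes f: "monogenic f" and v: "norm v \<le> 1"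
  shows "monogenic (dir_deriv v f)"
proof -
  note C1 = monogenic_C1[OF f]
  note C = C1_continuous[OF C1, of UNIV]
  let ?m = "bump_mass TYPE('n paravector)"
  let ?g = "\<lambda>w x y. (4 * bump y * (y \<bullet> v)) *\<^sub>R dir_deriv w f (x + 1 *\<^sub>R y)"
  have i: "?g w x integrable_on qbox" for w x
    by (intro integrable_continuous continuous_intros continuous_on_compose2[OF C(1)]) auto
  have "C1_fun (dir_deriv v f)"
  proof (rule C1_funI[OF has_derivative_dir_deriv[OF f v]])
    fix w
    show "continuous_on UNIV (\<lambda>x. (1 / ?m) *\<^sub>R integral qbox (?g w x))"
      by (intro continuous_intros integral_continuous_on_param, unfold split_beta)
        (intro continuous_intros continuous_on_compose2[OF C(1)], auto)
  qed
  moreover have "partial0 (dir_deriv v f) x + (\<Sum>i\<in>UNIV. cl_unit i \<cdot>\<^sub>c partial i (dir_deriv v f) x) = 0" for x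
  proof -
    have D: "dir_deriv w (dir_deriv v f) x = (1 / ?m) *\<^sub>R integral qbox (?g w x)" for w
      by (rule dir_deriv_eqI[OF has_derivative_dir_deriv[OF f v]])
    have cm: "((\<lambda>y. a \<cdot>\<^sub>c h y) has_integral a \<cdot>\<^sub>c z) qbox"
      if "(h has_integral z) qbox" for a h z
      using has_integral_linear[OF that cmul.bounded_linear_right[of a]] by (simp add: o_def)
    have "((\<lambda>y. ?g (1, 0) x y + (\<Sum>i\<in>UNIV. cl_unit i \<cdot>\<^sub>c ?g (0, axis i 1) x y)) has_integral
       integral qbox (?g (1, 0) x) + (\<Sum>i\<in>UNIV. cl_unit i \<cdot>\<^sub>c integral qbox (?g (0, axis i 1) x))) qbox"
      by (intro has_integral_add has_integral_sum cm integrable_integral i) auto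
    moreover have "?g (1, 0) x y + (\<Sum>i\<in>UNIV. cl_unit i \<cdot>\<^sub>c ?g (0, axis i 1) x y) = 0" for y
    proof -
      have "?g (1, 0) x y + (\<Sum>i\<in>UNIV. cl_unit i \<cdot>\<^sub>c ?g (0, axis i 1) x y) =
        (4 * bump y * (y \<bullet> v)) *\<^sub>R (partial0 f (x + 1 *\<^sub>R y) +
          (\<Sum>i\<in>UNIV. cl_unit i \<cdot>\<^sub>c partial i f (x + 1 *\<^sub>R y)))"
        by (simp add: cmul.scaleR_right scaleR_add_right scaleR_sum_right)
      then show ?thesis unfolding monogenic_eq[OF f] by simp
    qed
    ultimately have "integral qbox (?g (1, 0) x) + (\<Sum>i\<in>UNIV. cl_unit i \<cdot>\<^sub>c integral qbox (?g (0, axis i 1) x)) = 0"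
      by simp
    then have "(1 / ?m) *\<^sub>R (integral qbox (?g (1, 0) x) + (\<Sum>i\<in>UNIV. cl_unit i \<cdot>\<^sub>c integral qbox (?g (0, axis i 1) x))) = 0"
      by simp
    then show ?thesis
      unfolding D by (simp only: cmul.scaleR_right scaleR_add_right scaleR_sum_right)
  qed
  ultimately show ?thesis unfolding monogenic_def by blast
qed

text \<open>Both sides are the same integral: the left one by differentiating the formula for
  \<open>dir_deriv v f\<close>, the right one by applying that formula to the monogenic function
  \<open>dir_deriv w f\<close>.\<close>

lemma dir_deriv_commute:
  fixes f :: "'n::{finite,linorder} cfun"
  assumes f: "monogenic f" and v: "norm v \<le> 1" and w: "norm w \<le> 1"
  shows "dir_deriv w (dir_deriv v f) = dir_deriv v (dir_deriv w f)"
  unfolding monogenic_dir_deriv_explicit[OF monogenic_dir_deriv[OF f w] v]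
  by (rule ext) (rule dir_deriv_eqI[OF has_derivative_dir_deriv[OF f v]])

section \<open>Iterated derivatives, Cauchy estimates and limits\<close>

lemma norm_unit_vectors [simp]:
  "norm ((1, 0) :: 'n::finite paravector) = 1" "norm ((0, axis i 1) :: 'n::finite paravector) = 1"
  by (simp_all add: norm_prod_def)

lemma monogenic_partial: "monogenic f \<Longrightarrow> monogenic (partial i f)"
  by (rule monogenic_dir_deriv) simp_all

text \<open>Words of partial derivatives are easier to permute and to induct on than the nested
  powers in \<open>multi_deriv\<close>; for monogenic functions only the multiset of letters
  matters.\<close>

definition list_deriv :: "'n::finite list \<Rightarrow> 'n cfun \<Rightarrow> 'n cfun" where
  "list_deriv js f = foldr partial js f"

lemma list_deriv_simps [simp]:
  "list_deriv [] f = f" "list_deriv (j # js) f = partial j (list_deriv js f)"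
  "list_deriv (js @ ks) f = list_deriv js (list_deriv ks f)"
  by (simp_all add: list_deriv_def)

lemma monogenic_list_deriv: "monogenic f \<Longrightarrow> monogenic (list_deriv js f)"
  by (induction js) (simp_all add: monogenic_partial)

lemma list_deriv_move:
  "monogenic f \<Longrightarrow> list_deriv (a @ i # b) f = partial i (list_deriv (a @ b) f)"
  by (induction a) (auto simp: dir_deriv_commute monogenic_list_deriv)

lemma list_deriv_mset:
  assumes "monogenic f" "mset js = mset ks"
  shows "list_deriv js f = list_deriv ks f"
  using assms(2)
proof (induction js arbitrary: ks)
  case (Cons i js)
  then have "i \<in> set ks" by (metis list.set_intros(1) mset_eq_setD)
  then obtain a b where ks: "ks = a @ i # b" by (meson split_list)
  then have "mset js = mset (a @ b)" using Cons.prems by simp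
  from Cons.IH[OF this] show ?case
    unfolding ks list_deriv_move[OF assms(1)] by simp
qed simp

definition multi_list :: "'n::{finite,linorder} multi \<Rightarrow> 'n list" where
  "multi_list m = concat (map (\<lambda>i. replicate (m i) i) (sorted_list_of_set UNIV))"

lemma count_list_replicate: "count_list (replicate k a) i = (if a = i then k else 0)"
  by (induction k) auto

lemma count_multi_list: "count_list (multi_list m) = m"
proof
  fix i
  have "count_list (concat (map (\<lambda>i. replicate (m i) i) xs)) i = (if i \<in> set xs then m i else 0)"
    if "distinct xs" for xs
    using that by (induction xs) (auto simp: count_list_append count_list_replicate)
  from this[of "sorted_list_of_set UNIV"] show "count_list (multi_list m) i = m i" by (simp add: multi_list_def)
qed

lemma multi_deriv_eq_list_deriv: "multi_deriv m f = list_deriv (multi_list m) f"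
proof -
  have r: "(partial i ^^ k) g = list_deriv (replicate k i) g" for i k and g :: "'a cfun"
    by (induction k) simp_all
  have "foldr (\<lambda>i. partial i ^^ m i) xs f = list_deriv (concat (map (\<lambda>i. replicate (m i) i) xs)) f" for xs
    by (induction xs) (simp_all add: r)
  then show ?thesis by (simp add: multi_deriv_def multi_list_def)
qed

lemma list_deriv_eq_multi_deriv:
  assumes "monogenic f"
  shows "list_deriv js f = multi_deriv (count_list js) f"
  unfolding multi_deriv_eq_list_deriv
  by (rule list_deriv_mset[OF assms]) (simp add: multiset_eq_iff count_mset count_multi_list)

lemma monogenic_multi_deriv: "monogenic f \<Longrightarrow> monogenic (multi_deriv m f)"
  by (simp add: multi_deriv_eq_list_deriv monogenic_list_deriv)

lemma multi_deriv_add: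
  assumes "monogenic f"
  shows "multi_deriv a (multi_deriv b f) = multi_deriv (\<lambda>i. a i + b i) f"
proof -
  have "multi_deriv a (multi_deriv b f) = list_deriv (multi_list a @ multi_list b) f"
    by (simp add: multi_deriv_eq_list_deriv)
  also have "\<dots> = multi_deriv (\<lambda>i. a i + b i) f"
    unfolding list_deriv_eq_multi_deriv[OF assms] by (simp add: count_list_append[abs_def] count_multi_list)
  finally show ?thesis .
qed

definition incr :: "'n \<Rightarrow> 'n multi \<Rightarrow> 'n multi" where
  "incr j m = m(j := Suc (m j))"

lemma incr_commute: "incr i (incr j m) = incr j (incr i m)"
  by (auto simp: incr_def fun_eq_iff)

lemma count_list_Cons: "count_list (j # js) = incr j (count_list js)"
  by (auto simp: incr_def fun_eq_iff)

lemma partial_multi_deriv: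
  assumes "monogenic f"
  shows "partial j (multi_deriv m f) = multi_deriv (incr j m) f"
proof -
  have "partial j (multi_deriv m f) = list_deriv (j # multi_list m) f"
    by (simp add: multi_deriv_eq_list_deriv)
  also have "\<dots> = multi_deriv (incr j m) f"
    unfolding list_deriv_eq_multi_deriv[OF assms] count_list_Cons
    by (simp add: count_multi_list)
  finally show ?thesis .
qed

lemma length_eq_multi_abs: "length js = multi_abs (count_list js)"
proof -
  have "multi_abs (count_list js) = (\<Sum>i\<in>set js. count_list js i)"
    unfolding multi_abs_def by (rule sum.mono_neutral_right) (auto simp: count_list_0_iff)
  then show ?thesis by (simp add: sum_count_set)
qed

lemma length_multi_list: "length (multi_list m) = multi_abs m"
  by (simp add: length_eq_multi_abs count_multi_list)

lemma multi_abs_0 [simp]: "multi_abs (\<lambda>_. 0) = 0"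
  by (simp add: multi_abs_def)

lemma multi_deriv_0 [simp]: "multi_deriv (\<lambda>_. 0) f = (f :: 'n::{finite,linorder} cfun)"
  using length_multi_list[of "\<lambda>_::'n. 0"] by (simp add: multi_deriv_eq_list_deriv)

lemma grad_const_nonneg: "grad_const TYPE('n::finite) \<ge> 0"
  unfolding grad_const_def
  by (intro divide_nonneg_nonneg mult_nonneg_nonneg measure_nonneg less_imp_le[OF bump_mass_pos]) simp

text \<open>Each differentiation spends the distance \<open>s\<close>, so a word of length k sees
  the ball of radius \<open>s * k\<close>.\<close>

lemma list_deriv_bound:
  fixes f :: "'n::{finite,linorder} cfun" and s :: real
  assumes f: "monogenic f" and s: "s > 0"
    and B: "\<And>y. dist x y \<le> s * length js \<Longrightarrow> norm (f y) \<le> B"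
  shows "norm (list_deriv js f x) \<le> (grad_const TYPE('n) / s) ^ length js * B"
  using B
proof (induction js arbitrary: x)
  case (Cons j js)
  have "norm (list_deriv js f y) \<le> (grad_const TYPE('n) / s) ^ length js * B" if "dist x y \<le> s" for y
  proof (rule Cons.IH)
    fix z assume "dist y z \<le> s * length js"
    then have "dist x z \<le> s * length (j # js)"
      using that dist_triangle[of x z y] by (simp add: algebra_simps)
    then show "norm (f z) \<le> B" by (rule Cons.prems)
  qed
  then have "norm (partial j (list_deriv js f) x) \<le>
      grad_const TYPE('n) / s * ((grad_const TYPE('n) / s) ^ length js * B)"
    by (intro monogenic_gradient_bound monogenic_list_deriv f s) auto
  then show ?case by simp
qed simp

lemma power_self_le_fact: "real k ^ k \<le> exp 1 ^ k * fact k"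
proof -
  have "(\<Sum>i\<in>{k}. real k ^ i / fact i) \<le> (\<Sum>i. real k ^ i / fact i)"
    using summable_exp[of "real k"] by (intro sum_le_suminf) (auto simp: field_simps)
  also have "\<dots> = exp (real k)" by (simp add: exp_def field_simps)
  also have "\<dots> = exp 1 ^ k" by (simp flip: exp_of_nat_mult)
  finally show ?thesis by (simp add: field_simps)
qed

text \<open>The factor \<open>exp 1\<close> pays for replacing k^k by k!. Adding 1 guarantees
  positivity, since \<open>grad_const_nonneg\<close> gives only a weak inequality.\<close>

definition cauchy_const :: "'n::finite itself \<Rightarrow> real" where
  "cauchy_const _ = exp 1 * grad_const TYPE('n) + 1"

lemma cauchy_const_pos: "cauchy_const TYPE('n::finite) > 0"
  unfolding cauchy_const_def using grad_const_nonneg[where 'n = 'n]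
  by (intro add_nonneg_pos mult_nonneg_nonneg) auto

lemma multi_deriv_bound:
  fixes f :: "'n::{finite,linorder} cfun"
  assumes f: "monogenic f" and R: "R > 0"
    and B: "\<And>y. dist x y \<le> R \<Longrightarrow> norm (f y) \<le> B"
  shows "norm (multi_deriv m f x) \<le> fact (multi_abs m) * (cauchy_const TYPE('n) / R) ^ multi_abs m * B"
proof -
  define k where "k = multi_abs m"
  have B0: "B \<ge> 0" using order_trans[OF norm_ge_zero B[of x]] R by simp
  show ?thesis
  proof (cases "k = 0")
    case True
    then have "multi_list m = []" using length_multi_list[of m] by (simp add: k_def)
    then show ?thesis using True B[of x] R by (simp add: k_def multi_deriv_eq_list_deriv)
  next
    case False
    \<comment> \<open>The radius \<open>R\<close> is divided into k equal steps, which produces the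
      factor k^k.\<close>
    have "norm (list_deriv (multi_list m) f x) \<le>
        (grad_const TYPE('n) / (R / k)) ^ length (multi_list m) * B"
    proof (rule list_deriv_bound[OF f])
      fix y assume "dist x y \<le> R / k * length (multi_list m)"
      then show "norm (f y) \<le> B" using False by (intro B) (simp add: length_multi_list k_def)
    qed (use False R in simp)
    also have "\<dots> = (real k ^ k * (grad_const TYPE('n) / R) ^ k) * B"
      by (simp add: length_multi_list k_def power_divide power_mult_distrib)
    also have "\<dots> \<le> ((exp 1 ^ k * fact k) * (grad_const TYPE('n) / R) ^ k) * B"
      using B0 R grad_const_nonneg[where 'n = 'n]
      by (intro mult_right_mono power_self_le_fact) auto
    also have "\<dots> = fact k * ((exp 1 * grad_const TYPE('n)) / R) ^ k * B"
      by (simp add: power_divide power_mult_distrib)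
    also have "\<dots> \<le> fact k * (cauchy_const TYPE('n) / R) ^ k * B"
      using B0 R grad_const_nonneg[where 'n = 'n]
      by (intro mult_right_mono mult_left_mono power_mono divide_right_mono) (auto simp: cauchy_const_def)
    finally show ?thesis by (simp add: multi_deriv_eq_list_deriv k_def)
  qed
qed

section \<open>Derivatives of linear combinations, right multiples and limits\<close>

lemma dir_deriv_lincomb:
  assumes "C1_fun f" "C1_fun g"
  shows "dir_deriv v (\<lambda>x. s *\<^sub>R f x + t *\<^sub>R g x) = (\<lambda>x. s *\<^sub>R dir_deriv v f x + t *\<^sub>R dir_deriv v g x)"
  by (rule ext, rule dir_deriv_eqI) (intro has_derivative_add has_derivative_scaleR_right C1_has_derivative assms)

lemma multi_deriv_lincomb:
  assumes "monogenic f" "monogenic g"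
  shows "multi_deriv m (\<lambda>x. s *\<^sub>R f x + t *\<^sub>R g x) = (\<lambda>x. s *\<^sub>R multi_deriv m f x + t *\<^sub>R multi_deriv m g x)"
proof -
  have "list_deriv js (\<lambda>x. s *\<^sub>R f x + t *\<^sub>R g x) = (\<lambda>x. s *\<^sub>R list_deriv js f x + t *\<^sub>R list_deriv js g x)" for js
    by (induction js) (simp_all add: dir_deriv_lincomb monogenic_C1 monogenic_list_deriv assms)
  then show ?thesis by (simp add: multi_deriv_eq_list_deriv)
qed

lemma dir_deriv_cmul_right:
  assumes "C1_fun f"
  shows "dir_deriv v (\<lambda>x. f x \<cdot>\<^sub>c a) = (\<lambda>x. dir_deriv v f x \<cdot>\<^sub>c a)"
  by (rule ext, rule dir_deriv_eqI)
    (rule bounded_linear.has_derivative[OF cmul.bounded_linear_left C1_has_derivative[OF assms]])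

lemma monogenic_cmul_right:
  assumes "monogenic f"
  shows "monogenic (\<lambda>x. f x \<cdot>\<^sub>c a)"
proof -
  note C1 = monogenic_C1[OF assms]
  have "C1_fun (\<lambda>x. f x \<cdot>\<^sub>c a)"
    by (rule C1_funI[OF bounded_linear.has_derivative[OF cmul.bounded_linear_left C1_has_derivative[OF C1]]])
      (intro cmul.continuous_on continuous_intros C1_continuous[OF C1])
  moreover have "partial0 (\<lambda>x. f x \<cdot>\<^sub>c a) x + (\<Sum>i\<in>UNIV. cl_unit i \<cdot>\<^sub>c partial i (\<lambda>x. f x \<cdot>\<^sub>c a) x) =
      (partial0 f x + (\<Sum>i\<in>UNIV. cl_unit i \<cdot>\<^sub>c partial i f x)) \<cdot>\<^sub>c a" for x
    by (simp add: dir_deriv_cmul_right[OF C1] cmul.add_left cmul.sum_left cmul_assoc)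
  ultimately show ?thesis
    unfolding monogenic_def by (simp add: monogenic_eq[OF assms] cmul.zero_left)
qed

lemma multi_deriv_cmul_right:
  assumes "monogenic f"
  shows "multi_deriv m (\<lambda>x. f x \<cdot>\<^sub>c a) = (\<lambda>x. multi_deriv m f x \<cdot>\<^sub>c a)"
proof -
  have "list_deriv js (\<lambda>x. f x \<cdot>\<^sub>c a) = (\<lambda>x. list_deriv js f x \<cdot>\<^sub>c a)" for js
    by (induction js) (auto simp: dir_deriv_cmul_right monogenic_C1 monogenic_list_deriv assms)
  then show ?thesis by (simp add: multi_deriv_eq_list_deriv)
qed

lemma dir_deriv_scale:
  assumes "C1_fun f"
  shows "dir_deriv h f x = norm h *\<^sub>R dir_deriv ((1 / norm h) *\<^sub>R h) f x"
  using linear_cmul[OF dir_deriv_linear[OF assms, of x], of "norm h" "(1 / norm h) *\<^sub>R h"]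
    linear_0[OF dir_deriv_linear[OF assms, of x]]
  by (cases "h = 0") auto

text \<open>The gradient bound at distance 1 turns uniform convergence on
  \<open>cball 0 (R + 1)\<close> into a uniform Cauchy property of the derivatives on
  \<open>cball 0 R\<close>, linear in the direction. Hence derivatives converge locally uniformly
  and the monogenic equation passes to the limit.\<close>

lemma monogenic_uniform_limit:
  fixes f :: "nat \<Rightarrow> 'n::{finite,linorder} cfun"
  assumes mono: "\<And>n. monogenic (f n)"
    and lim: "\<And>R. uniform_limit (cball 0 R) f g sequentially"
  shows "monogenic g" and "(\<lambda>n. dir_deriv v (f n) x) \<longlonglongrightarrow> dir_deriv v g x"
proof -
  let ?K = "grad_const TYPE('n) + 1"
  have K: "?K > 0" using grad_const_nonneg[where 'n = 'n] by simp
  note C1 = monogenic_C1[OF mono]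
  have cauchy: "\<exists>N. \<forall>n\<ge>N. \<forall>m\<ge>N. \<forall>x\<in>cball 0 R. \<forall>h. norm (dir_deriv h (f n) x - dir_deriv h (f m) x) \<le> e * norm h"
    if e: "e > 0" for R e
  proof -
    have "\<forall>\<^sub>F n in sequentially. \<forall>x\<in>cball 0 (R + 1). dist (f n x) (g x) < e / (2 * ?K)"
      using lim[of "R + 1"] e K unfolding uniform_limit_iff by (meson divide_pos_pos mult_pos_pos zero_less_numeral)
    then obtain N where N: "\<And>n x. n \<ge> N \<Longrightarrow> x \<in> cball 0 (R + 1) \<Longrightarrow> dist (f n x) (g x) < e / (2 * ?K)"
      unfolding eventually_sequentially by blast
    have "norm (dir_deriv h (f n) x - dir_deriv h (f m) x) \<le> e * norm h"
      if nm: "n \<ge> N" "m \<ge> N" and x: "x \<in> cball 0 R" for n m x h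
    proof -
      let ?d = "\<lambda>x. 1 *\<^sub>R f n x + (-1) *\<^sub>R f m x"
      have md: "monogenic ?d" by (intro monogenic_lincomb mono)
      have v: "norm (dir_deriv v ?d x) \<le> e" if "norm v \<le> 1" for v
      proof -
        have "norm (dir_deriv v ?d x) \<le> grad_const TYPE('n) / 1 * (e / ?K)"
        proof (rule monogenic_gradient_bound[OF md that])
          fix y assume "dist x y \<le> 1"
          then have "y \<in> cball 0 (R + 1)" using x dist_triangle[of 0 y x] by simp
          from N[OF nm(1) this] N[OF nm(2) this]
          have "dist (f n y) (f m y) < e / (2 * ?K) + e / (2 * ?K)"
            by (rule dist_triangle_less_add)
          also have "\<dots> = e / ?K" 
            using field_sum_of_halves[of "e / ?K"] by (simp only: divide_divide_eq_left mult.commute)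
          finally show "norm (?d y) \<le> e / ?K" by (simp add: dist_norm)
        qed simp
        also have "\<dots> \<le> e" using K e by (simp add: field_simps)
        finally show ?thesis .
      qed
      have "norm (dir_deriv h ?d x) = norm h * norm (dir_deriv ((1 / norm h) *\<^sub>R h) ?d x)"
        by (subst dir_deriv_scale[OF monogenic_C1[OF md]]) simp
      also have "\<dots> \<le> norm h * e"
        by (intro mult_left_mono v) auto
      finally show ?thesis unfolding dir_deriv_lincomb[OF C1 C1] by (simp add: mult.commute)
    qed
    then show ?thesis by blast
  qed
  define g' where "g' x h = lim (\<lambda>n. dir_deriv h (f n) x)" for x h
  have g': "(\<lambda>n. dir_deriv h (f n) x) \<longlonglongrightarrow> g' x h" for x h
  proof -
    have "Cauchy (\<lambda>n. dir_deriv h (f n) x)"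
    proof (rule metric_CauchyI)
      fix e :: real assume e: "e > 0"
      define e' where "e' = e / (norm h + 1)"
      have h: "norm h + 1 > 0" by (simp add: add_nonneg_pos)
      have "e' > 0" using e h by (simp add: e'_def)
      from cauchy[OF this, of "norm x"]
      obtain N where N: "\<forall>n\<ge>N. \<forall>m\<ge>N. \<forall>x\<in>cball 0 (norm x). \<forall>h. norm (dir_deriv h (f n) x - dir_deriv h (f m) x) \<le> e' * norm h"
        by blast
      have "dist (dir_deriv h (f m) x) (dir_deriv h (f n) x) < e" if "m \<ge> N" "n \<ge> N" for m n
      proof -
        have "x \<in> cball 0 (norm x)" by simp
        with N that have "norm (dir_deriv h (f m) x - dir_deriv h (f n) x) \<le> e' * norm h" by blast
        also have "\<dots> < e' * (norm h + 1)" using \<open>e' > 0\<close> by simp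
        also have "\<dots> = e" using h by (simp add: e'_def)
        finally show ?thesis by (simp add: dist_norm)
      qed
      then show "\<exists>M. \<forall>m\<ge>M. \<forall>n\<ge>M. dist (dir_deriv h (f m) x) (dir_deriv h (f n) x) < e" by blast
    qed
    then show ?thesis unfolding g'_def using Cauchy_convergent convergent_LIMSEQ_iff by blast
  qed
  have unif: "\<forall>\<^sub>F n in sequentially. \<forall>x\<in>cball 0 R. \<forall>h. norm (dir_deriv h (f n) x - g' x h) \<le> e * norm h"
    if e: "e > 0" for R e
  proof -
    obtain N where N: "\<forall>n\<ge>N. \<forall>m\<ge>N. \<forall>x\<in>cball 0 R. \<forall>h. norm (dir_deriv h (f n) x - dir_deriv h (f m) x) \<le> e * norm h"
      using cauchy[OF e] by blast
    have "norm (dir_deriv h (f n) x - g' x h) \<le> e * norm h" if "n \<ge> N" "x \<in> cball 0 R" for n x h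
    proof (rule tendsto_upperbound)
      show "(\<lambda>m. norm (dir_deriv h (f n) x - dir_deriv h (f m) x)) \<longlonglongrightarrow> norm (dir_deriv h (f n) x - g' x h)"
        by (intro tendsto_intros g')
      show "\<forall>\<^sub>F m in sequentially. norm (dir_deriv h (f n) x - dir_deriv h (f m) x) \<le> e * norm h"
        unfolding eventually_sequentially using N that by blast
    qed simp
    then show ?thesis unfolding eventually_sequentially by blast
  qed
  have gder: "(g has_derivative g' x) (at x)" for x
  proof -
    define R where "R = norm x + 1"
    have x: "x \<in> ball 0 R" by (simp add: R_def)
    have gl: "(\<lambda>n. f n y) \<longlonglongrightarrow> g y" for y
      using tendsto_uniform_limitI[OF lim[of "norm y"], of y] by simp
    have "\<exists>G. \<forall>y\<in>ball 0 R. (\<lambda>n. f n y) \<longlonglongrightarrow> G y \<and> (G has_derivative g' y) (at y within ball 0 R)"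
    proof (rule has_derivative_sequence[OF _ _ _ x gl])
      show "(f n has_derivative (\<lambda>h. dir_deriv h (f n) y)) (at y within ball 0 R)" for n y
        by (rule has_derivative_at_withinI[OF C1_has_derivative[OF C1]])
      show "\<forall>\<^sub>F n in sequentially. \<forall>x\<in>ball 0 R. \<forall>h. norm (dir_deriv h (f n) x - g' x h) \<le> e * norm h" if "e > 0" for e
        using unif[OF that, of R] by (rule eventually_mono) auto
    qed auto
    then obtain G where G: "\<And>y. y \<in> ball 0 R \<Longrightarrow> (\<lambda>n. f n y) \<longlonglongrightarrow> G y"
      "\<And>y. y \<in> ball 0 R \<Longrightarrow> (G has_derivative g' y) (at y within ball 0 R)" by blast
    have eq: "G y = g y" if "y \<in> ball 0 R" for y
      using G(1)[OF that] gl LIMSEQ_unique by blast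
    have "(G has_derivative g' x) (at x)"
      using G(2)[OF x] at_within_open[OF x] by simp
    then show ?thesis
      by (rule has_derivative_transform_within_open[OF _ open_ball x eq])
  qed
  have Dg: "dir_deriv v g x = g' x v" for v x by (rule dir_deriv_eqI[OF gder])
  show "(\<lambda>n. dir_deriv v (f n) x) \<longlonglongrightarrow> dir_deriv v g x" unfolding Dg by (rule g')
  have "C1_fun g"
  proof (rule C1_funI[OF gder])
    fix v
    have "continuous (at x) (\<lambda>x. g' x v)" for x
    proof -
      define R where "R = norm x + 1"
      have "uniform_limit (cball 0 R) (\<lambda>n. dir_deriv v (f n)) (\<lambda>x. g' x v) sequentially"
        unfolding uniform_limit_iff
      proof (intro allI impI)
        fix e :: real assume e: "e > 0"
        have h: "norm v + 1 > 0" by (simp add: add_nonneg_pos)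
        have "e / (norm v + 1) * norm v < e" using e h by (simp add: field_simps)
        then have lt: "z < e" if "z \<le> e / (norm v + 1) * norm v" for z using that by simp
        have "e / (norm v + 1) > 0" using e h by simp
        from unif[OF this, of R]
        show "\<forall>\<^sub>F n in sequentially. \<forall>x\<in>cball 0 R. dist (dir_deriv v (f n) x) (g' x v) < e"
          by (rule eventually_mono) (unfold dist_norm, blast intro: lt)
      qed
      then have "continuous_on (cball 0 R) (\<lambda>x. g' x v)"
        by (rule uniform_limit_theorem[rotated]) (use C1_continuous(1)[OF C1] in auto)
      then have "continuous_on (ball 0 R) (\<lambda>x. g' x v)"
        by (rule continuous_on_subset) auto
      then show ?thesis
        using continuous_on_interior[of "ball 0 R" "\<lambda>x. g' x v" x] by (simp add: R_def)
    qed
    then show "continuous_on UNIV (\<lambda>x. g' x v)" by (rule continuous_at_imp_continuous_on[OF ballI])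
  qed
  moreover have "partial0 g x + (\<Sum>i\<in>UNIV. cl_unit i \<cdot>\<^sub>c partial i g x) = 0" for x
  proof (rule LIMSEQ_unique)
    show "(\<lambda>n. partial0 (f n) x + (\<Sum>i\<in>UNIV. cl_unit i \<cdot>\<^sub>c partial i (f n) x)) \<longlonglongrightarrow>
        partial0 g x + (\<Sum>i\<in>UNIV. cl_unit i \<cdot>\<^sub>c partial i g x)"
      unfolding Dg by (intro tendsto_add tendsto_sum cmul.tendsto tendsto_const g')
    show "(\<lambda>n. partial0 (f n) x + (\<Sum>i\<in>UNIV. cl_unit i \<cdot>\<^sub>c partial i (f n) x)) \<longlonglongrightarrow> 0"
      unfolding monogenic_eq[OF mono] by simp
  qed
  ultimately show "monogenic g" unfolding monogenic_def by blast
qed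

section \<open>Fueter polynomials\<close>

lemma fueter_var_linear: "linear (fueter_var j)"
  unfolding fueter_var_def by (auto intro!: linearI simp: algebra_simps)

lemma fueter_var_unit [simp]:
  "fueter_var j (1, 0) = - cl_unit j"
  "fueter_var j (0, axis i 1) = (if i = j then cl_one else 0)"
  by (auto simp: fueter_var_def axis_def)

text \<open>The Fueter variables do not commute, but the commutator of z_i at x with z_j at v is x_0
  v_0 (e_i e_j - e_j e_i). This is antisymmetric in i and j and cancels against symmetric
  coefficients.\<close>

lemma fueter_var_swap_sum:
  fixes g :: "'n::{finite,linorder} \<Rightarrow> 'n \<Rightarrow> 'n clifford"
  assumes "\<And>i j. g i j = g j i"
  shows "(\<Sum>i\<in>UNIV. \<Sum>j\<in>UNIV. fueter_var i x \<cdot>\<^sub>c (fueter_var j v \<cdot>\<^sub>c g i j)) =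
    (\<Sum>j\<in>UNIV. \<Sum>i\<in>UNIV. fueter_var j v \<cdot>\<^sub>c (fueter_var i x \<cdot>\<^sub>c g i j))"
proof -
  let ?e = "\<lambda>i j. cl_unit i \<cdot>\<^sub>c (cl_unit j \<cdot>\<^sub>c g i j)"
  have "fueter_var i x \<cdot>\<^sub>c (fueter_var j v \<cdot>\<^sub>c g i j) = fueter_var j v \<cdot>\<^sub>c (fueter_var i x \<cdot>\<^sub>c g i j) +
      (fst x * fst v) *\<^sub>R (?e i j - ?e j i)" for i j
    by (simp add: fueter_var_def cmul.diff_left cmul.diff_right cmul.scaleR_left cmul.scaleR_right
        cl_one_cmul assms[of j i] algebra_simps)
  then have "(\<Sum>i\<in>UNIV. \<Sum>j\<in>UNIV. fueter_var i x \<cdot>\<^sub>c (fueter_var j v \<cdot>\<^sub>c g i j)) =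
      (\<Sum>i\<in>UNIV. \<Sum>j\<in>UNIV. fueter_var j v \<cdot>\<^sub>c (fueter_var i x \<cdot>\<^sub>c g i j)) +
      (fst x * fst v) *\<^sub>R ((\<Sum>i\<in>UNIV. \<Sum>j\<in>UNIV. ?e i j) - (\<Sum>i\<in>UNIV. \<Sum>j\<in>UNIV. ?e j i))"
    by (simp add: sum.distrib sum_subtractf scaleR_sum_right scaleR_diff_right)
  also have "(\<Sum>i\<in>UNIV. \<Sum>j\<in>UNIV. ?e j i) = (\<Sum>i\<in>UNIV. \<Sum>j\<in>UNIV. ?e i j)"
    by (rule sum.swap)
  finally show ?thesis by (subst sum.swap) simp
qed

text \<open>The sum over all words of length k of z_{j_1} ... z_{j_k} times the coefficient of the
  letter counts, which is k! times the sum of V_m c_m / m! over |m| = k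
  (\<open>fueter_sum_eq\<close>). Carrying arbitrary right coefficients makes induction on the
  leftmost factor possible; a single Fueter polynomial lacks such a recursion.\<close>

primrec fueter_sum :: "nat \<Rightarrow> ('n::{finite,linorder} multi \<Rightarrow> 'n clifford) \<Rightarrow> 'n cfun" where
  "fueter_sum 0 c x = c (\<lambda>_. 0)"
| "fueter_sum (Suc k) c x = (\<Sum>j\<in>UNIV. fueter_var j x \<cdot>\<^sub>c fueter_sum k (\<lambda>m. c (incr j m)) x)"

text \<open>The product rule differentiates each of the k positions of a word;
  \<open>fueter_var_swap_sum\<close> moves the differentiated factor to the front, where all
  positions contribute equally. At \<open>k = 0\<close> the truncated \<open>k - 1\<close> is
  harmless because of the factor \<open>real k\<close>.\<close>

lemma has_derivative_fueter_sum:
  "(fueter_sum k c has_derivative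
     (\<lambda>v. real k *\<^sub>R (\<Sum>j\<in>UNIV. fueter_var j v \<cdot>\<^sub>c fueter_sum (k - 1) (\<lambda>m. c (incr j m)) x))) (at x)"
proof (induction k arbitrary: c)
  case 0
  have "fueter_sum 0 c = (\<lambda>x. c (\<lambda>_. 0))" by (simp add: fun_eq_iff)
  then show ?case by simp
next
  case (Suc k)
  let ?c = "\<lambda>i m. c (incr i m)" and ?cc = "\<lambda>i j m. c (incr i (incr j m))"
  have "fueter_sum (Suc k) c = (\<lambda>x. \<Sum>j\<in>UNIV. fueter_var j x \<cdot>\<^sub>c fueter_sum k (?c j) x)"
    by (simp add: fun_eq_iff)
  moreover have "((\<lambda>x. \<Sum>j\<in>UNIV. fueter_var j x \<cdot>\<^sub>c fueter_sum k (?c j) x) has_derivative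
    (\<lambda>v. \<Sum>i\<in>UNIV. fueter_var i x \<cdot>\<^sub>c (real k *\<^sub>R (\<Sum>j\<in>UNIV. fueter_var j v \<cdot>\<^sub>c fueter_sum (k - 1) (?cc i j) x)) +
       fueter_var i v \<cdot>\<^sub>c fueter_sum k (?c i) x)) (at x)"
    by (intro has_derivative_sum cmul.FDERIV linear_imp_has_derivative fueter_var_linear Suc.IH)
  moreover have "(\<Sum>i\<in>UNIV. fueter_var i x \<cdot>\<^sub>c (real k *\<^sub>R (\<Sum>j\<in>UNIV. fueter_var j v \<cdot>\<^sub>c fueter_sum (k - 1) (?cc i j) x)) +
       fueter_var i v \<cdot>\<^sub>c fueter_sum k (?c i) x) =
     real (Suc k) *\<^sub>R (\<Sum>j\<in>UNIV. fueter_var j v \<cdot>\<^sub>c fueter_sum k (?c j) x)" for v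
  proof -
    have "(\<Sum>i\<in>UNIV. fueter_var i x \<cdot>\<^sub>c (real k *\<^sub>R (\<Sum>j\<in>UNIV. fueter_var j v \<cdot>\<^sub>c fueter_sum (k - 1) (?cc i j) x))) =
        real k *\<^sub>R (\<Sum>i\<in>UNIV. \<Sum>j\<in>UNIV. fueter_var i x \<cdot>\<^sub>c (fueter_var j v \<cdot>\<^sub>c fueter_sum (k - 1) (?cc i j) x))"
      by (simp add: cmul.scaleR_right cmul.sum_right scaleR_sum_right)
    also have "\<dots> = real k *\<^sub>R (\<Sum>j\<in>UNIV. \<Sum>i\<in>UNIV. fueter_var j v \<cdot>\<^sub>c (fueter_var i x \<cdot>\<^sub>c fueter_sum (k - 1) (?cc i j) x))"
      by (subst fueter_var_swap_sum) (simp_all add: incr_commute)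
    also have "\<dots> = real k *\<^sub>R (\<Sum>j\<in>UNIV. fueter_var j v \<cdot>\<^sub>c fueter_sum k (?c j) x)"
    proof (cases k)
      case (Suc l)
      have "fueter_sum k (?c j) x = (\<Sum>i\<in>UNIV. fueter_var i x \<cdot>\<^sub>c fueter_sum (k - 1) (?cc i j) x)" for j
        by (simp add: Suc incr_commute[of j])
      then show ?thesis by (simp add: cmul.sum_right)
    qed simp
    finally show ?thesis
      by (simp add: sum.distrib scaleR_left_distrib)
  qed
  ultimately show ?case by simp
qed

lemma dir_deriv_fueter_sum:
  "dir_deriv v (fueter_sum k c) x =
    real k *\<^sub>R (\<Sum>j\<in>UNIV. fueter_var j v \<cdot>\<^sub>c fueter_sum (k - 1) (\<lambda>m. c (incr j m)) x)"
  by (rule dir_deriv_eqI[OF has_derivative_fueter_sum])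

lemma continuous_on_fueter_sum: "continuous_on S (fueter_sum k c)"
  by (rule has_derivative_continuous_on[OF has_derivative_at_withinI[OF has_derivative_fueter_sum]])

lemma partial_fueter_sum:
  "partial i (fueter_sum k c) x = real k *\<^sub>R fueter_sum (k - 1) (\<lambda>m. c (incr i m)) x"
proof -
  have "(\<Sum>j\<in>UNIV. (if i = j then cl_one else 0) \<cdot>\<^sub>c fueter_sum (k - 1) (\<lambda>m. c (incr j m)) x) =
      (\<Sum>j\<in>UNIV. if i = j then fueter_sum (k - 1) (\<lambda>m. c (incr j m)) x else 0)"
    by (intro sum.cong) (auto simp: cl_one_cmul cmul.zero_left)
  then show ?thesis by (simp add: dir_deriv_fueter_sum)
qed

text \<open>Differentiation in x_0 replaces a front factor z_j by - e_j, differentiation in x_j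
  replaces it by 1, so the two parts of the equation cancel.\<close>

lemma monogenic_fueter_sum: "monogenic (fueter_sum k c)"
proof -
  have "C1_fun (fueter_sum k c)"
    by (rule C1_funI[OF has_derivative_fueter_sum])
      (intro continuous_intros cmul.continuous_on continuous_on_fueter_sum)
  moreover have "partial0 (fueter_sum k c) x + (\<Sum>i\<in>UNIV. cl_unit i \<cdot>\<^sub>c partial i (fueter_sum k c) x) = 0" for x
    unfolding partial_fueter_sum
    by (simp add: dir_deriv_fueter_sum cmul.scaleR_right cmul.minus_left sum_negf scaleR_sum_right)
  ultimately show ?thesis unfolding monogenic_def by blast
qed

text \<open>Along the ray through \<open>x\<close>, differentiation acts on the coefficients only.\<close>

lemma fueter_sum_radial:
  "fueter_sum k (\<lambda>m. \<Sum>j\<in>UNIV. fueter_var j x \<cdot>\<^sub>c c (incr j m)) x = fueter_sum (Suc k) c x"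
proof (induction k arbitrary: c)
  case (Suc k)
  have "fueter_sum (Suc k) (\<lambda>m. \<Sum>j\<in>UNIV. fueter_var j x \<cdot>\<^sub>c c (incr j m)) x =
      (\<Sum>i\<in>UNIV. fueter_var i x \<cdot>\<^sub>c
        fueter_sum k (\<lambda>m. \<Sum>j\<in>UNIV. fueter_var j x \<cdot>\<^sub>c c (incr i (incr j m))) x)"
    by (simp add: incr_commute)
  also have "\<dots> = (\<Sum>i\<in>UNIV. fueter_var i x \<cdot>\<^sub>c fueter_sum (Suc k) (\<lambda>m. c (incr i m)) x)"
    using Suc.IH[of "\<lambda>m. c (incr i m)" for i] by (intro sum.cong refl arg_cong2[where f = cmul])
  finally show ?case by simp
qed simp

lemma has_vector_derivative_fueter_sum_coeff:
  assumes "\<And>m. ((\<lambda>t. c t m) has_vector_derivative c' m) (at t within S)"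
  shows "((\<lambda>t. fueter_sum k (c t) x) has_vector_derivative fueter_sum k c' x) (at t within S)"
  using assms
proof (induction k arbitrary: c c')
  case (Suc k)
  show ?case unfolding fueter_sum.simps
    by (intro has_vector_derivative_sum bounded_linear.has_vector_derivative[OF cmul.bounded_linear_right] Suc.IH Suc.prems)
qed simp

section \<open>Norm bounds for Fueter polynomials\<close>

definition cmul_const :: "'n::{finite,linorder} itself \<Rightarrow> real" where
  "cmul_const _ = (SOME K. K > 0 \<and> (\<forall>x y :: 'n clifford. norm (x \<cdot>\<^sub>c y) \<le> K * norm x * norm y))"

text \<open>The coefficient norm is not submultiplicative for the Clifford product in general;
  boundedness of a bilinear map in finite dimension supplies a substitute.\<close>

lemma cmul_const:
  "cmul_const TYPE('n::{finite,linorder}) > 0"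
  "norm (x \<cdot>\<^sub>c y) \<le> cmul_const TYPE('n::{finite,linorder}) * norm x * norm (y :: 'n clifford)"
proof -
  have "\<exists>K. K > 0 \<and> (\<forall>x y :: 'n clifford. norm (x \<cdot>\<^sub>c y) \<le> K * norm x * norm y)"
    using bilinear_bounded_pos[OF bilinear_cmul] by blast
  from someI_ex[OF this]
  show "cmul_const TYPE('n) > 0" "norm (x \<cdot>\<^sub>c y) \<le> cmul_const TYPE('n) * norm x * norm (y :: 'n clifford)"
    unfolding cmul_const_def by blast+
qed

lemma norm_blade [simp]: "norm (blade A) = 1"
  by (simp add: blade_def)

lemma norm_fueter_var_le: "norm (fueter_var j x) \<le> 2 * norm x"
proof -
  have "norm (fueter_var j x) \<le> \<bar>snd x $ j\<bar> + \<bar>fst x\<bar>"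
    unfolding fueter_var_def by (rule order_trans[OF norm_triangle_ineq4]) simp
  also have "\<bar>snd x $ j\<bar> \<le> norm (snd x)" by (rule component_le_norm_cart)
  also have "norm (snd x) \<le> norm x" by (cases x) (simp add: norm_snd_le)
  also have "\<bar>fst x\<bar> \<le> norm x" by (cases x) (metis fst_conv norm_fst_le real_norm_def)
  finally show ?thesis by simp
qed

text \<open>The cost of one letter: 2 from \<open>norm_fueter_var_le\<close>,
  \<open>CARD('n)\<close> from the choice of the letter, \<open>cmul_const\<close> from the
  multiplication.\<close>

definition fueter_const :: "'n::{finite,linorder} itself \<Rightarrow> real" where
  "fueter_const _ = 2 * CARD('n) * cmul_const TYPE('n)"

lemma fueter_const_pos: "fueter_const TYPE('n::{finite,linorder}) > 0"
  unfolding fueter_const_def using cmul_const(1)[where 'n = 'n] by simp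

lemma multi_abs_incr [simp]: "multi_abs (incr j m) = Suc (multi_abs m)"
  by (simp add: multi_abs_def incr_def sum.remove[where x = j])

lemma fueter_sum_bound:
  fixes c :: "'n::{finite,linorder} multi \<Rightarrow> 'n clifford"
  assumes "\<And>m. multi_abs m = k \<Longrightarrow> norm (c m) \<le> B"
  shows "norm (fueter_sum k c x) \<le> (fueter_const TYPE('n) * norm x) ^ k * B"
  using assms
proof (induction k arbitrary: c)
  case (Suc k)
  let ?L = "(fueter_const TYPE('n) * norm x) ^ k * B"
  have "norm (fueter_sum (Suc k) c x) \<le>
      (\<Sum>j\<in>(UNIV::'n set). cmul_const TYPE('n) * (2 * norm x) * ?L)"
    unfolding fueter_sum.simps
  proof (rule sum_norm_le)
    fix j
    let ?f = "fueter_sum k (\<lambda>m. c (incr j m)) x"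
    have 1: "norm ?f \<le> ?L" by (intro Suc.IH Suc.prems) simp
    have "norm (fueter_var j x \<cdot>\<^sub>c ?f) \<le> cmul_const TYPE('n) * norm (fueter_var j x) * norm ?f"
      by (rule cmul_const)
    also have "\<dots> \<le> cmul_const TYPE('n) * (2 * norm x) * ?L"
      using cmul_const(1)[where 'n = 'n]
      by (intro mult_mono[OF mult_left_mono[OF norm_fueter_var_le] 1]) auto
    finally show "norm (fueter_var j x \<cdot>\<^sub>c ?f) \<le> cmul_const TYPE('n) * (2 * norm x) * ?L" .
  qed
  also have "\<dots> = (fueter_const TYPE('n) * norm x) ^ Suc k * B"
    by (simp add: fueter_const_def)
  finally show ?case .
qed simp

section \<open>Words of indices and multi-indices\<close>

lemma finite_lists_length [simp]: "finite {js :: 'n::finite list. length js = k}"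
  using finite_lists_length_eq[of "UNIV :: 'n set" k] by simp

lemma multi_abs_image: "{m :: 'n::{finite,linorder} multi. multi_abs m = k} = count_list ` {js. length js = k}"
proof (intro equalityI subsetI)
  fix m :: "'n multi" assume "m \<in> {m. multi_abs m = k}"
  then show "m \<in> count_list ` {js. length js = k}"
    by (intro image_eqI[of _ _ "multi_list m"]) (simp_all add: count_multi_list length_multi_list)
qed (auto simp: length_eq_multi_abs)

lemma finite_multi_abs_eq [simp]: "finite {m :: 'n::{finite,linorder} multi. multi_abs m = k}"
  by (simp add: multi_abs_image)

lemma card_multi_abs_eq: "card {m :: 'n::{finite,linorder} multi. multi_abs m = k} \<le> CARD('n) ^ k"
proof -
  have "card {m :: 'n multi. multi_abs m = k} \<le> card {js :: 'n list. length js = k}"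
    unfolding multi_abs_image by (rule card_image_le) simp
  also have "\<dots> = CARD('n) ^ k"
    using card_lists_length_eq[of "UNIV :: 'n set" k] by simp
  finally show ?thesis .
qed

lemma fueter_sum_lists:
  "fueter_sum k c x =
    (\<Sum>js | length js = k. foldr (\<lambda>j y. fueter_var j x \<cdot>\<^sub>c y) js (c (count_list js)))"
proof (induction k arbitrary: c)
  case (Suc k)
  have inj: "inj_on (\<lambda>(j, js). j # js) (UNIV \<times> {js :: 'a list. length js = k})" by (auto simp: inj_on_def)
  have im: "{js :: 'a list. length js = Suc k} = (\<lambda>(j, js). j # js) ` (UNIV \<times> {js. length js = k})"
    by (auto simp: length_Suc_conv image_iff)
  show ?case
    unfolding im sum.reindex[OF inj] fueter_sum.simps Suc.IH cmul.sum_right sum.cartesian_product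
    by (simp add: o_def case_prod_unfold count_list_Cons)
next
  case 0
  have "count_list [] = (\<lambda>_::'a. 0)" by auto
  then show ?case by simp
qed

lemma foldr_fueter_var_right:
  "foldr (\<lambda>j y. fueter_var j x \<cdot>\<^sub>c y) js a = foldr (\<lambda>j y. fueter_var j x \<cdot>\<^sub>c y) js cl_one \<cdot>\<^sub>c a"
  by (induction js) (simp_all add: cl_one_cmul cmul_assoc)

lemma multi_fact_pos: "multi_fact m > 0"
  by (simp add: multi_fact_def prod_pos)

lemma fueter_sum_eq:
  "fueter_sum k c x = (\<Sum>m | multi_abs m = k. (fact k / multi_fact m) *\<^sub>R (fueter m x \<cdot>\<^sub>c c m))"
proof -
  let ?z = "\<lambda>js a. foldr (\<lambda>j y. fueter_var j x \<cdot>\<^sub>c y) js a"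
  have "fueter_sum k c x =
      (\<Sum>m | multi_abs m = k. \<Sum>js | js \<in> {js. length js = k} \<and> count_list js = m. ?z js (c (count_list js)))"
    unfolding fueter_sum_lists by (rule sum.group[symmetric]) (auto simp: length_eq_multi_abs[symmetric])
  also have "\<dots> = (\<Sum>m | multi_abs m = k. (fact k / multi_fact m) *\<^sub>R (fueter m x \<cdot>\<^sub>c c m))"
  proof (rule sum.cong[OF refl])
    fix m :: "'a multi" assume m: "m \<in> {m. multi_abs m = k}"
    have set: "{js. js \<in> {js. length js = k} \<and> count_list js = m} = {js. \<forall>i. count_list js i = m i}"
      using m by (auto simp: length_eq_multi_abs fun_eq_iff[symmetric])
    have "(\<Sum>js | js \<in> {js. length js = k} \<and> count_list js = m. ?z js (c (count_list js))) =
        (\<Sum>js | \<forall>i. count_list js i = m i. ?z js cl_one) \<cdot>\<^sub>c c m"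
      unfolding set cmul.sum_left
      by (rule sum.cong[OF refl], subst foldr_fueter_var_right) (auto simp: fun_eq_iff[symmetric])
    also have "(\<Sum>js | \<forall>i. count_list js i = m i. ?z js cl_one) = (fact k / multi_fact m) *\<^sub>R fueter m x"
      using m multi_fact_pos[of m] by (simp add: fueter_def)
    finally show "(\<Sum>js | js \<in> {js. length js = k} \<and> count_list js = m. ?z js (c (count_list js))) =
        (fact k / multi_fact m) *\<^sub>R (fueter m x \<cdot>\<^sub>c c m)"
      by (simp add: cmul.scaleR_left)
  qed
  finally show ?thesis .
qed

definition delta :: "'n multi \<Rightarrow> 'b \<Rightarrow> 'n multi \<Rightarrow> 'b::zero" where
  "delta m a = (\<lambda>l. if l = m then a else 0)"

text \<open>A coefficient family concentrated at one multi-index isolates a single Fueter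
  polynomial, which thus inherits monogenicity, bounds and derivatives from
  \<open>fueter_sum\<close>.\<close>

lemma fueter_eq_fueter_sum:
  "fueter m x \<cdot>\<^sub>c a = (multi_fact m / fact (multi_abs m)) *\<^sub>R fueter_sum (multi_abs m) (delta m a) x"
proof -
  have "fueter_sum (multi_abs m) (delta m a) x =
      (\<Sum>l | multi_abs l = multi_abs m. if l = m then (fact (multi_abs m) / multi_fact m) *\<^sub>R (fueter m x \<cdot>\<^sub>c a) else 0)"
    unfolding fueter_sum_eq by (rule sum.cong[OF refl]) (auto simp: delta_def cmul.zero_right)
  also have "\<dots> = (fact (multi_abs m) / multi_fact m) *\<^sub>R (fueter m x \<cdot>\<^sub>c a)"
    by (simp add: sum.delta')
  finally show ?thesis using multi_fact_pos[of m] by simp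
qed

lemma prod_fact_le: "finite A \<Longrightarrow> (\<Prod>i\<in>A. fact (m i) :: real) \<le> fact (\<Sum>i\<in>A. m i)"
proof (induction A rule: finite_induct)
  case (insert i A)
  have "(\<Prod>i\<in>insert i A. fact (m i) :: real) \<le> fact (m i) * fact (\<Sum>i\<in>A. m i)"
    using insert by (simp add: mult_left_mono)
  also have "fact (m i) * fact (\<Sum>i\<in>A. m i) \<le> (fact (m i + (\<Sum>i\<in>A. m i)) :: real)"
    using dvd_imp_le[OF fact_fact_dvd_fact[of "m i" "\<Sum>i\<in>A. m i"]]
    by (metis fact_gt_zero of_nat_fact of_nat_le_iff of_nat_mult)
  finally show ?case using insert by simp
qed simp

lemma multi_fact_le: "multi_fact m \<le> fact (multi_abs m)"
  unfolding multi_fact_def multi_abs_def by (rule prod_fact_le) simp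

lemma monogenic_fueter: "monogenic (\<lambda>x. fueter m x \<cdot>\<^sub>c a)"
  unfolding fueter_eq_fueter_sum
  using monogenic_lincomb[OF monogenic_fueter_sum monogenic_fueter_sum, of "multi_fact m / fact (multi_abs m)"
      "multi_abs m" "delta m a" 0 0 "delta m a"] by simp

lemma fueter_bound:
  "norm (fueter m x \<cdot>\<^sub>c a) \<le> (fueter_const TYPE('n::{finite,linorder}) * norm x) ^ multi_abs m * norm (a :: 'n clifford)"
proof -
  have f: "0 \<le> multi_fact m / fact (multi_abs m)" "multi_fact m / fact (multi_abs m) \<le> 1"
    using multi_fact_pos[of m] multi_fact_le[of m] by simp_all
  have "norm (fueter m x \<cdot>\<^sub>c a) \<le> 1 * norm (fueter_sum (multi_abs m) (delta m a) x)"
    unfolding fueter_eq_fueter_sum norm_scaleR using f multi_fact_pos[of m] by (intro mult_right_mono) auto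
  also have "norm (fueter_sum (multi_abs m) (delta m a) x) \<le> (fueter_const TYPE('n) * norm x) ^ multi_abs m * norm a"
    by (rule fueter_sum_bound) (simp add: delta_def)
  finally show ?thesis by simp
qed

section \<open>The Taylor expansion\<close>

lemma dir_deriv_fueter_var:
  assumes "monogenic f"
  shows "dir_deriv v f x = (\<Sum>j\<in>UNIV. fueter_var j v \<cdot>\<^sub>c partial j f x)"
proof -
  have a: "partial0 f x = - (\<Sum>i\<in>UNIV. cl_unit i \<cdot>\<^sub>c partial i f x)"
    using monogenic_eq[OF assms] eq_neg_iff_add_eq_0 by blast
  show ?thesis
    unfolding dir_deriv_expand[OF monogenic_C1[OF assms], of v] a fueter_var_def
    by (simp add: cmul.diff_left cmul.scaleR_left cl_one_cmul sum_subtractf scaleR_sum_right)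
qed

lemma multi_deriv_radial:
  assumes "monogenic f"
  shows "((\<lambda>t. multi_deriv m f (t *\<^sub>R x)) has_vector_derivative
    (\<Sum>j\<in>UNIV. fueter_var j x \<cdot>\<^sub>c multi_deriv (incr j m) f (t *\<^sub>R x))) (at t within S)"
proof -
  let ?g = "multi_deriv m f"
  note g = monogenic_multi_deriv[OF assms, of m]
  have "((\<lambda>t. t *\<^sub>R x) has_derivative (\<lambda>h. h *\<^sub>R x)) (at t within S)"
    by (auto intro!: derivative_eq_intros)
  from has_derivative_compose[OF this C1_has_derivative[OF monogenic_C1[OF g]]]
  have "((\<lambda>t. ?g (t *\<^sub>R x)) has_vector_derivative dir_deriv x ?g (t *\<^sub>R x)) (at t within S)"
    unfolding linear_cmul[OF dir_deriv_linear[OF monogenic_C1[OF g]]] has_vector_derivative_def .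
  then show ?thesis
    unfolding dir_deriv_fueter_var[OF g] partial_multi_deriv[OF assms] .
qed

text \<open>Starting from \<open>k = 0\<close>, where the sum is f(t x), these are the successive
  derivatives of f along the ray, ready for the Taylor formula in one real variable.\<close>

lemma fueter_sum_multi_deriv_radial:
  assumes "monogenic f"
  shows "((\<lambda>t. fueter_sum k (\<lambda>m. multi_deriv m f (t *\<^sub>R x)) x) has_vector_derivative
    fueter_sum (Suc k) (\<lambda>m. multi_deriv m f (t *\<^sub>R x)) x) (at t within S)"
  unfolding fueter_sum_radial[symmetric]
  by (rule has_vector_derivative_fueter_sum_coeff) (rule multi_deriv_radial[OF assms])

lemma fueter_sum_taylor_coeff:
  "(1 / fact k) *\<^sub>R fueter_sum k (\<lambda>m. multi_deriv m f 0) x =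
     (\<Sum>m | multi_abs m = k. fueter m x \<cdot>\<^sub>c taylor_coeff f m)"
  by (simp add: fueter_sum_eq taylor_coeff_def scaleR_sum_right cmul.scaleR_right)

definition taylor_const :: "'n::{finite,linorder} itself \<Rightarrow> real" where
  "taylor_const _ = cauchy_const TYPE('n) * fueter_const TYPE('n)"

lemma taylor_const_pos: "taylor_const TYPE('n::{finite,linorder}) > 0"
  unfolding taylor_const_def by (intro mult_pos_pos cauchy_const_pos fueter_const_pos)

lemma finite_multi_abs_less: "finite {m :: 'n::{finite,linorder} multi. multi_abs m < p}"
proof -
  have "{m :: 'n multi. multi_abs m < p} = (\<Union>i<p. {m. multi_abs m = i})" by auto
  then show ?thesis by simp
qed

text \<open>Integral form of the remainder. The lower bound on \<open>R\<close> makes the Cauchy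
  factor times the size of a Fueter variable at most 1/2 per degree; the factor p is p! / (p -
  1)!.\<close>

lemma taylor_remainder_bound:
  fixes f :: "'n::{finite,linorder} cfun"
  assumes f: "monogenic f" and R: "R > 0" "R \<ge> 2 * taylor_const TYPE('n) * norm x"
    and B: "\<And>y. norm y \<le> norm x + R \<Longrightarrow> norm (f y) \<le> B" and p: "p > 0"
  shows "norm (f x - (\<Sum>m | multi_abs m < p. fueter m x \<cdot>\<^sub>c taylor_coeff f m)) \<le> real p * (1/2) ^ p * B"
proof -
  define T where "T k t = fueter_sum k (\<lambda>m. multi_deriv m f (t *\<^sub>R x)) x" for k t
  define F where "F t = ((1 - t) ^ (p - 1) / fact (p - 1)) *\<^sub>R T p t" for t :: real
  have "T 0 = (\<lambda>t. f (t *\<^sub>R x))" by (simp add: T_def fun_eq_iff)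
  then have "(F has_integral f (1 *\<^sub>R x) - (\<Sum>i<p. ((1 - 0) ^ i / fact i) *\<^sub>R T i 0)) {0..1}"
    unfolding F_def
    by (intro Taylor_has_integral p) (simp_all only: T_def fueter_sum_multi_deriv_radial[OF f] zero_le_one)
  moreover have "(\<Sum>i<p. ((1 - 0) ^ i / fact i) *\<^sub>R T i 0) =
      (\<Sum>m | multi_abs m < p. fueter m x \<cdot>\<^sub>c taylor_coeff f m)"
  proof -
    have "(\<Sum>m | multi_abs m < p. fueter m x \<cdot>\<^sub>c taylor_coeff f m) =
      (\<Sum>i<p. \<Sum>m | m \<in> {m. multi_abs m < p} \<and> multi_abs m = i. fueter m x \<cdot>\<^sub>c taylor_coeff f m)"
      by (rule sum.group[symmetric]) (auto simp: finite_multi_abs_less)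
    also have "\<dots> = (\<Sum>i<p. (1 / fact i) *\<^sub>R T i 0)"
      unfolding T_def by (intro sum.cong refl) (simp, subst fueter_sum_taylor_coeff, auto intro!: sum.cong)
    finally show ?thesis by simp
  qed
  ultimately have int: "(F has_integral f x - (\<Sum>m | multi_abs m < p. fueter m x \<cdot>\<^sub>c taylor_coeff f m)) (cbox 0 1)"
    by simp
  have B0: "B \<ge> 0" using order_trans[OF norm_ge_zero B[of x]] R by simp
  have Fb: "norm (F t) \<le> real p * (1/2) ^ p * B" if t: "t \<in> cbox 0 1" for t
  proof -
    have "norm (T p t) \<le> (fueter_const TYPE('n) * norm x) ^ p * (fact p * (cauchy_const TYPE('n) / R) ^ p * B)"
      unfolding T_def
    proof (rule fueter_sum_bound)
      fix m :: "'n multi" assume m: "multi_abs m = p"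
      have "norm (multi_deriv m f (t *\<^sub>R x)) \<le> fact (multi_abs m) * (cauchy_const TYPE('n) / R) ^ multi_abs m * B"
      proof (rule multi_deriv_bound[OF f R(1)])
        fix y assume "dist (t *\<^sub>R x) y \<le> R"
        moreover have "norm y \<le> norm (t *\<^sub>R x) + dist (t *\<^sub>R x) y"
          using norm_triangle_sub[of y "t *\<^sub>R x"] by (simp add: dist_norm norm_minus_commute)
        moreover have "norm (t *\<^sub>R x) \<le> norm x" using t by (simp add: mult_left_le_one_le)
        ultimately show "norm (f y) \<le> B" by (intro B) linarith
      qed
      then show "norm (multi_deriv m f (t *\<^sub>R x)) \<le> fact p * (cauchy_const TYPE('n) / R) ^ p * B"
        by (simp add: m)
    qed
    also have "\<dots> = fact p * (taylor_const TYPE('n) * norm x / R) ^ p * B"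
      by (simp add: taylor_const_def power_mult_distrib power_divide)
    also have "\<dots> \<le> fact p * (1/2) ^ p * B"
      using R B0 taylor_const_pos[where 'n = 'n]
      by (intro mult_right_mono mult_left_mono power_mono) (auto simp: field_simps)
    finally have 1: "norm (T p t) \<le> fact p * (1/2) ^ p * B" .
    have "norm (F t) = (1 - t) ^ (p - 1) / fact (p - 1) * norm (T p t)"
      using t by (simp add: F_def)
    also have "\<dots> \<le> 1 / fact (p - 1) * (fact p * (1/2) ^ p * B)"
      using t by (intro mult_mono 1 divide_right_mono power_le_one) auto
    also have "\<dots> = real p * (1/2) ^ p * B"
      using p by (simp add: fact_reduce)
    finally show ?thesis .
  qed
  show ?thesis
    using has_integral_bound[OF _ int Fb] B0 by simp
qed

section \<open>Multinomial numbers and a summable weight on multi-indices\<close>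

lemma card_multi_sequences:
  fixes m :: "'n::{finite,linorder} multi"
  shows "real (card {js. \<forall>i. count_list js i = m i}) = fact (multi_abs m) / multi_fact m"
proof -
  let ?A = "mset (multi_list m)"
  have c: "count ?A i = m i" for i by (simp add: count_mset count_multi_list)
  have set: "permutations_of_multiset ?A = {js. \<forall>i. count_list js i = m i}"
    by (auto simp: permutations_of_multiset_def multiset_eq_iff count_mset count_multi_list)
  have "(\<Prod>i\<in>set_mset ?A. fact (count ?A i) :: nat) = (\<Prod>i\<in>UNIV. fact (count ?A i))"
  proof (rule prod.mono_neutral_left)
    show "\<forall>i\<in>UNIV - set_mset ?A. fact (count ?A i) = (1 :: nat)"
    proof
      fix i assume "i \<in> UNIV - set_mset ?A"
      then have "count ?A i = 0" by (simp add: not_in_iff del: set_mset_mset)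
      then show "fact (count ?A i) = (1 :: nat)" by (simp only: fact_0)
    qed
  qed simp_all
  then have "(\<Prod>i\<in>set_mset ?A. fact (count ?A i) :: nat) = (\<Prod>i\<in>UNIV. fact (m i))"
    by (simp only: c)
  with card_permutations_of_multiset_aux[of ?A]
  have "card {js. \<forall>i. count_list js i = m i} * (\<Prod>i\<in>UNIV. fact (m i)) = fact (multi_abs m)"
    by (simp add: set length_multi_list)
  then have "real (card {js. \<forall>i. count_list js i = m i} * (\<Prod>i\<in>UNIV. fact (m i))) = real (fact (multi_abs m))"
    by (rule arg_cong)
  then have "real (card {js. \<forall>i. count_list js i = m i}) * multi_fact m = fact (multi_abs m)"
    by (simp add: multi_fact_def)
  then show ?thesis using multi_fact_pos[of m] by (simp add: field_simps)
qed

lemma fact_multi_abs_le: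
  fixes m :: "'n::{finite,linorder} multi"
  shows "fact (multi_abs m) / multi_fact m \<le> real CARD('n) ^ multi_abs m"
proof -
  have "card {js. \<forall>i. count_list js i = m i} \<le> card {js :: 'n list. length js = multi_abs m}"
    by (rule card_mono) (auto simp: length_eq_multi_abs[symmetric] fun_eq_iff[symmetric])
  also have "\<dots> = CARD('n) ^ multi_abs m"
    using card_lists_length_eq[of "UNIV :: 'n set" "multi_abs m"] by simp
  finally have "real (card {js. \<forall>i. count_list js i = m i}) \<le> real (CARD('n) ^ multi_abs m)"
    by (simp only: of_nat_le_iff)
  then show ?thesis unfolding card_multi_sequences by simp
qed

text \<open>The Cauchy estimate has |m|! where the Taylor coefficient divides by m!. The quotient is
  a multinomial number, which accounts for \<open>CARD('n)\<close> in the base.\<close>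

lemma taylor_coeff_bound:
  fixes f :: "'n::{finite,linorder} cfun"
  assumes f: "monogenic f" and R: "R > 0" and B: "\<And>y. norm y \<le> R \<Longrightarrow> norm (f y) \<le> B"
  shows "norm (taylor_coeff f m) \<le> (CARD('n) * cauchy_const TYPE('n) / R) ^ multi_abs m * B"
proof -
  have B0: "B \<ge> 0" using order_trans[OF norm_ge_zero B[of 0]] R by simp
  have "norm (taylor_coeff f m) \<le> 1 / multi_fact m * (fact (multi_abs m) * (cauchy_const TYPE('n) / R) ^ multi_abs m * B)"
    unfolding taylor_coeff_def norm_scaleR using multi_fact_pos[of m] multi_deriv_bound[OF f R, of 0 B m] B
    by (intro mult_mono) auto
  also have "\<dots> = fact (multi_abs m) / multi_fact m * ((cauchy_const TYPE('n) / R) ^ multi_abs m * B)"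
    by simp
  also have "\<dots> \<le> real CARD('n) ^ multi_abs m * ((cauchy_const TYPE('n) / R) ^ multi_abs m * B)"
    using B0 R cauchy_const_pos[where 'n = 'n] by (intro mult_right_mono fact_multi_abs_le) auto
  also have "\<dots> = (CARD('n) * cauchy_const TYPE('n) / R) ^ multi_abs m * B"
    by (simp add: power_mult_distrib power_divide)
  finally show ?thesis .
qed

text \<open>At most \<open>CARD('n) ^ k\<close> multi-indices have degree k, so degree k contributes
  at most \<open>(1/2) ^ k\<close> and the total is at most 2. The majorants and the operator series
  are summed by comparison with this weight.\<close>

definition multi_weight :: "'n::{finite,linorder} multi \<Rightarrow> real" where
  "multi_weight m = (1 / (2 * CARD('n))) ^ multi_abs m"

lemma multi_weight_nonneg: "multi_weight m \<ge> 0"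
  by (simp add: multi_weight_def)

lemma sum_multi_weight_le:
  assumes "finite (M :: 'n::{finite,linorder} multi set)"
  shows "sum multi_weight M \<le> 2"
proof -
  define K where "K = Suc (Max (insert 0 (multi_abs ` M)))"
  have "multi_abs m \<le> Max (insert 0 (multi_abs ` M))" if "m \<in> M" for m
    using assms that by (intro Max_ge) auto
  then have sub: "M \<subseteq> (\<Union>k<K. {m. multi_abs m = k})"
    by (auto simp: K_def less_Suc_eq_le)
  have "sum multi_weight M \<le> sum multi_weight (\<Union>k<K. {m :: 'n multi. multi_abs m = k})"
    by (rule sum_mono2[OF _ sub]) (auto simp: multi_weight_nonneg)
  also have "\<dots> = (\<Sum>k<K. \<Sum>m\<in>{m :: 'n multi. multi_abs m = k}. multi_weight m)"
    by (rule sum.UNION_disjoint) auto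
  also have "\<dots> \<le> (\<Sum>k<K. (1/2) ^ k)"
  proof (rule sum_mono)
    fix k
    have "(\<Sum>m\<in>{m :: 'n multi. multi_abs m = k}. multi_weight m) =
        real (card {m :: 'n multi. multi_abs m = k}) * (1 / (2 * CARD('n))) ^ k"
      by (simp add: multi_weight_def)
    also have "\<dots> \<le> real (CARD('n) ^ k) * (1 / (2 * CARD('n))) ^ k"
      by (intro mult_right_mono) (use card_multi_abs_eq[where 'n = 'n, of k] in \<open>simp_all only: of_nat_le_iff, simp\<close>)
    also have "\<dots> = (1/2) ^ k" by (simp add: power_divide power_mult_distrib)
    finally show "(\<Sum>m\<in>{m :: 'n multi. multi_abs m = k}. multi_weight m) \<le> (1/2) ^ k" .
  qed
  also have "\<dots> \<le> (\<Sum>k. (1/2 :: real) ^ k)"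
    by (rule sum_le_suminf) (auto simp: summable_geometric)
  also have "\<dots> = 2" using suminf_geometric[of "1/2 :: real"] by simp
  finally show ?thesis .
qed

lemma summable_multi_weight: "multi_weight summable_on (UNIV :: 'n::{finite,linorder} multi set)"
  by (rule nonneg_bdd_above_summable_on) (auto simp: multi_weight_nonneg bdd_above_def intro: sum_multi_weight_le)

lemma infsum_multi_weight_le: "infsum multi_weight (UNIV :: 'n::{finite,linorder} multi set) \<le> 2"
  by (rule infsum_le_finite_sums[OF summable_multi_weight]) (rule sum_multi_weight_le)

text \<open>The sum of the norms of the Taylor terms, with \<open>\<parallel>V\<^sub>m(x)\<parallel>\<close> replaced by its bound for \<open>\<parallel>x\<parallel> = r\<close>.\<close>

definition majorant :: "'n::{finite,linorder} cfun \<Rightarrow> real \<Rightarrow> real" where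
  "majorant f r = (\<Sum>\<^sub>\<infinity>m. norm (taylor_coeff f m) * (fueter_const TYPE('n) * r) ^ multi_abs m)"

lemma weighted_summable:
  fixes a :: "'n::{finite,linorder} multi \<Rightarrow> real"
  assumes "\<And>m. 0 \<le> a m" "\<And>m. a m \<le> C * multi_weight m"
  shows "a summable_on UNIV" "infsum a UNIV \<le> 2 * C"
proof -
  have C: "C \<ge> 0"
    using order_trans[OF assms(1) assms(2)[of "\<lambda>_. 0"]] by (simp add: multi_weight_def)
  have s: "(\<lambda>m::'n multi. C * multi_weight m) summable_on UNIV"
    by (rule summable_on_cmult_right[OF summable_multi_weight])
  show *: "a summable_on UNIV"
    by (rule summable_on_comparison_test[OF s]) (use assms in auto)
  have "infsum a UNIV \<le> infsum (\<lambda>m::'n multi. C * multi_weight m) UNIV"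
    by (rule infsum_mono[OF * s assms(2)])
  also have "\<dots> = C * infsum multi_weight (UNIV :: 'n multi set)" by (rule infsum_cmult_right')
  also have "\<dots> \<le> C * 2" by (intro mult_left_mono infsum_multi_weight_le C)
  finally show "infsum a UNIV \<le> 2 * C" by simp
qed

text \<open>One factor \<open>CARD('n)\<close> compensates \<open>taylor_coeff_bound\<close>; the
  other one, with the 2, produces \<open>multi_weight\<close>.\<close>

definition majorant_const :: "'n::{finite,linorder} itself \<Rightarrow> real" where
  "majorant_const _ = 2 * (real CARD('n))\<^sup>2 * taylor_const TYPE('n)"

lemma majorant_const_pos: "majorant_const TYPE('n::{finite,linorder}) > 0"
  unfolding majorant_const_def using taylor_const_pos[where 'n = 'n] by simp

lemma majorant_bound:
  fixes f :: "'n::{finite,linorder} cfun"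
  assumes f: "monogenic f" and R: "R > 0" "R \<ge> majorant_const TYPE('n) * r" and r: "r \<ge> 0"
    and B: "\<And>y. norm y \<le> R \<Longrightarrow> norm (f y) \<le> B"
  shows "(\<lambda>m. norm (taylor_coeff f m) * (fueter_const TYPE('n) * r) ^ multi_abs m) summable_on UNIV"
    and "majorant f r \<le> 2 * B"
proof -
  have B0: "B \<ge> 0" using order_trans[OF norm_ge_zero B[of 0]] R by simp
  note fp = fueter_const_pos[where 'n = 'n] and cp = cauchy_const_pos[where 'n = 'n]
  have b: "norm (taylor_coeff f m) * (fueter_const TYPE('n) * r) ^ multi_abs m \<le> B * multi_weight m" for m
  proof -
    have "norm (taylor_coeff f m) * (fueter_const TYPE('n) * r) ^ multi_abs m \<le>
       ((CARD('n) * cauchy_const TYPE('n) / R) ^ multi_abs m * B) * (fueter_const TYPE('n) * r) ^ multi_abs m"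
      using taylor_coeff_bound[OF f R(1) B] fp r by (intro mult_right_mono) auto
    also have "\<dots> = B * (CARD('n) * taylor_const TYPE('n) * r / R) ^ multi_abs m"
      by (simp add: taylor_const_def power_mult_distrib power_divide)
    also have "\<dots> \<le> B * multi_weight m"
      unfolding multi_weight_def
    proof (intro mult_left_mono power_mono B0)
      show "CARD('n) * taylor_const TYPE('n) * r / R \<le> 1 / (2 * CARD('n))"
        using R by (simp add: majorant_const_def power2_eq_square field_simps)
      show "0 \<le> CARD('n) * taylor_const TYPE('n) * r / R"
        using R r taylor_const_pos[where 'n = 'n] by simp
    qed
    finally show ?thesis .
  qed
  have nn: "0 \<le> norm (taylor_coeff f m) * (fueter_const TYPE('n) * r) ^ multi_abs m" for m
    using fp r by simp
  show "(\<lambda>m. norm (taylor_coeff f m) * (fueter_const TYPE('n) * r) ^ multi_abs m) summable_on UNIV"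
    "majorant f r \<le> 2 * B"
    unfolding majorant_def by (rule weighted_summable[OF nn b])+
qed

lemma monogenic_bounded_on_balls:
  assumes "monogenic f"
  obtains B where "\<And>y. norm y \<le> R \<Longrightarrow> norm (f y) \<le> B"
proof -
  have "compact (f ` cball 0 R)"
    by (intro compact_continuous_image C1_continuous(2) monogenic_C1 assms compact_cball)
  then obtain B where "\<forall>z\<in>f ` cball 0 R. norm z \<le> B"
    using compact_imp_bounded bounded_iff by blast
  then show ?thesis by (intro that[of B]) auto
qed

lemma majorant_summable:
  fixes f :: "'n::{finite,linorder} cfun"
  assumes f: "monogenic f" and r: "r \<ge> 0"
  shows "(\<lambda>m. norm (taylor_coeff f m) * (fueter_const TYPE('n) * r) ^ multi_abs m) summable_on UNIV"
proof -
  let ?R = "majorant_const TYPE('n) * r + 1"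
  obtain B where "\<And>y. norm y \<le> ?R \<Longrightarrow> norm (f y) \<le> B"
    using monogenic_bounded_on_balls[OF f] by blast
  then show ?thesis
    using majorant_const_pos[where 'n = 'n] r by (intro majorant_bound(1)[OF f, of ?R]) (auto intro!: add_nonneg_pos)
qed

lemma majorant_nonneg:
  fixes f :: "'n::{finite,linorder} cfun"
  shows "r \<ge> 0 \<Longrightarrow> majorant f r \<ge> 0"
  unfolding majorant_def
  by (intro infsum_nonneg mult_nonneg_nonneg zero_le_power norm_ge_zero less_imp_le[OF fueter_const_pos])

lemma fueter_taylor_bound:
  fixes a :: "'n::{finite,linorder} clifford"
  shows "norm (fueter m x \<cdot>\<^sub>c a) \<le> norm a * (fueter_const TYPE('n) * norm x) ^ multi_abs m"
  by (subst mult.commute) (rule fueter_bound)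

lemma taylor_abs_summable:
  fixes f :: "'n::{finite,linorder} cfun"
  assumes f: "monogenic f"
  shows "(\<lambda>m. norm (fueter m x \<cdot>\<^sub>c taylor_coeff f m)) summable_on UNIV"
  by (rule Infinite_Sum.abs_summable_on_comparison_test'[OF majorant_summable[OF f norm_ge_zero[of x]]])
    (rule fueter_taylor_bound)

text \<open>Links unordered summation to summation by degree, the form in which the remainder is
  estimated.\<close>

lemma filterlim_multi_abs_less:
  "filterlim (\<lambda>p. {m :: 'n::{finite,linorder} multi. multi_abs m < p}) (finite_subsets_at_top UNIV) sequentially"
  unfolding filterlim_finite_subsets_at_top
proof safe
  fix X :: "'n multi set" assume X: "finite X"
  have "X \<subseteq> {m. multi_abs m < p}" if "p \<ge> Suc (Max (insert 0 (multi_abs ` X)))" for p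
  proof
    fix m assume "m \<in> X"
    then have "multi_abs m \<le> Max (insert 0 (multi_abs ` X))" using X by (intro Max_ge) auto
    then show "m \<in> {m. multi_abs m < p}" using that by simp
  qed
  then show "\<forall>\<^sub>F p in sequentially. finite {m :: 'n multi. multi_abs m < p} \<and>
      X \<subseteq> {m. multi_abs m < p} \<and> {m :: 'n multi. multi_abs m < p} \<subseteq> UNIV"
    unfolding eventually_sequentially using finite_multi_abs_less by blast
qed

text \<open>Absolute summability, from the majorant, provides some value of the series. The partial
  sums by degree identify it, because their remainder is at most p (1/2)^p B.\<close>

theorem taylor_has_sum:
  fixes f :: "'n::{finite,linorder} cfun"
  assumes f: "monogenic f"
  shows "((\<lambda>m. fueter m x \<cdot>\<^sub>c taylor_coeff f m) has_sum f x) UNIV"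
proof -
  let ?t = "\<lambda>m. fueter m x \<cdot>\<^sub>c taylor_coeff f m"
  have "(?t has_sum infsum ?t UNIV) UNIV"
    by (rule has_sum_infsum[OF abs_summable_summable[OF taylor_abs_summable[OF f]]])
  then have "(sum ?t \<longlongrightarrow> infsum ?t UNIV) (finite_subsets_at_top UNIV)"
    by (simp add: has_sum_def)
  then have 1: "(\<lambda>p. \<Sum>m | multi_abs m < p. ?t m) \<longlonglongrightarrow> infsum ?t UNIV"
    by (rule filterlim_compose[OF _ filterlim_multi_abs_less])
  define R where "R = 2 * taylor_const TYPE('n) * norm x + 1"
  have R: "R > 0" "R \<ge> 2 * taylor_const TYPE('n) * norm x"
    using taylor_const_pos[where 'n = 'n] by (auto simp: R_def intro!: add_nonneg_pos)
  obtain B where B: "\<And>y. norm y \<le> norm x + R \<Longrightarrow> norm (f y) \<le> B"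
    using monogenic_bounded_on_balls[OF f] by blast
  have "(\<lambda>p. f x - (\<Sum>m | multi_abs m < p. ?t m)) \<longlonglongrightarrow> 0"
  proof (rule Lim_null_comparison)
    show "\<forall>\<^sub>F p in sequentially. norm (f x - (\<Sum>m | multi_abs m < p. ?t m)) \<le> real p * (1/2) ^ p * B"
      using eventually_gt_at_top[of 0] by eventually_elim (rule taylor_remainder_bound[OF f R B])
    have "(\<lambda>p. real p * (1/2) ^ p) \<longlonglongrightarrow> 0"
      using lim_n_over_pown[of "2::real"] by (simp add: power_divide)
    then show "(\<lambda>p. real p * (1/2) ^ p * B) \<longlonglongrightarrow> 0"
      using tendsto_mult_left_zero by blast
  qed
  from tendsto_diff[OF tendsto_const[of "f x"] this]
  have "(\<lambda>p. \<Sum>m | multi_abs m < p. ?t m) \<longlonglongrightarrow> f x" by simp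
  then have "infsum ?t UNIV = f x" using 1 LIMSEQ_unique by blast
  then show ?thesis using \<open>(?t has_sum infsum ?t UNIV) UNIV\<close> by simp
qed

section \<open>The CK-product\<close>

lemma dir_deriv_vanish:
  assumes f: "monogenic f" and z: "\<And>t. f (y + t *\<^sub>R v) = 0"
  shows "dir_deriv v f y = 0"
proof -
  have "((\<lambda>t. y + t *\<^sub>R v) has_derivative (\<lambda>t. t *\<^sub>R v)) (at 0)"
    by (auto intro!: derivative_eq_intros)
  from has_derivative_compose[OF this C1_has_derivative[OF monogenic_C1[OF f]]]
  have "((\<lambda>t. 0 :: 'a clifford) has_derivative (\<lambda>t. dir_deriv (t *\<^sub>R v) f (y + 0 *\<^sub>R v))) (at (0::real))"
    by (simp add: z)
  then have "(\<lambda>t::real. dir_deriv (t *\<^sub>R v) f (y + 0 *\<^sub>R v)) = (\<lambda>t. 0)"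
    using has_derivative_unique has_derivative_const by blast
  from fun_cong[OF this, of 1] show ?thesis by simp
qed

lemma list_deriv_vanish:
  assumes f: "monogenic f" and z: "\<And>y. f (0, y) = 0"
  shows "list_deriv js f (0, y) = 0"
proof (induction js arbitrary: y)
  case (Cons j js)
  show ?case unfolding list_deriv_simps
    by (rule dir_deriv_vanish[OF monogenic_list_deriv[OF f]]) (simp add: Cons.IH)
qed (simp add: z)

text \<open>Taylor coefficients contain only derivatives tangent to the hyperplane, and those of the
  difference vanish there; its Taylor series is therefore zero everywhere.\<close>

theorem monogenic_eqI:
  fixes f g :: "'n::{finite,linorder} cfun"
  assumes f: "monogenic f" and g: "monogenic g" and eq: "\<And>y. f (0, y) = g (0, y)"
  shows "f = g"
proof
  fix x
  let ?d = "\<lambda>x. 1 *\<^sub>R f x + (-1) *\<^sub>R g x"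
  have d: "monogenic ?d" by (intro monogenic_lincomb f g)
  have "list_deriv js ?d (0, 0) = 0" for js
    by (rule list_deriv_vanish[OF d]) (simp add: eq)
  then have "taylor_coeff ?d m = 0" for m
    by (simp add: taylor_coeff_def multi_deriv_eq_list_deriv zero_prod_def)
  then have "((\<lambda>m::'n multi. 0) has_sum ?d x) UNIV"
    using taylor_has_sum[OF d, of x] by (simp add: cmul.zero_right)
  then have "?d x = 0" using has_sum_unique[OF _ has_sum_0] by blast
  then show "f x = g x" by simp
qed

section \<open>Restriction of Fueter polynomials to the hyperplane\<close>

definition mpow :: "(real, 'n::finite) vec \<Rightarrow> 'n multi \<Rightarrow> real" where
  "mpow y m = (\<Prod>i\<in>UNIV. (y $ i) ^ m i)"

lemma mpow_incr: "mpow y (incr j m) = y $ j * mpow y m"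
proof -
  have "mpow y (incr j m) = (\<Prod>i\<in>UNIV. (if i = j then y $ j else 1) * (y $ i) ^ m i)"
    unfolding mpow_def by (rule prod.cong) (auto simp: incr_def)
  then show ?thesis by (simp add: prod.distrib mpow_def)
qed

lemma mpow_add: "mpow y (\<lambda>i. m i + k i) = mpow y m * mpow y k"
  by (simp add: mpow_def power_add prod.distrib)

text \<open>There the Fueter variables are real multiples of the unit. All words with the same
  letter counts agree, and their number cancels the normalizing factor.\<close>

lemma fueter_hyperplane:
  fixes m :: "'n::{finite,linorder} multi"
  shows "fueter m (0, y) = mpow y m *\<^sub>R cl_one"
proof -
  have 1: "foldr (\<lambda>j z. fueter_var j (0, y) \<cdot>\<^sub>c z) js cl_one = mpow y (count_list js) *\<^sub>R cl_one" for js :: "'n list"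
  proof (induction js)
    case (Cons j js)
    then show ?case
      by (simp add: count_list_Cons mpow_incr fueter_var_def cmul.scaleR_left cl_one_cmul del: count_list.simps)
  qed (simp add: mpow_def)
  have "(\<Sum>js | \<forall>i. count_list js i = m i. foldr (\<lambda>j z. fueter_var j (0, y) \<cdot>\<^sub>c z) js cl_one) =
      (\<Sum>js | \<forall>i. count_list js i = m i. mpow y m *\<^sub>R cl_one)"
    unfolding 1 by (rule sum.cong) (auto simp: fun_eq_iff[symmetric])
  also have "\<dots> = (fact (multi_abs m) / multi_fact m) *\<^sub>R (mpow y m *\<^sub>R cl_one)"
    unfolding sum_constant_scaleR card_multi_sequences ..
  finally show ?thesis
    using multi_fact_pos[of m] by (simp add: fueter_def)
qed

lemma fueter_hyperplane_cmul: "fueter m (0, y) \<cdot>\<^sub>c a = mpow y m *\<^sub>R a"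
  by (simp add: fueter_hyperplane cmul.scaleR_left cl_one_cmul)

text \<open>\<open>monogenic_uniform_limit\<close> speaks of sequences; an enumeration of the index
  type replaces the net of finite sets by a sequence.\<close>

lemma filterlim_countable_exhaustion:
  "filterlim (\<lambda>n. {p :: 'i::countable. to_nat p < n}) (finite_subsets_at_top UNIV) sequentially"
proof -
  have fin: "finite {p :: 'i. to_nat p < n}" for n
    using finite_vimageI[OF finite_lessThan[of n] inj_to_nat] by (simp add: vimage_def)
  show ?thesis
    unfolding filterlim_finite_subsets_at_top
  proof safe
    fix X :: "'i set" assume X: "finite X"
    have "X \<subseteq> {p. to_nat p < n}" if "n \<ge> Suc (Max (insert 0 (to_nat ` X)))" for n
    proof
      fix p assume "p \<in> X"
      then have "to_nat p \<le> Max (insert 0 (to_nat ` X))" using X by (intro Max_ge) auto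
      then show "p \<in> {p. to_nat p < n}" using that by simp
    qed
    then show "\<forall>\<^sub>F n in sequentially. finite {p :: 'i. to_nat p < n} \<and>
        X \<subseteq> {p. to_nat p < n} \<and> {p :: 'i. to_nat p < n} \<subseteq> UNIV"
      unfolding eventually_sequentially using fin by blast
  qed
qed

lemma monogenic_zero: "monogenic (\<lambda>x. 0)"
  using monogenic_lincomb[OF monogenic_fueter monogenic_fueter, of 0 _ _ 0] by simp

lemma monogenic_add: "monogenic f \<Longrightarrow> monogenic g \<Longrightarrow> monogenic (\<lambda>x. f x + g x)"
  using monogenic_lincomb[of f g 1 1] by simp

lemma monogenic_scaleR: "monogenic f \<Longrightarrow> monogenic (\<lambda>x. c *\<^sub>R f x)"
  using monogenic_lincomb[of f f c 0] by simp

lemma monogenic_sum: "(\<And>i. i \<in> I \<Longrightarrow> monogenic (f i)) \<Longrightarrow> monogenic (\<lambda>x. \<Sum>i\<in>I. f i x)"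
  by (induction I rule: infinite_finite_induct) (auto simp: monogenic_zero monogenic_add)

lemma monogenic_infsum:
  fixes g :: "'i::countable \<Rightarrow> 'n::{finite,linorder} cfun"
  assumes mono: "\<And>p. monogenic (g p)"
    and sm: "\<And>R. R \<ge> 0 \<Longrightarrow> w R summable_on UNIV"
    and bd: "\<And>R p x. norm x \<le> R \<Longrightarrow> norm (g p x) \<le> w R p"
  shows "monogenic (\<lambda>x. \<Sum>\<^sub>\<infinity>p. g p x)"
proof (rule monogenic_uniform_limit(1))
  show "monogenic (\<lambda>x. \<Sum>p | to_nat p < n. g p x)" for n
    by (intro monogenic_sum mono)
  fix R :: real
  show "uniform_limit (cball 0 R) (\<lambda>n x. \<Sum>p | to_nat p < n. g p x) (\<lambda>x. \<Sum>\<^sub>\<infinity>p. g p x) sequentially"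
  proof (cases "R \<ge> 0")
    case True
    have "uniform_limit (cball 0 R) (\<lambda>X x. \<Sum>p\<in>X. g p x) (\<lambda>x. \<Sum>\<^sub>\<infinity>p. g p x) (finite_subsets_at_top UNIV)"
      by (rule Weierstrass_m_test_general[OF _ sm[OF True]]) (simp add: bd)
    then show ?thesis
      using filterlim_compose[OF _ filterlim_countable_exhaustion, of "\<lambda>X x. \<Sum>p\<in>X. g p x"]
      by (simp add: o_def)
  qed simp
qed

text \<open>The bound for Fueter polynomials is multiplicative in the degree, so the term with
  indices m and k is at most \<open>cmul_const\<close> times a term of \<open>majorant f\<close>
  times a term of \<open>majorant g\<close>. Summability over pairs also turns the iterated sum of
  the definition into a single one.\<close>

lemma CK_prod_monogenic_bound:
  fixes f g :: "'n::{finite,linorder} cfun"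
  assumes f: "monogenic f" and g: "monogenic g"
  shows "monogenic (f \<odot>\<^sub>L g)"
    and "norm ((f \<odot>\<^sub>L g) x) \<le> cmul_const TYPE('n) * majorant f (norm x) * majorant g (norm x)"
proof -
  let ?K = "cmul_const TYPE('n)" and ?F = "fueter_const TYPE('n)"
  define t where "t p x = fueter (\<lambda>i. fst p i + snd p i) x \<cdot>\<^sub>c (taylor_coeff f (fst p) \<cdot>\<^sub>c taylor_coeff g (snd p))"
    for p :: "'n multi \<times> 'n multi" and x
  define v where "v h r m = norm (taylor_coeff h m) * (?F * r) ^ multi_abs m" for h :: "'n cfun" and r m
  define w where "w r p = ?K * v f r (fst p) * v g r (snd p)" for r p
  note K = cmul_const(1)[where 'n = 'n] and Fp = fueter_const_pos[where 'n = 'n]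
  have v0: "v h r m \<ge> 0" if "r \<ge> 0" for h r m unfolding v_def using that Fp by simp
  have vs: "v h r summable_on UNIV" if "monogenic h" "r \<ge> 0" for h r
    unfolding v_def by (rule majorant_summable[OF that])
  have hs: "((\<lambda>k. w r (m, k)) has_sum ?K * v f r m * majorant g r) UNIV" if "r \<ge> 0" for r m
    unfolding w_def fst_conv snd_conv majorant_def v_def[symmetric]
    by (intro has_sum_cmult_right has_sum_infsum vs g that)
  have ws: "(w r has_sum ?K * majorant f r * majorant g r) (UNIV \<times> UNIV)" if r: "r \<ge> 0" for r
  proof -
    have s: "((\<lambda>m. ?K * v f r m * majorant g r) has_sum ?K * majorant f r * majorant g r) UNIV"
      unfolding majorant_def[of f] v_def[symmetric]
      by (intro has_sum_cmult_left has_sum_cmult_right has_sum_infsum vs f r)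
    have "w r summable_on (UNIV \<times> UNIV)"
    proof (rule summable_on_SigmaI[OF hs[OF r]])
      show "(\<lambda>m. ?K * v f r m * majorant g r) summable_on UNIV" using s has_sum_imp_summable by blast
      show "w r (m, k) \<ge> 0" for m k unfolding w_def using K v0[OF r] by simp
    qed
    then have "(w r has_sum infsum (w r) (UNIV \<times> UNIV)) (UNIV \<times> UNIV)" by (rule has_sum_infsum)
    moreover have "infsum (w r) (UNIV \<times> UNIV) = ?K * majorant f r * majorant g r"
      using has_sum_SigmaD[OF calculation hs[OF r]] s has_sum_unique by blast
    ultimately show ?thesis by simp
  qed
  have bd: "norm (t p x) \<le> w r p" if "norm x \<le> r" for p x r
  proof -
    have "norm (t p x) \<le> (?F * norm x) ^ (multi_abs (fst p) + multi_abs (snd p)) *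
        norm (taylor_coeff f (fst p) \<cdot>\<^sub>c taylor_coeff g (snd p))"
      unfolding t_def using fueter_bound[of "\<lambda>i. fst p i + snd p i"] by (simp add: multi_abs_def sum.distrib)
    also have "\<dots> \<le> (?F * r) ^ (multi_abs (fst p) + multi_abs (snd p)) *
        (?K * norm (taylor_coeff f (fst p)) * norm (taylor_coeff g (snd p)))"
      using that Fp order_trans[OF norm_ge_zero that]
      by (intro mult_mono power_mono mult_left_mono cmul_const(2)) auto
    also have "\<dots> = w r p" by (simp add: w_def v_def power_add)
    finally show ?thesis .
  qed
  have wsm: "w r summable_on UNIV" if "r \<ge> 0" for r
    using has_sum_imp_summable[OF ws[OF that]] by simp
  have abs: "(\<lambda>p. norm (t p x)) summable_on UNIV" for x
    by (rule Infinite_Sum.abs_summable_on_comparison_test'[OF wsm[OF norm_ge_zero[of x]]]) (simp add: bd)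
  have eq: "(f \<odot>\<^sub>L g) x = (\<Sum>\<^sub>\<infinity>p. t p x)" for x
  proof -
    have "(\<lambda>(m, k). t (m, k) x) summable_on (UNIV \<times> UNIV)"
      using abs_summable_summable[OF abs[of x]] by (simp add: case_prod_unfold)
    from infsum_Sigma'_banach[OF this] show ?thesis
      unfolding CK_prod_def by (simp add: t_def case_prod_unfold)
  qed
  have "monogenic (t p)" for p
    unfolding t_def by (rule monogenic_fueter)
  then have "monogenic (\<lambda>x. \<Sum>\<^sub>\<infinity>p. t p x)"
    by (rule monogenic_infsum[where w = w, OF _ wsm bd])
  then show "monogenic (f \<odot>\<^sub>L g)" by (simp add: eq[abs_def, symmetric])
  have "norm ((f \<odot>\<^sub>L g) x) \<le> (\<Sum>\<^sub>\<infinity>p. norm (t p x))"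
    unfolding eq by (rule norm_infsum_bound[OF abs])
  also have "\<dots> \<le> (\<Sum>\<^sub>\<infinity>p. w (norm x) p)"
    by (intro infsum_mono abs wsm bd) auto
  also have "\<dots> = ?K * majorant f (norm x) * majorant g (norm x)"
    using infsumI[OF ws[OF norm_ge_zero[of x]]] by simp
  finally show "norm ((f \<odot>\<^sub>L g) x) \<le> ?K * majorant f (norm x) * majorant g (norm x)" .
qed

text \<open>On the hyperplane V_{m+k} is a real monomial, which splits as V_m V_k and moves past the
  coefficient between them, so the iterated sum factors.\<close>

lemma CK_prod_hyperplane:
  fixes f g :: "'n::{finite,linorder} cfun"
  assumes f: "monogenic f" and g: "monogenic g"
  shows "(f \<odot>\<^sub>L g) (0, y) = f (0, y) \<cdot>\<^sub>c g (0, y)"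
proof -
  have t: "fueter (\<lambda>i. m i + k i) (0, y) \<cdot>\<^sub>c (a \<cdot>\<^sub>c b) = (fueter m (0, y) \<cdot>\<^sub>c a) \<cdot>\<^sub>c (fueter k (0, y) \<cdot>\<^sub>c b)"
    for m k and a b :: "'n clifford"
    by (simp add: fueter_hyperplane_cmul mpow_add cmul.scaleR_left cmul.scaleR_right)
  have "(\<Sum>\<^sub>\<infinity>k. (fueter m (0, y) \<cdot>\<^sub>c a) \<cdot>\<^sub>c (fueter k (0, y) \<cdot>\<^sub>c taylor_coeff g k)) = (fueter m (0, y) \<cdot>\<^sub>c a) \<cdot>\<^sub>c g (0, y)" for m a
    by (rule infsumI, rule has_sum_bounded_linear[OF cmul.bounded_linear_right taylor_has_sum[OF g]])
  moreover have "(\<Sum>\<^sub>\<infinity>m. (fueter m (0, y) \<cdot>\<^sub>c taylor_coeff f m) \<cdot>\<^sub>c g (0, y)) = f (0, y) \<cdot>\<^sub>c g (0, y)"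
    by (rule infsumI, rule has_sum_bounded_linear[OF cmul.bounded_linear_left taylor_has_sum[OF f]])
  ultimately show ?thesis unfolding CK_prod_def t by simp
qed

section \<open>Derivatives and Taylor coefficients of Fueter polynomials\<close>

definition mshift :: "'n multi \<Rightarrow> 'n multi \<Rightarrow> 'n multi" where
  "mshift a b = (\<lambda>i. a i + b i)"

lemma multi_abs_mshift: "multi_abs (mshift a b) = multi_abs a + multi_abs b"
  by (simp add: multi_abs_def mshift_def sum.distrib)

lemma taylor_coeff_multi_deriv:
  assumes "monogenic f"
  shows "taylor_coeff (multi_deriv m f) l =
    (multi_fact (mshift l m) / multi_fact l) *\<^sub>R taylor_coeff f (mshift l m)"
  using multi_fact_pos[of "mshift l m"]
  by (simp add: taylor_coeff_def multi_deriv_add[OF assms] mshift_def)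

text \<open>Division by k! makes differentiation a pure shift of the coefficient family, until the
  degree is exhausted.\<close>

lemma list_deriv_fueter_sum:
  "list_deriv js (\<lambda>x. (1 / fact k) *\<^sub>R fueter_sum k c x) =
    (\<lambda>x. if length js \<le> k then (1 / fact (k - length js)) *\<^sub>R
       fueter_sum (k - length js) (\<lambda>m. c (mshift m (count_list js))) x else 0)"
proof (induction js)
  case Nil
  have "mshift m (count_list []) = m" for m :: "'a multi" by (simp add: mshift_def)
  then show ?case by simp
next
  case (Cons j js)
  let ?c = "\<lambda>m. c (mshift m (count_list js))" and ?l = "k - length js"
  have D: "partial j (\<lambda>x. a *\<^sub>R fueter_sum l d x) x = a *\<^sub>R (real l *\<^sub>R fueter_sum (l - 1) (\<lambda>m. d (incr j m)) x)"
    for a l d x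
    unfolding partial_fueter_sum[symmetric]
    by (rule dir_deriv_eqI[OF has_derivative_scaleR_right[OF C1_has_derivative[OF monogenic_C1[OF monogenic_fueter_sum]]]])
  have Z: "partial j (\<lambda>x. 0) x = (0 :: 'a clifford)" for x
    by (rule dir_deriv_eqI[OF has_derivative_const])
  have i: "mshift (incr j m) (count_list js) = mshift m (count_list (j # js))" for m
    by (auto simp: mshift_def incr_def fun_eq_iff)
  show ?case
  proof
    fix x
    show "list_deriv (j # js) (\<lambda>x. (1 / fact k) *\<^sub>R fueter_sum k c x) x =
        (if length (j # js) \<le> k then (1 / fact (k - length (j # js))) *\<^sub>R
         fueter_sum (k - length (j # js)) (\<lambda>m. c (mshift m (count_list (j # js)))) x else 0)"
    proof (cases "length js \<le> k")
      case True
      have "list_deriv (j # js) (\<lambda>x. (1 / fact k) *\<^sub>R fueter_sum k c x) x =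
        (1 / fact ?l) *\<^sub>R (real ?l *\<^sub>R fueter_sum (?l - 1) (\<lambda>m. c (mshift m (count_list (j # js)))) x)"
        unfolding list_deriv_simps Cons.IH using True D[of "1 / fact ?l" ?l ?c x] by (simp only: if_True i)
      also have "\<dots> = (if length (j # js) \<le> k then (1 / fact (k - length (j # js))) *\<^sub>R
         fueter_sum (k - length (j # js)) (\<lambda>m. c (mshift m (count_list (j # js)))) x else 0)"
      proof (cases "?l = 0")
        case False
        then have "real ?l / fact ?l = 1 / fact (?l - 1)" by (simp add: fact_reduce)
        then show ?thesis using False by (simp del: count_list.simps)
      qed (use True in simp)
      finally show ?thesis .
    next
      case False
      then show ?thesis unfolding list_deriv_simps Cons.IH using Z by simp
    qed
  qed
qed

text \<open>Shifting the family concentrated at m by l yields the one concentrated at m - l, or the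
  zero family if \<open>l \<le> m\<close> fails. The guard makes the truncated subtraction a genuine
  one.\<close>

lemma multi_deriv_fueter:
  fixes a :: "'n::{finite,linorder} clifford"
  shows "multi_deriv l (\<lambda>x. fueter m x \<cdot>\<^sub>c a) =
    (\<lambda>x. if l \<le> m then (multi_fact m / multi_fact (\<lambda>i. m i - l i)) *\<^sub>R (fueter (\<lambda>i. m i - l i) x \<cdot>\<^sub>c a) else 0)"
proof
  fix x
  let ?k = "multi_abs m" and ?l = "multi_abs l" and ?d = "\<lambda>i. m i - l i"
  have V: "(\<lambda>x. fueter m x \<cdot>\<^sub>c a) = (\<lambda>x. (1 / fact ?k) *\<^sub>R fueter_sum ?k (delta m (multi_fact m *\<^sub>R a)) x)"
  proof
    fix x
    have "fueter_sum ?k (delta m (multi_fact m *\<^sub>R a)) x =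
      (fact ?k / multi_fact m) *\<^sub>R (fueter m x \<cdot>\<^sub>c (multi_fact m *\<^sub>R a))"
      unfolding fueter_eq_fueter_sum using multi_fact_pos[of m] by simp
    then show "fueter m x \<cdot>\<^sub>c a = (1 / fact ?k) *\<^sub>R fueter_sum ?k (delta m (multi_fact m *\<^sub>R a)) x"
      using multi_fact_pos[of m] by (simp add: cmul.scaleR_right)
  qed
  have D: "multi_deriv l (\<lambda>x. fueter m x \<cdot>\<^sub>c a) x = (if ?l \<le> ?k then (1 / fact (?k - ?l)) *\<^sub>R
       fueter_sum (?k - ?l) (\<lambda>p. delta m (multi_fact m *\<^sub>R a) (mshift p l)) x else 0)"
    unfolding V multi_deriv_eq_list_deriv list_deriv_fueter_sum by (simp add: length_multi_list count_multi_list)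
  show "multi_deriv l (\<lambda>x. fueter m x \<cdot>\<^sub>c a) x = (if l \<le> m then (multi_fact m / multi_fact ?d) *\<^sub>R (fueter ?d x \<cdot>\<^sub>c a) else 0)"
  proof (cases "l \<le> m")
    case True
    then have le: "l i \<le> m i" for i by (simp add: le_fun_def)
    have m: "m = mshift ?d l" using le by (auto simp: mshift_def)
    have k: "?k = multi_abs ?d + ?l" by (subst m) (rule multi_abs_mshift)
    have "(\<lambda>p. delta m (multi_fact m *\<^sub>R a) (mshift p l)) = delta ?d (multi_fact m *\<^sub>R a)"
    proof
      fix p
      have "mshift p l = m \<longleftrightarrow> p = ?d"
        using le by (auto simp: mshift_def fun_eq_iff) (metis add_diff_cancel_right')
      then show "delta m (multi_fact m *\<^sub>R a) (mshift p l) = delta ?d (multi_fact m *\<^sub>R a) p"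
        by (simp add: delta_def)
    qed
    moreover have "fueter ?d x \<cdot>\<^sub>c (multi_fact m *\<^sub>R a) = (multi_fact ?d / fact (multi_abs ?d)) *\<^sub>R
        fueter_sum (multi_abs ?d) (delta ?d (multi_fact m *\<^sub>R a)) x"
      by (rule fueter_eq_fueter_sum)
    ultimately have "(1 / multi_fact ?d) *\<^sub>R (fueter ?d x \<cdot>\<^sub>c (multi_fact m *\<^sub>R a)) =
        (1 / fact (multi_abs ?d)) *\<^sub>R fueter_sum (multi_abs ?d) (\<lambda>p. delta m (multi_fact m *\<^sub>R a) (mshift p l)) x"
      using multi_fact_pos[of ?d] by simp
    then show ?thesis
      using True unfolding D k by (simp add: cmul.scaleR_right)
  next
    case False
    then obtain i where "l i > m i" by (auto simp: le_fun_def not_le)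
    then have "mshift p l \<noteq> m" for p by (metis mshift_def not_add_less2)
    then have "(\<lambda>p. delta m (multi_fact m *\<^sub>R a) (mshift p l)) = (\<lambda>p. 0)" by (intro ext) (simp add: delta_def)
    moreover have "fueter_sum k (\<lambda>p. 0) x = (0 :: 'n clifford)" for k
      by (induction k) (simp_all add: cmul.zero_right)
    ultimately show ?thesis unfolding D using False by simp
  qed
qed

lemma taylor_coeff_fueter: "taylor_coeff (\<lambda>x. fueter m x \<cdot>\<^sub>c a) l = delta m a l"
proof (cases "l \<le> m \<and> l \<noteq> m")
  case True
  then obtain i where "m i - l i > 0" by (auto simp: le_fun_def fun_eq_iff) (metis nat_neq_iff not_less)
  then have "mpow 0 (\<lambda>i. m i - l i) = 0" by (auto simp: mpow_def intro!: bexI[of _ i])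
  then show ?thesis using True
    by (simp add: taylor_coeff_def multi_deriv_fueter delta_def zero_prod_def fueter_hyperplane_cmul)
next
  case False
  have "mpow 0 (\<lambda>i. m i - m i) = 1" by (simp add: mpow_def)
  moreover have "multi_fact (\<lambda>i. m i - m i) = 1" by (simp add: multi_fact_def)
  ultimately show ?thesis using False multi_fact_pos[of m]
    by (auto simp: taylor_coeff_def multi_deriv_fueter delta_def zero_prod_def fueter_hyperplane_cmul)
qed

lemma majorant_fueter:
  fixes a :: "'n::{finite,linorder} clifford"
  shows "majorant (\<lambda>x. fueter m x \<cdot>\<^sub>c a) r = norm a * (fueter_const TYPE('n) * r) ^ multi_abs m"
proof -
  have "((\<lambda>l. norm (delta m a l) * (fueter_const TYPE('n) * r) ^ multi_abs l) has_sum
      norm a * (fueter_const TYPE('n) * r) ^ multi_abs m) UNIV"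
    by (rule has_sum_finite_neutralI[of "{m}"]) (auto simp: delta_def)
  then show ?thesis unfolding majorant_def taylor_coeff_fueter by (rule infsumI)
qed

section \<open>Proximate orders\<close>

definition growth :: "(real \<Rightarrow> real) \<Rightarrow> real \<Rightarrow> real" where
  "growth \<rho> r = r powr \<rho> r"

lemma growth_nonneg: "growth \<rho> r \<ge> 0"
  by (simp add: growth_def)

text \<open>
  Since \<open>ln (growth \<rho> r) = \<rho> r ln r\<close> has the derivative \<open>(\<rho>' r r ln r + \<rho> r) / r\<close>, the function is, up to
  constants in the exponents, between \<open>r powr (\<rho>\<^sub>0 / 2)\<close> and \<open>r powr (2 \<rho>\<^sub>0)\<close> in the following
  relative sense.
\<close>

lemma growth_log_slope:
  assumes po: "proximate_order \<rho> \<rho>\<^sub>0" and pos: "\<rho>\<^sub>0 > 0"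
  obtains R where "R > 1" "\<And>s r. R \<le> s \<Longrightarrow> s \<le> r \<Longrightarrow>
    (r / s) powr (\<rho>\<^sub>0 / 2) * growth \<rho> s \<le> growth \<rho> r \<and> growth \<rho> r \<le> (r / s) powr (2 * \<rho>\<^sub>0) * growth \<rho> s"
proof -
  have d: "(\<rho> has_real_derivative deriv \<rho> r) (at r)" if "r > 0" for r
  proof -
    have "\<rho> differentiable (at r within {0<..})"
      using po that unfolding proximate_order_def
      by (meson differentiable_on_def differentiable_within_subset greaterThan_iff atLeast_iff less_imp_le subsetI)
    then have "\<rho> differentiable (at r)" using that at_within_open[of r "{0<..}"] by simp
    then show ?thesis using DERIV_deriv_iff_real_differentiable by blast
  qed
  have "((\<lambda>r. deriv \<rho> r * r * ln r + \<rho> r) \<longlongrightarrow> 0 + \<rho>\<^sub>0) at_top"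
    using po unfolding proximate_order_def by (intro tendsto_add) auto
  then have "\<forall>\<^sub>F r in at_top. dist (deriv \<rho> r * r * ln r + \<rho> r) \<rho>\<^sub>0 < \<rho>\<^sub>0 / 2"
    using pos by (intro tendstoD) auto
  then obtain R0 where R0: "\<And>r. r \<ge> R0 \<Longrightarrow> dist (deriv \<rho> r * r * ln r + \<rho> r) \<rho>\<^sub>0 < \<rho>\<^sub>0 / 2"
    by (auto simp: eventually_at_top_linorder)
  define R where "R = max R0 2"
  have sl: "\<rho>\<^sub>0 / 2 \<le> deriv \<rho> r * r * ln r + \<rho> r" "deriv \<rho> r * r * ln r + \<rho> r \<le> 2 * \<rho>\<^sub>0" if "r \<ge> R" for r
    using R0[of r] that pos unfolding R_def dist_real_def abs_diff_less_iff by (simp_all add: field_simps)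
  define H where "H c r = \<rho> r * ln r - c * ln r" for c r
  have Hd: "(H c has_real_derivative (deriv \<rho> r * r * ln r + \<rho> r - c) / r) (at r)" if "r \<ge> R" for c r
  proof -
    have r: "r > 0" using that by (simp add: R_def)
    show ?thesis unfolding H_def
      by (rule derivative_eq_intros d[OF r] refl r)+ (use r in \<open>simp add: field_simps\<close>)
  qed
  have "(r / s) powr (\<rho>\<^sub>0 / 2) * growth \<rho> s \<le> growth \<rho> r \<and> growth \<rho> r \<le> (r / s) powr (2 * \<rho>\<^sub>0) * growth \<rho> s"
    if s: "R \<le> s" "s \<le> r" for s r
  proof -
    have pos': "s > 0" "r > 0" using s by (auto simp: R_def)
    have e: "growth \<rho> x = exp (\<rho> x * ln x)" if "x > 0" for x using that by (simp add: growth_def powr_def)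
    have p: "(r / s) powr c * growth \<rho> s = exp (c * ln r - c * ln s + \<rho> s * ln s)" for c
      using pos' by (simp add: e powr_def ln_div exp_add exp_diff right_diff_distrib)
    have "H (\<rho>\<^sub>0 / 2) s \<le> H (\<rho>\<^sub>0 / 2) r"
    proof (rule DERIV_nonneg_imp_nondecreasing[OF s(2)])
      fix x assume "s \<le> x" "x \<le> r"
      then have x: "x \<ge> R" "x > 0" using s pos' by auto
      show "\<exists>y. (H (\<rho>\<^sub>0 / 2) has_real_derivative y) (at x) \<and> y \<ge> 0"
        using Hd[OF x(1)] sl[OF x(1)] x(2) by (intro exI conjI) auto
    qed
    moreover have "H (2 * \<rho>\<^sub>0) s \<ge> H (2 * \<rho>\<^sub>0) r"
    proof (rule DERIV_nonpos_imp_nonincreasing[OF s(2)])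
      fix x assume "s \<le> x" "x \<le> r"
      then have x: "x \<ge> R" "x > 0" using s pos' by auto
      show "\<exists>y. (H (2 * \<rho>\<^sub>0) has_real_derivative y) (at x) \<and> y \<le> 0"
        using Hd[OF x(1)] sl[OF x(1)] x(2) by (intro exI conjI) (auto simp: divide_nonpos_pos)
    qed
    ultimately show ?thesis unfolding p e[OF pos'(2)] by (simp add: H_def)
  qed
  then show ?thesis by (intro that[of R]) (auto simp: R_def)
qed

lemma growth_bounded:
  assumes "proximate_order \<rho> \<rho>\<^sub>0"
  obtains B where "B \<ge> 0" "\<And>s. 0 \<le> s \<Longrightarrow> s \<le> R \<Longrightarrow> growth \<rho> s \<le> B"
proof -
  have "continuous_on {0..} \<rho>"
    using assms differentiable_imp_continuous_on unfolding proximate_order_def by blast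
  then have "continuous_on {0..R} \<rho>" by (rule continuous_on_subset) auto
  then have "compact (\<rho> ` {0..R})" by (rule compact_continuous_image) auto
  then obtain M where "\<forall>z\<in>\<rho> ` {0..R}. norm z \<le> M"
    using compact_imp_bounded bounded_iff by blast
  then have M: "\<bar>\<rho> s\<bar> \<le> M" if "s \<in> {0..R}" for s using that by simp
  have "growth \<rho> s \<le> max 1 R powr max 0 M" if "0 \<le> s" "s \<le> R" for s
  proof -
    have "\<rho> s \<ge> 0" using assms that unfolding proximate_order_def by blast
    have "growth \<rho> s \<le> max 1 R powr \<rho> s"
      unfolding growth_def using that \<open>\<rho> s \<ge> 0\<close> by (intro powr_mono2) auto
    also have "\<dots> \<le> max 1 R powr max 0 M"
      using M[of s] that by (intro powr_mono) auto
    finally show ?thesis .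
  qed
  then show ?thesis by (intro that[of "max 1 R powr max 0 M"]) auto
qed

text \<open>For large arguments the slope estimate charges a power of the ratio; bounded arguments
  go into \<open>B\<close>. The \<open>+ 1\<close> admits radii that stay positive at
  \<open>r = 0\<close>, as the Cauchy estimates require.\<close>

lemma growth_dilation:
  assumes po: "proximate_order \<rho> \<rho>\<^sub>0" and pos: "\<rho>\<^sub>0 > 0"
  obtains K B where "K > 0" "B \<ge> 0" "\<And>r s. 0 \<le> s \<Longrightarrow> s \<le> \<mu> * r + 1 \<Longrightarrow> 0 \<le> r \<Longrightarrow> growth \<rho> s \<le> K * growth \<rho> r + B"
proof -
  obtain R where R: "R > 1" "\<And>s r. R \<le> s \<Longrightarrow> s \<le> r \<Longrightarrow>
    (r / s) powr (\<rho>\<^sub>0 / 2) * growth \<rho> s \<le> growth \<rho> r \<and> growth \<rho> r \<le> (r / s) powr (2 * \<rho>\<^sub>0) * growth \<rho> s"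
    using growth_log_slope[OF po pos] by blast
  \<comment> \<open>Since \<open>R > 1\<close>, an s above \<open>\<nu> * R\<close> forces
    \<open>r \<ge> R\<close>, so that both arguments lie in the range of the slope estimate.\<close>
  define \<nu> where "\<nu> = \<bar>\<mu>\<bar> + 1"
  have \<nu>: "\<nu> \<ge> 1" by (simp add: \<nu>_def)
  obtain B where B: "B \<ge> 0" "\<And>s. 0 \<le> s \<Longrightarrow> s \<le> \<nu> * R \<Longrightarrow> growth \<rho> s \<le> B"
    using growth_bounded[OF po, of "\<nu> * R"] by blast
  have "growth \<rho> s \<le> \<nu> powr (2 * \<rho>\<^sub>0) * growth \<rho> r + B"
    if s: "0 \<le> s" "s \<le> \<mu> * r + 1" "0 \<le> r" for r s
  proof (cases "s \<le> \<nu> * R")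
    case True
    then show ?thesis using B(2)[OF s(1) True] growth_nonneg[of \<rho> r] by (simp add: add_increasing)
  next
    case sR: False
    have mr: "\<mu> * r \<le> \<bar>\<mu>\<bar> * r" using s(3) by (intro mult_right_mono) auto
    have rR: "r \<ge> R"
    proof (rule ccontr)
      assume "\<not> R \<le> r"
      then have "\<bar>\<mu>\<bar> * r \<le> \<bar>\<mu>\<bar> * R" by (intro mult_left_mono) auto
      then show False using sR s mr R(1) unfolding \<nu>_def by (simp add: distrib_right)
    qed
    have "s \<le> \<bar>\<mu>\<bar> * r + r" using s mr rR R(1) by linarith
    then have sv: "s \<le> \<nu> * r" by (simp add: \<nu>_def distrib_right)
    show ?thesis
    proof (cases "s \<le> r")
      case True
      have "1 * R \<le> \<nu> * R" using \<nu> R(1) by (intro mult_right_mono) auto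
      then have "s \<ge> R" using sR by linarith
      then have "(r / s) powr (\<rho>\<^sub>0 / 2) * growth \<rho> s \<le> growth \<rho> r" using R(2)[of s r] True by blast
      moreover have "1 \<le> (r / s) powr (\<rho>\<^sub>0 / 2)"
        using True \<open>s \<ge> R\<close> R(1) pos by (intro ge_one_powr_ge_zero) (auto simp: field_simps)
      ultimately have "growth \<rho> s \<le> growth \<rho> r"
        using mult_right_mono[of 1 "(r / s) powr (\<rho>\<^sub>0 / 2)" "growth \<rho> s"] growth_nonneg[of \<rho> s] by simp
      also have "\<dots> \<le> \<nu> powr (2 * \<rho>\<^sub>0) * growth \<rho> r"
        using mult_right_mono[OF ge_one_powr_ge_zero[OF \<nu>, of "2 * \<rho>\<^sub>0"] growth_nonneg[of \<rho> r]] pos by simp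
      finally show ?thesis using B(1) by simp
    next
      case False
      then have "growth \<rho> s \<le> (s / r) powr (2 * \<rho>\<^sub>0) * growth \<rho> r" using R(2)[of r s] rR by auto
      also have "\<dots> \<le> \<nu> powr (2 * \<rho>\<^sub>0) * growth \<rho> r"
        using sv rR R(1) pos s by (intro mult_right_mono powr_mono2 growth_nonneg) (auto simp: field_simps)
      finally show ?thesis using B(1) by simp
    qed
  qed
  then show ?thesis using \<nu> B(1) by (intro that[of "\<nu> powr (2 * \<rho>\<^sub>0)" B]) auto
qed

lemma growth_bigo:
  assumes po1: "proximate_order \<rho>\<^sub>1 o\<^sub>1" and O: "growth \<rho>\<^sub>1 \<in> O[at_top](growth \<rho>\<^sub>2)"
  obtains K B where "K > 0" "B \<ge> 0" "\<And>r. 0 \<le> r \<Longrightarrow> growth \<rho>\<^sub>1 r \<le> K * growth \<rho>\<^sub>2 r + B"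
proof -
  obtain c where c: "c > 0" "\<forall>\<^sub>F r in at_top. norm (growth \<rho>\<^sub>1 r) \<le> c * norm (growth \<rho>\<^sub>2 r)"
    using O by (auto elim: landau_o.bigE)
  then obtain R where R: "\<And>r. r \<ge> R \<Longrightarrow> growth \<rho>\<^sub>1 r \<le> c * growth \<rho>\<^sub>2 r"
    unfolding eventually_at_top_linorder by (auto simp: growth_nonneg)
  obtain B where B: "B \<ge> 0" "\<And>s. 0 \<le> s \<Longrightarrow> s \<le> R \<Longrightarrow> growth \<rho>\<^sub>1 s \<le> B"
    using growth_bounded[OF po1, of R] by blast
  have "growth \<rho>\<^sub>1 r \<le> c * growth \<rho>\<^sub>2 r + B" if "0 \<le> r" for r
  proof (cases "r \<le> R")
    case True
    then show ?thesis using B(2)[OF that True] c(1) growth_nonneg[of \<rho>\<^sub>2 r] by (simp add: add_increasing)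
  next
    case False
    then show ?thesis using R[of r] B(1) by simp
  qed
  then show ?thesis using that c B by blast
qed

section \<open>Normalized orders and the gauge sequence\<close>

definition phi :: "(real \<Rightarrow> real) \<Rightarrow> real \<Rightarrow> real" where
  "phi \<rho> = the_inv_into {0<..} (growth \<rho>)"

text \<open>\<open>G_coeff\<close> stripped of its geometric factor
  (\<open>G_coeff_eq\<close>).\<close>

definition Phi :: "(real \<Rightarrow> real) \<Rightarrow> nat \<Rightarrow> real" where
  "Phi \<rho> q = (if q = 0 then 1 else phi \<rho> (real q) ^ q)"

locale normalized_order =
  fixes \<rho>' \<rho> :: "real \<Rightarrow> real" and \<rho>\<^sub>0 :: real
  assumes norm: "normalization \<rho>' \<rho> \<rho>\<^sub>0" and po: "proximate_order \<rho> \<rho>\<^sub>0" and pos: "\<rho>\<^sub>0 > 0"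
begin

lemma po': "proximate_order \<rho>' \<rho>\<^sub>0"
  and mono: "strict_mono_on {0<..} (growth \<rho>')"
  and onto: "growth \<rho>' ` {0<..} = {0<..}"
  using norm by (auto simp: normalization_def growth_def[abs_def])

lemma assumes "t > 0" shows phi_pos: "phi \<rho>' t > 0" and growth_phi: "growth \<rho>' (phi \<rho>' t) = t"
proof -
  have inj: "inj_on (growth \<rho>') {0<..}" using mono by (rule strict_mono_on_imp_inj_on)
  show "phi \<rho>' t > 0"
    using the_inv_into_into[OF inj, of t "{0<..}"] assms by (simp add: phi_def onto)
  show "growth \<rho>' (phi \<rho>' t) = t"
    using f_the_inv_into_f[OF inj, of t] assms by (simp add: phi_def onto)
qed

lemma growth_mono: "0 < s \<Longrightarrow> s \<le> r \<Longrightarrow> growth \<rho>' s \<le> growth \<rho>' r"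
  using strict_mono_onD[OF mono, of s r] by (cases "s = r") auto

lemma phi_mono: assumes "0 < s" "s \<le> t" shows "phi \<rho>' s \<le> phi \<rho>' t"
proof (rule ccontr)
  assume "\<not> ?thesis"
  then have "growth \<rho>' (phi \<rho>' t) < growth \<rho>' (phi \<rho>' s)"
    using assms phi_pos[of t] phi_pos[of s] by (intro strict_mono_onD[OF mono]) auto
  then show False using assms by (simp add: growth_phi)
qed

lemma growth_compare:
  obtains B where "B \<ge> 0" "\<And>r. 0 \<le> r \<Longrightarrow> growth \<rho> r \<le> growth \<rho>' r + B" "\<And>r. 0 \<le> r \<Longrightarrow> growth \<rho>' r \<le> growth \<rho> r + B"
proof -
  obtain r1 where r1: "\<forall>r\<ge>r1. \<rho>' r = \<rho> r" using norm by (auto simp: normalization_def)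
  obtain B where B: "B \<ge> 0" "\<And>s. 0 \<le> s \<Longrightarrow> s \<le> r1 \<Longrightarrow> growth \<rho> s \<le> B"
    using growth_bounded[OF po, of r1] by blast
  obtain B' where B': "B' \<ge> 0" "\<And>s. 0 \<le> s \<Longrightarrow> s \<le> r1 \<Longrightarrow> growth \<rho>' s \<le> B'"
    using growth_bounded[OF po', of r1] by blast
  show ?thesis
  proof (rule that[of "max B B'"])
    fix r :: real assume r: "0 \<le> r"
    have eq: "growth \<rho> r = growth \<rho>' r" if "\<not> r \<le> r1" using r1 that by (simp add: growth_def)
    show "growth \<rho> r \<le> growth \<rho>' r + max B B'"
      using B(2)[OF r] eq B(1) growth_nonneg[of \<rho>' r] by (cases "r \<le> r1") auto
    show "growth \<rho>' r \<le> growth \<rho> r + max B B'"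
      using B'(2)[OF r] eq B(1) growth_nonneg[of \<rho> r] by (cases "r \<le> r1") auto
  qed (use B in auto)
qed

lemma Phi_pos: "Phi \<rho>' q > 0"
  by (simp add: Phi_def phi_pos)

text \<open>Monotonicity of \<open>phi\<close> allows both arguments to be raised to p + q. This
  inequality separates the order of a derivative from the degree of its Taylor terms.\<close>

lemma Phi_mult_le: "Phi \<rho>' p * Phi \<rho>' q \<le> Phi \<rho>' (p + q)"
proof (cases "p = 0 \<or> q = 0")
  case False
  then have "phi \<rho>' p ^ p * phi \<rho>' q ^ q \<le> phi \<rho>' (p + q) ^ p * phi \<rho>' (p + q) ^ q"
    by (intro mult_mono power_mono phi_mono) (auto intro!: less_imp_le phi_pos zero_le_power)
  then show ?thesis using False by (simp add: Phi_def power_add)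
qed (auto simp: Phi_def)

lemma G_coeff_eq:
  "G_coeff \<rho>' \<rho>\<^sub>0 q = Phi \<rho>' q / ((exp 1 * \<rho>\<^sub>0) powr (1 / \<rho>\<^sub>0)) ^ q"
  using pos by (simp add: G_coeff_def Phi_def phi_def growth_def[abs_def] powr_power)

text \<open>The constant in \<open>growth \<rho>' r / growth \<rho>' s \<ge> c (r / s)\<^sup>a\<close> extends from large \<open>s\<close> to \<open>s \<ge> phi \<rho>' 1\<close>.\<close>

lemma growth_lower_slope:
  obtains c where "c > 0" "\<And>s r. phi \<rho>' 1 \<le> s \<Longrightarrow> s \<le> r \<Longrightarrow> c * (r / s) powr (\<rho>\<^sub>0 / 2) * growth \<rho>' s \<le> growth \<rho>' r"
proof -
  let ?h = "growth \<rho>'" and ?a = "\<rho>\<^sub>0 / 2" and ?s0 = "phi \<rho>' 1"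
  obtain R where R: "R > 1" "\<And>s r. R \<le> s \<Longrightarrow> s \<le> r \<Longrightarrow> (r / s) powr ?a * ?h s \<le> ?h r"
    using growth_log_slope[OF po' pos] by metis
  have s0: "?s0 > 0" by (rule phi_pos) simp
  \<comment> \<open>Below \<open>R\<close> only monotonicity of the growth is available. The ratio
    \<open>r / s\<close> gains at most \<open>R / ?s0\<close> over that range, and \<open>c\<close>
    pays for this.\<close>
  define c where "c = min 1 ((?s0 / R) powr ?a)"
  have c: "c > 0" "c \<le> 1" "c \<le> (?s0 / R) powr ?a" using s0 R(1) by (auto simp: c_def)
  have "c * (r / s) powr ?a * ?h s \<le> ?h r" if s: "?s0 \<le> s" "s \<le> r" for s r
  proof -
    have sp: "s > 0" "r > 0" using s s0 by auto
    consider "R \<le> s" | "r \<le> R" | "s < R" "R < r" by linarith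
    then show ?thesis
    proof cases
      case 1
      have "c * ((r / s) powr ?a * ?h s) \<le> 1 * ((r / s) powr ?a * ?h s)"
        using c growth_nonneg[of \<rho>' s] by (intro mult_right_mono) auto
      then show ?thesis using R(2)[OF 1 s(2)] by simp
    next
      case 2
      have "c * (r / s) powr ?a \<le> (?s0 / R) powr ?a * (r / s) powr ?a"
        using c by (intro mult_right_mono) auto
      also have "\<dots> = ((?s0 / R) * (r / s)) powr ?a" using s0 sp R(1) by (subst powr_mult) auto
      also have "\<dots> \<le> 1 powr ?a"
      proof (rule powr_mono2)
        have "?s0 * r \<le> s * R" using s 2 s0 sp by (intro mult_mono) auto
        then show "?s0 / R * (r / s) \<le> 1" using sp R(1) by (simp add: field_simps)
      qed (use s0 sp R(1) pos in auto)
      finally have "c * (r / s) powr ?a * ?h s \<le> 1 * ?h s"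
        using growth_nonneg[of \<rho>' s] by (intro mult_right_mono) auto
      also have "\<dots> \<le> ?h r" using growth_mono[OF sp(1) s(2)] by simp
      finally show ?thesis .
    next
      case 3
      have "c * (r / s) powr ?a \<le> (?s0 / R) powr ?a * (r / s) powr ?a"
        using c by (intro mult_right_mono) auto
      also have "\<dots> = ((?s0 / R) * (r / s)) powr ?a" using s0 sp R(1) by (subst powr_mult) auto
      also have "\<dots> \<le> (r / R) powr ?a"
      proof (rule powr_mono2)
        have "?s0 * r \<le> s * r" using s sp by (intro mult_right_mono) auto
        then show "?s0 / R * (r / s) \<le> r / R" using sp R(1) by (simp add: field_simps)
      qed (use s0 sp R(1) pos in auto)
      finally have "c * (r / s) powr ?a * ?h s \<le> (r / R) powr ?a * ?h R"
        using growth_mono[OF sp(1), of R] 3 growth_nonneg[of \<rho>' s] by (intro mult_mono) auto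
      also have "\<dots> \<le> ?h r" using R(2)[of R r] 3 by simp
      finally show ?thesis .
    qed
  qed
  then show ?thesis using c(1) that by blast
qed

text \<open>Only the case \<open>phi q < \<mu> r\<close> needs work. With y the ratio of these
  radii, the lower slope estimate bounds q y^a by the growth at \<open>\<mu> r\<close>, and ln z
  \<le> z converts this into a bound for q ln y that is independent of q. The dilation estimate then
  returns from \<open>\<mu> r\<close> to r.\<close>

lemma power_le_Phi:
  assumes \<mu>: "\<mu> > 0"
  obtains \<sigma> C where "\<sigma> > 0" "C > 0"
    "\<And>q r. r \<ge> 0 \<Longrightarrow> (\<mu> * r) ^ q \<le> C * Phi \<rho>' q * exp (\<sigma> * growth \<rho> r)"
proof -
  let ?h = "growth \<rho>'" and ?a = "\<rho>\<^sub>0 / 2"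
  obtain c where c: "c > 0" "\<And>s r. phi \<rho>' 1 \<le> s \<Longrightarrow> s \<le> r \<Longrightarrow> c * (r / s) powr ?a * ?h s \<le> ?h r"
    using growth_lower_slope by blast
  obtain K B where KB: "K > 0" "B \<ge> 0" "\<And>r s. 0 \<le> s \<Longrightarrow> s \<le> \<mu> * r + 1 \<Longrightarrow> 0 \<le> r \<Longrightarrow> ?h s \<le> K * ?h r + B"
    using growth_dilation[OF po' pos] by metis
  obtain B' where B': "B' \<ge> 0" "\<And>r. 0 \<le> r \<Longrightarrow> ?h r \<le> growth \<rho> r + B'"
    using growth_compare by metis
  \<comment> \<open>Chosen so that q ln y is at most \<open>k\<close> times the growth at
    \<open>\<mu> r\<close>.\<close>
  define k where "k = 1 / (c * ?a)"
  have k: "k > 0" using c pos by (simp add: k_def)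
  define \<sigma> C where "\<sigma> = k * K" and "C = exp (k * (K * B' + B))"
  have C1: "C \<ge> 1" using k KB B' by (simp add: C_def)
  have \<sigma>: "\<sigma> > 0" using k KB by (simp add: \<sigma>_def)
  have "(\<mu> * r) ^ q \<le> C * Phi \<rho>' q * exp (\<sigma> * growth \<rho> r)" if r: "r \<ge> 0" for q r
  proof -
    have e1: "1 \<le> C * exp (\<sigma> * growth \<rho> r)"
      using mult_mono[OF C1, of 1 "exp (\<sigma> * growth \<rho> r)"] \<sigma> growth_nonneg[of \<rho> r] C1 by simp
    show ?thesis
    proof (cases "q = 0")
      case True
      then show ?thesis using e1 by (simp add: Phi_def)
    next
      case False
      define s where "s = phi \<rho>' q"
      have s: "s > 0" "?h s = q" "phi \<rho>' 1 \<le> s"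
        using False phi_pos[of q] growth_phi[of q] phi_mono[of 1 q] by (auto simp: s_def)
      have Ph: "Phi \<rho>' q = s ^ q" using False by (simp add: Phi_def s_def)
      show ?thesis
      proof (cases "\<mu> * r \<le> s")
        case True
        have "(\<mu> * r) ^ q \<le> s ^ q * 1" using True \<mu> r by (simp add: power_mono)
        also have "\<dots> \<le> s ^ q * (C * exp (\<sigma> * growth \<rho> r))" using s by (intro mult_left_mono e1) auto
        finally show ?thesis unfolding Ph by (simp add: mult_ac)
      next
        case mr: False
        define X where "X = ?h (\<mu> * r) / c"
        define y where "y = \<mu> * r / s"
        have y: "y > 1" using mr s by (simp add: y_def field_simps)
        have "c * y powr ?a * real q \<le> ?h (\<mu> * r)"
          using c(2)[OF s(3), of "\<mu> * r"] mr s unfolding y_def by simp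
        then have yX: "y powr ?a \<le> X / q" using False c(1) by (simp add: X_def field_simps)
        have "0 < y powr ?a" using y by simp
        then have Xq: "X / q > 0" using yX by (rule less_le_trans)
        have "ln y * ?a = ln (y powr ?a)" using y by (simp add: ln_powr)
        also have "\<dots> \<le> ln (X / q)" using yX Xq y by (intro ln_mono) auto
        also have "\<dots> \<le> X / q" using ln_le_minus_one[OF Xq] by simp
        finally have "q * ln y \<le> X / ?a" using False pos by (simp add: field_simps)
        then have "y ^ q \<le> exp (X / ?a)"
          using y by (simp add: powr_realpow[symmetric] powr_def)
        also have "X / ?a = k * ?h (\<mu> * r)" by (simp add: X_def k_def)
        also have "exp (k * ?h (\<mu> * r)) \<le> exp (k * (K * (growth \<rho> r + B') + B))"
        proof -
          have "?h (\<mu> * r) \<le> K * ?h r + B" using KB(3)[of "\<mu> * r" r] \<mu> r by simp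
          also have "\<dots> \<le> K * (growth \<rho> r + B') + B" using B'(2)[OF r] KB by simp
          finally show ?thesis using k by simp
        qed
        also have "\<dots> = C * exp (\<sigma> * growth \<rho> r)" by (simp add: C_def \<sigma>_def exp_add[symmetric] algebra_simps)
        finally have "y ^ q * s ^ q \<le> C * exp (\<sigma> * growth \<rho> r) * s ^ q"
          using s by (intro mult_right_mono) auto
        moreover have "y ^ q * s ^ q = (\<mu> * r) ^ q" using s by (simp add: y_def power_divide)
        ultimately show ?thesis unfolding Ph by (simp add: mult_ac)
      qed
    qed
  qed
  then show ?thesis using \<sigma> C1 by (intro that[of \<sigma> C]) auto
qed

text \<open>The normalized growth equals q at \<open>phi q\<close>. On the ball of that radius the
  exponential weight is thus bounded geometrically in q.\<close>

lemma growth_below_phi: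
  obtains B where "B \<ge> 0" "\<And>q s. q > 0 \<Longrightarrow> 0 \<le> s \<Longrightarrow> s \<le> phi \<rho>' (real q) \<Longrightarrow> growth \<rho> s \<le> real q + B"
proof -
  obtain B where B: "B \<ge> 0" "\<And>r. 0 \<le> r \<Longrightarrow> growth \<rho> r \<le> growth \<rho>' r + B"
    using growth_compare by metis
  have "growth \<rho>' s \<le> real q" if "q > 0" "0 \<le> s" "s \<le> phi \<rho>' (real q)" for q s
    using growth_mono[of s "phi \<rho>' q"] growth_phi[of q] that by (cases "s = 0") (auto simp: growth_def)
  then have "growth \<rho> s \<le> real q + B" if "q > 0" "0 \<le> s" "s \<le> phi \<rho>' (real q)" for q s
    using B(2)[OF that(2)] that by (meson add_right_mono order_trans)
  then show ?thesis using B(1) that by blast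
qed

end

section \<open>Growth estimates\<close>

lemma A_stepI:
  assumes "monogenic f" "C \<ge> 0" "\<And>x. norm (f x) \<le> C * exp (\<sigma> * growth \<rho> (norm x))"
  shows "f \<in> A_step \<rho> \<sigma>" "A_norm \<rho> \<sigma> f \<le> C"
proof -
  show "f \<in> A_step \<rho> \<sigma>" unfolding A_step_iff using assms by (auto simp: growth_def)
  have "A_weighted \<rho> \<sigma> f x \<le> C" for x
    using assms(3)[of x] by (simp add: A_weighted_def growth_def exp_minus field_simps)
  then show "A_norm \<rho> \<sigma> f \<le> C" unfolding A_norm_def by (intro cSUP_least) auto
qed

lemma A_norm_bound:
  assumes "f \<in> A_step \<rho> \<sigma>"
  shows "norm (f x) \<le> A_norm \<rho> \<sigma> f * exp (\<sigma> * growth \<rho> (norm x))" and "A_norm \<rho> \<sigma> f \<ge> 0"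
proof -
  have le: "A_weighted \<rho> \<sigma> f x \<le> A_norm \<rho> \<sigma> f" for x
    unfolding A_norm_def using assms by (intro cSUP_upper) (auto simp: A_step_def)
  show "norm (f x) \<le> A_norm \<rho> \<sigma> f * exp (\<sigma> * growth \<rho> (norm x))"
    using le[of x] by (simp add: A_weighted_def growth_def exp_minus field_simps)
  have "0 \<le> A_weighted \<rho> \<sigma> f 0" by (simp add: A_weighted_def)
  then show "A_norm \<rho> \<sigma> f \<ge> 0" using le[of 0] by linarith
qed

lemma A_step_monogenic: "f \<in> A_step \<rho> \<sigma> \<Longrightarrow> monogenic f"
  by (simp add: A_step_def)

lemma A_space_monogenic: "f \<in> A_space \<rho> \<Longrightarrow> monogenic f"
  by (auto simp: A_space_def A_step_def)

lemma A_step_space: "f \<in> A_step \<rho> \<sigma> \<Longrightarrow> \<sigma> > 0 \<Longrightarrow> f \<in> A_space \<rho>"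
  by (auto simp: A_space_def)

lemma A_space_cmul_right:
  fixes f :: "'n::{finite,linorder} cfun"
  assumes "f \<in> A_space \<rho>"
  shows "(\<lambda>x. f x \<cdot>\<^sub>c a) \<in> A_space \<rho>"
proof -
  obtain \<sigma> where \<sigma>: "\<sigma> > 0" "f \<in> A_step \<rho> \<sigma>" using assms by (auto simp: A_space_def)
  have "norm (f x \<cdot>\<^sub>c a) \<le> (cmul_const TYPE('n) * A_norm \<rho> \<sigma> f * norm a) * exp (\<sigma> * growth \<rho> (norm x))" for x
  proof -
    have "norm (f x \<cdot>\<^sub>c a) \<le> cmul_const TYPE('n) * norm (f x) * norm a" by (rule cmul_const(2))
    also have "\<dots> \<le> cmul_const TYPE('n) * (A_norm \<rho> \<sigma> f * exp (\<sigma> * growth \<rho> (norm x))) * norm a"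
      using cmul_const(1)[where 'n = 'n]
      by (intro mult_right_mono mult_left_mono A_norm_bound \<sigma>) auto
    finally show ?thesis by (simp add: mult_ac)
  qed
  then have "(\<lambda>x. f x \<cdot>\<^sub>c a) \<in> A_step \<rho> \<sigma>"
    using cmul_const(1)[where 'n = 'n] A_norm_bound(2)[OF \<sigma>(2)]
    by (intro A_stepI(1)[where C = "cmul_const TYPE('n) * A_norm \<rho> \<sigma> f * norm a"]
        monogenic_cmul_right A_step_monogenic[OF \<sigma>(2)]) simp_all
  then show ?thesis using \<sigma>(1) by (rule A_step_space)
qed

section \<open>Summation against the weight\<close>

definition weight_tail :: "'n::{finite,linorder} multi set \<Rightarrow> real" where
  "weight_tail M = infsum multi_weight (UNIV :: 'n multi set) - sum multi_weight M"

lemma weight_tail_tendsto: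
  "(weight_tail \<longlongrightarrow> 0) (finite_subsets_at_top (UNIV :: 'n::{finite,linorder} multi set))"
proof -
  have "(sum multi_weight \<longlongrightarrow> infsum multi_weight (UNIV :: 'n multi set)) (finite_subsets_at_top (UNIV :: 'n multi set))"
    using has_sum_infsum[OF summable_multi_weight[where 'n = 'n]] by (simp add: has_sum_def)
  from tendsto_diff[OF tendsto_const[of "infsum multi_weight (UNIV :: 'n multi set)"] this]
  show ?thesis by (simp add: weight_tail_def[abs_def])
qed

lemma infsum_split_finite:
  fixes h :: "'a \<Rightarrow> 'b::banach"
  assumes M: "finite M" and h: "h summable_on UNIV"
  shows "infsum h UNIV = infsum h (UNIV - M) + sum h M"
proof -
  have "infsum h (M \<union> (UNIV - M)) = infsum h M + infsum h (UNIV - M)"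
    using M by (intro infsum_Un_disjoint summable_on_subset_banach[OF h]) auto
  then show ?thesis using M by (simp add: Un_Diff_cancel)
qed

text \<open>In the last claim the error factors into a constant depending on the terms and a null
  net that does not. Pointwise estimates thereby become convergence in the norm of one step.\<close>

lemma weight_dominated:
  fixes T :: "'n::{finite,linorder} multi \<Rightarrow> 'b::banach"
  assumes b: "\<And>m. norm (T m) \<le> c * multi_weight m"
  shows "T summable_on UNIV" and "norm (infsum T UNIV) \<le> 2 * c"
    and "finite M \<Longrightarrow> norm (sum T M - infsum T UNIV) \<le> c * weight_tail M"
proof -
  have ws: "(\<lambda>m::'n multi. c * multi_weight m) summable_on UNIV"
    by (rule summable_on_cmult_right[OF summable_multi_weight])
  have abs: "(\<lambda>m. norm (T m)) summable_on UNIV"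
    by (rule Infinite_Sum.abs_summable_on_comparison_test'[OF ws]) (rule b)
  show s: "T summable_on UNIV" by (rule abs_summable_summable[OF abs])
  have "norm (infsum T UNIV) \<le> infsum (\<lambda>m. norm (T m)) UNIV"
    by (rule norm_infsum_bound[OF abs])
  also have "\<dots> \<le> 2 * c" by (rule weighted_summable(2)) (use b in auto)
  finally show "norm (infsum T UNIV) \<le> 2 * c" .
  assume M: "finite M"
  have absM: "(\<lambda>m. norm (T m)) summable_on (UNIV - M)" by (rule summable_on_subset_banach[OF abs]) auto
  have wM: "(\<lambda>m::'n multi. c * multi_weight m) summable_on (UNIV - M)" by (rule summable_on_subset_banach[OF ws]) auto
  note split = infsum_split_finite[OF M]
  have "norm (sum T M - infsum T UNIV) = norm (infsum T (UNIV - M))"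
    by (subst split[OF s]) simp
  also have "\<dots> \<le> infsum (\<lambda>m. norm (T m)) (UNIV - M)" by (rule norm_infsum_bound[OF absM])
  also have "\<dots> \<le> infsum (\<lambda>m::'n multi. c * multi_weight m) (UNIV - M)"
    by (intro infsum_mono absM wM b)
  also have "\<dots> = infsum (\<lambda>m::'n multi. c * multi_weight m) UNIV - sum (\<lambda>m. c * multi_weight m) M"
    by (subst split[OF ws]) simp
  also have "\<dots> = c * weight_tail M"
    by (simp add: weight_tail_def infsum_cmult_right' right_diff_distrib sum_distrib_left)
  finally show "norm (sum T M - infsum T UNIV) \<le> c * weight_tail M" .
qed

text \<open>The majorant at r is controlled by f on the ball of radius
  \<open>majorant_const * r + 1\<close>; the dilation estimate turns this enlargement into a change
  of index and a constant factor.\<close>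

lemma majorant_growth:
  assumes po: "proximate_order \<rho> \<rho>\<^sub>0" and pos: "\<rho>\<^sub>0 > 0" and \<sigma>: "\<sigma> > 0"
  obtains \<sigma>' C where "\<sigma>' > 0" "C > 0"
    "\<And>f r. f \<in> A_step \<rho> \<sigma> \<Longrightarrow> r \<ge> 0 \<Longrightarrow>
      majorant (f :: 'n::{finite,linorder} cfun) r \<le> C * A_norm \<rho> \<sigma> f * exp (\<sigma>' * growth \<rho> r)"
proof -
  let ?\<mu> = "majorant_const TYPE('n)"
  obtain K B where KB: "K > 0" "B \<ge> 0"
    "\<And>r s. 0 \<le> s \<Longrightarrow> s \<le> ?\<mu> * r + 1 \<Longrightarrow> 0 \<le> r \<Longrightarrow> growth \<rho> s \<le> K * growth \<rho> r + B"
    using growth_dilation[OF po pos] by metis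
  have "majorant f r \<le> (2 * exp (\<sigma> * B)) * A_norm \<rho> \<sigma> f * exp ((\<sigma> * K) * growth \<rho> r)"
    if f: "f \<in> A_step \<rho> \<sigma>" and r: "r \<ge> 0" for f :: "'n cfun" and r
  proof -
    have "majorant f r \<le> 2 * (A_norm \<rho> \<sigma> f * exp (\<sigma> * (K * growth \<rho> r + B)))"
    proof (rule majorant_bound(2)[OF A_step_monogenic[OF f], of "?\<mu> * r + 1"])
      fix y :: "'n paravector" assume y: "norm y \<le> ?\<mu> * r + 1"
      have "norm (f y) \<le> A_norm \<rho> \<sigma> f * exp (\<sigma> * growth \<rho> (norm y))" by (rule A_norm_bound[OF f])
      also have "\<dots> \<le> A_norm \<rho> \<sigma> f * exp (\<sigma> * (K * growth \<rho> r + B))"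
        using KB(3)[OF norm_ge_zero y r] \<sigma> A_norm_bound(2)[OF f] by (intro mult_left_mono) auto
      finally show "norm (f y) \<le> A_norm \<rho> \<sigma> f * exp (\<sigma> * (K * growth \<rho> r + B))" .
    qed (use majorant_const_pos[where 'n = 'n] r in \<open>auto intro!: add_nonneg_pos\<close>)
    also have "\<dots> = (2 * exp (\<sigma> * B)) * A_norm \<rho> \<sigma> f * exp ((\<sigma> * K) * growth \<rho> r)"
      by (simp add: exp_add[symmetric] algebra_simps)
    finally show ?thesis .
  qed
  then show ?thesis using \<sigma> KB(1) by (intro that[of "\<sigma> * K" "2 * exp (\<sigma> * B)"]) auto
qed

lemma multi_fact_mshift_le:
  "multi_fact (mshift l m) \<le> 2 ^ multi_abs (mshift l m) * multi_fact l * multi_fact m"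
proof -
  have "(fact (a + b) :: real) \<le> 2 ^ (a + b) * fact a * fact b" for a b :: nat
  proof -
    have "real ((a + b) choose a) \<le> 2 ^ (a + b)"
      using binomial_le_pow2[of "a + b" a] by (metis of_nat_le_iff of_nat_numeral of_nat_power)
    moreover have "real ((a + b) choose a) = fact (a + b) / (fact a * fact b)"
      by (simp add: binomial_fact)
    ultimately show ?thesis by (simp add: field_simps)
  qed
  then have "multi_fact (mshift l m) \<le> (\<Prod>i\<in>UNIV. 2 ^ (l i + m i) * fact (l i) * fact (m i))"
    unfolding multi_fact_def mshift_def by (intro prod_mono) auto
  also have "\<dots> = 2 ^ multi_abs (mshift l m) * multi_fact l * multi_fact m"
    by (simp add: multi_fact_def multi_abs_def mshift_def prod.distrib power_sum)
  finally show ?thesis .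
qed

section \<open>Estimates for the terms of an operator series\<close>

locale operator_setting = normalized_order \<rho>\<^sub>1' \<rho>\<^sub>1 o\<^sub>1
  for \<rho>\<^sub>1' \<rho>\<^sub>1 :: "real \<Rightarrow> real" and o\<^sub>1 :: real +
  fixes \<rho>\<^sub>2 :: "real \<Rightarrow> real" and o\<^sub>2 :: real
  assumes po2: "proximate_order \<rho>\<^sub>2 o\<^sub>2" and pos2: "o\<^sub>2 > 0"
    and bigo: "growth \<rho>\<^sub>1 \<in> O[at_top](growth \<rho>\<^sub>2)"
begin

abbreviation "G1 \<equiv> growth \<rho>\<^sub>1"
abbreviation "G2 \<equiv> growth \<rho>\<^sub>2"
abbreviation "\<Phi> \<equiv> Phi \<rho>\<^sub>1'"

text \<open>A Cauchy estimate whose radius \<open>phi q\<close> is adapted to the degree q: the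
  power of the radius is \<open>\<Phi> q\<close>, and the weight contributes the geometric factor
  \<open>exp \<sigma> ^ q\<close>.\<close>

lemma coeff_bound:
  assumes \<sigma>: "\<sigma> > 0"
  obtains s C where "s > 0" "C > 0"
    "\<And>f m. f \<in> A_step \<rho>\<^sub>1 \<sigma> \<Longrightarrow>
      norm (taylor_coeff (f :: 'n::{finite,linorder} cfun) m) \<le> C * A_norm \<rho>\<^sub>1 \<sigma> f * s ^ multi_abs m / \<Phi> (multi_abs m)"
proof -
  let ?c = "real CARD('n) * cauchy_const TYPE('n)"
  obtain B where B: "B \<ge> 0" "\<And>q s. q > 0 \<Longrightarrow> 0 \<le> s \<Longrightarrow> s \<le> phi \<rho>\<^sub>1' (real q) \<Longrightarrow> G1 s \<le> real q + B"
    using growth_below_phi by blast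
  have c: "?c > 0" using cauchy_const_pos[where 'n = 'n] by simp
  have "norm (taylor_coeff f m) \<le> exp (\<sigma> * (B + 1)) * A_norm \<rho>\<^sub>1 \<sigma> f * (?c * exp \<sigma>) ^ multi_abs m / \<Phi> (multi_abs m)"
    if f: "f \<in> A_step \<rho>\<^sub>1 \<sigma>" for f :: "'n cfun" and m
  proof -
    define q where "q = multi_abs m"
    \<comment> \<open>\<open>growth_below_phi\<close> needs a positive argument. In degree 0 any
      positive radius serves, as \<open>R ^ 0\<close> and \<open>\<Phi> 0\<close> are both
      1.\<close>
    define q' where "q' = max 1 q"
    have q': "q' > 0" "real q' \<le> real q + 1" by (auto simp: q'_def)
    define R where "R = phi \<rho>\<^sub>1' (real q')"
    have R: "R > 0" unfolding R_def using q' by (intro phi_pos) simp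
    have RP: "R ^ q = \<Phi> q" by (auto simp: Phi_def R_def q'_def max_def)
    note N = A_norm_bound(2)[OF f]
    have "norm (taylor_coeff f m) \<le> (?c / R) ^ multi_abs m * (A_norm \<rho>\<^sub>1 \<sigma> f * exp (\<sigma> * (real q' + B)))"
    proof (rule taylor_coeff_bound[OF A_step_monogenic[OF f] R])
      fix y :: "'n paravector" assume y: "norm y \<le> R"
      have "norm (f y) \<le> A_norm \<rho>\<^sub>1 \<sigma> f * exp (\<sigma> * G1 (norm y))" by (rule A_norm_bound[OF f])
      also have "\<dots> \<le> A_norm \<rho>\<^sub>1 \<sigma> f * exp (\<sigma> * (real q' + B))"
        using B(2)[OF q'(1) norm_ge_zero] y \<sigma> N unfolding R_def by (intro mult_left_mono) auto
      finally show "norm (f y) \<le> A_norm \<rho>\<^sub>1 \<sigma> f * exp (\<sigma> * (real q' + B))" .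
    qed
    also have "\<dots> \<le> (?c / R) ^ multi_abs m * (A_norm \<rho>\<^sub>1 \<sigma> f * exp (\<sigma> * (real q + 1 + B)))"
      using q'(2) \<sigma> N R c by (intro mult_left_mono) auto
    also have "exp (\<sigma> * (real q + 1 + B)) = exp (\<sigma> * (B + 1)) * exp \<sigma> ^ q"
      by (simp add: exp_of_nat_mult[symmetric] exp_add[symmetric] algebra_simps)
    also have "(?c / R) ^ multi_abs m * (A_norm \<rho>\<^sub>1 \<sigma> f * (exp (\<sigma> * (B + 1)) * exp \<sigma> ^ q)) =
        exp (\<sigma> * (B + 1)) * A_norm \<rho>\<^sub>1 \<sigma> f * (?c * exp \<sigma>) ^ multi_abs m / \<Phi> (multi_abs m)"
      unfolding q_def[symmetric] RP[symmetric] by (simp add: power_divide power_mult_distrib mult_ac)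
    finally show ?thesis .
  qed
  then show ?thesis using c by (intro that[of "?c * exp \<sigma>" "exp (\<sigma> * (B + 1))"]) auto
qed

text \<open>\<open>power_le_Phi\<close> with its factor enlarged by \<open>2 * CARD('n)\<close>; the
  surplus is exactly \<open>multi_weight\<close>.\<close>

lemma coeff_weight_bound:
  assumes s: "s > 0"
  obtains \<sigma>' C where "\<sigma>' > 0" "C > 0"
    "\<And>l r. r \<ge> 0 \<Longrightarrow> s ^ multi_abs l / \<Phi> (multi_abs l) * (fueter_const TYPE('n::{finite,linorder}) * r) ^ multi_abs (l :: 'n multi)
       \<le> C * exp (\<sigma>' * G1 r) * multi_weight l"
proof -
  let ?F = "fueter_const TYPE('n)"
  have "2 * CARD('n) * s * ?F > 0" using s fueter_const_pos[where 'n = 'n] by simp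
  then obtain \<sigma>' C where C: "\<sigma>' > 0" "C > 0"
    "\<And>q r. r \<ge> 0 \<Longrightarrow> ((2 * CARD('n) * s * ?F) * r) ^ q \<le> C * \<Phi> q * exp (\<sigma>' * G1 r)"
    using power_le_Phi by metis
  have "s ^ multi_abs l / \<Phi> (multi_abs l) * (?F * r) ^ multi_abs l \<le> C * exp (\<sigma>' * G1 r) * multi_weight l"
    if r: "r \<ge> 0" for l :: "'n multi" and r
  proof -
    let ?q = "multi_abs l"
    have "s ^ ?q / \<Phi> ?q * (?F * r) ^ ?q = ((2 * CARD('n) * s * ?F) * r) ^ ?q / \<Phi> ?q * multi_weight l"
      by (simp add: multi_weight_def power_mult_distrib power_divide)
    also have "\<dots> \<le> (C * \<Phi> ?q * exp (\<sigma>' * G1 r)) / \<Phi> ?q * multi_weight l"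
      using Phi_pos[of ?q] by (intro mult_right_mono divide_right_mono C(3) r multi_weight_nonneg) auto
    also have "\<dots> = C * exp (\<sigma>' * G1 r) * multi_weight l" using Phi_pos[of ?q] by simp
    finally show ?thesis .
  qed
  then show ?thesis using C that by blast
qed

text \<open>The coefficient of the derivative at l is that of f at l + m times (l + m)! / l!. The
  binomial bound extracts m! and powers of 2, \<open>Phi_mult_le\<close> separates the gauge, and
  the part depending on l is summed by \<open>coeff_weight_bound\<close>.\<close>

lemma majorant_deriv_bound:
  assumes \<sigma>: "\<sigma> > 0"
  obtains s \<sigma>' C where "s > 0" "\<sigma>' > 0" "C > 0"
    "\<And>f m r. f \<in> A_step \<rho>\<^sub>1 \<sigma> \<Longrightarrow> r \<ge> 0 \<Longrightarrow>
      majorant (multi_deriv m (f :: 'n::{finite,linorder} cfun)) r \<le>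
        C * A_norm \<rho>\<^sub>1 \<sigma> f * (multi_fact m * s ^ multi_abs m / \<Phi> (multi_abs m)) * exp (\<sigma>' * G1 r)"
proof -
  let ?F = "fueter_const TYPE('n)"
  obtain s C where sC: "s > 0" "C > 0"
    "\<And>f m. f \<in> A_step \<rho>\<^sub>1 \<sigma> \<Longrightarrow>
      norm (taylor_coeff (f :: 'n cfun) m) \<le> C * A_norm \<rho>\<^sub>1 \<sigma> f * s ^ multi_abs m / \<Phi> (multi_abs m)"
    using coeff_bound[OF \<sigma>] by metis
  have "2 * s > 0" using sC by simp
  then obtain \<sigma>' C' where C': "\<sigma>' > 0" "C' > 0"
    "\<And>l r. r \<ge> 0 \<Longrightarrow> (2 * s) ^ multi_abs l / \<Phi> (multi_abs l) * (?F * r) ^ multi_abs (l :: 'n multi)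
       \<le> C' * exp (\<sigma>' * G1 r) * multi_weight l"
    using coeff_weight_bound[where 'n = 'n] by metis
  have "majorant (multi_deriv m f) r \<le>
      (2 * C * C') * A_norm \<rho>\<^sub>1 \<sigma> f * (multi_fact m * (2 * s) ^ multi_abs m / \<Phi> (multi_abs m)) * exp (\<sigma>' * G1 r)"
    if f: "f \<in> A_step \<rho>\<^sub>1 \<sigma>" and r: "r \<ge> 0" for f :: "'n cfun" and m r
  proof -
    note N = A_norm_bound(2)[OF f] and mon = A_step_monogenic[OF f]
    let ?N = "A_norm \<rho>\<^sub>1 \<sigma> f" and ?p = "multi_abs m"
    let ?c = "C * ?N * (multi_fact m * (2 * s) ^ ?p / \<Phi> ?p)"
    have c0: "?c \<ge> 0" using sC N multi_fact_pos[of m] Phi_pos[of ?p] by (intro mult_nonneg_nonneg divide_nonneg_nonneg) auto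
    have "norm (taylor_coeff (multi_deriv m f) l) * (?F * r) ^ multi_abs l \<le> (?c * C' * exp (\<sigma>' * G1 r)) * multi_weight l" for l
    proof -
      let ?q = "multi_abs l"
      have "norm (taylor_coeff (multi_deriv m f) l) =
          (multi_fact (mshift l m) / multi_fact l) * norm (taylor_coeff f (mshift l m))"
        unfolding taylor_coeff_multi_deriv[OF mon] norm_scaleR
        using multi_fact_pos[of l] multi_fact_pos[of "mshift l m"] by simp
      also have "\<dots> \<le> (2 ^ multi_abs (mshift l m) * multi_fact m) * (C * ?N * s ^ multi_abs (mshift l m) / \<Phi> (multi_abs (mshift l m)))"
        using multi_fact_mshift_le[of l m] multi_fact_pos[of l] multi_fact_pos[of m]
        by (intro mult_mono sC(3)[OF f]) (auto simp: field_simps)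
      also have "\<dots> = C * ?N * multi_fact m * (2 * s) ^ (?q + ?p) / \<Phi> (?q + ?p)"
        by (simp add: multi_abs_mshift power_mult_distrib)
      also have "\<dots> \<le> C * ?N * multi_fact m * (2 * s) ^ (?q + ?p) / (\<Phi> ?q * \<Phi> ?p)"
        using sC N multi_fact_pos[of m] Phi_pos
        by (intro divide_left_mono Phi_mult_le mult_nonneg_nonneg mult_pos_pos) auto
      also have "\<dots> = ?c * ((2 * s) ^ ?q / \<Phi> ?q)" by (simp add: power_add mult_ac)
      finally have "norm (taylor_coeff (multi_deriv m f) l) * (?F * r) ^ ?q \<le> ?c * ((2 * s) ^ ?q / \<Phi> ?q) * (?F * r) ^ ?q"
        using fueter_const_pos[where 'n = 'n] r by (intro mult_right_mono) auto
      also have "\<dots> = ?c * ((2 * s) ^ ?q / \<Phi> ?q * (?F * r) ^ ?q)" by simp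
      also have "\<dots> \<le> ?c * (C' * exp (\<sigma>' * G1 r) * multi_weight l)"
        by (intro mult_left_mono C'(3) r c0)
      finally show ?thesis by (simp add: mult_ac)
    qed
    then have "majorant (multi_deriv m f) r \<le> 2 * (?c * C' * exp (\<sigma>' * G1 r))"
      unfolding majorant_def using fueter_const_pos[where 'n = 'n] r
      by (intro weighted_summable(2)) auto
    then show ?thesis by (simp add: mult_ac)
  qed
  then show ?thesis using sC C' by (intro that[of "2 * s" \<sigma>' "2 * C * C'"]) auto
qed

text \<open>The factors m! and \<open>\<Phi>\<close> in the bound of the derivative cancel those in
  the bound of \<open>u m\<close>, leaving a purely geometric dependence on the degree.\<close>

lemma operator_term_bound:
  fixes u :: "'n::{finite,linorder} multi \<Rightarrow> 'n cfun"
  assumes u: "u \<in> D_ops \<rho>\<^sub>1' o\<^sub>1 \<rho>\<^sub>2" and \<sigma>: "\<sigma> > 0"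
  obtains \<sigma>' C where "\<sigma>' > 0" "C > 0"
    "\<And>f m x. f \<in> A_step \<rho>\<^sub>1 \<sigma> \<Longrightarrow>
      norm ((u m \<odot>\<^sub>L multi_deriv m f) x) \<le> (C * A_norm \<rho>\<^sub>1 \<sigma> f * exp (\<sigma>' * G2 (norm x))) * multi_weight m"
proof -
  let ?K = "cmul_const TYPE('n)"
  obtain s \<sigma>1 C1 where s: "s > 0" "\<sigma>1 > 0" "C1 > 0"
    "\<And>f m r. f \<in> A_step \<rho>\<^sub>1 \<sigma> \<Longrightarrow> r \<ge> 0 \<Longrightarrow> majorant (multi_deriv m (f :: 'n cfun)) r \<le>
        C1 * A_norm \<rho>\<^sub>1 \<sigma> f * (multi_fact m * s ^ multi_abs m / \<Phi> (multi_abs m)) * exp (\<sigma>1 * G1 r)"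
    using majorant_deriv_bound[OF \<sigma>] by metis
  define E where "E = (exp 1 * o\<^sub>1) powr (1 / o\<^sub>1)"
  have E: "E > 0" using pos by (simp add: E_def)
  \<comment> \<open>The step of f has fixed \<open>s\<close>; the free parameter of
    \<open>D_ops\<close> is now chosen so that the powers of \<open>\<mu> * s / E\<close> are
    exactly \<open>multi_weight\<close>.\<close>
  define \<mu> where "\<mu> = E / (2 * CARD('n) * s)"
  have \<mu>: "\<mu> > 0" using E s by (simp add: \<mu>_def)
  obtain \<sigma>2 C2 where u2: "\<sigma>2 > 0" "C2 > 0" "\<And>m. u m \<in> A_step \<rho>\<^sub>2 \<sigma>2"
    "\<And>m. A_norm \<rho>\<^sub>2 \<sigma>2 (u m) \<le> C2 * (G_coeff \<rho>\<^sub>1' o\<^sub>1 (multi_abs m) / multi_fact m) * \<mu> ^ multi_abs m"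
    using u \<mu> unfolding D_ops_def by blast
  obtain \<sigma>3 C3 where m3: "\<sigma>3 > 0" "C3 > 0"
    "\<And>f r. f \<in> A_step \<rho>\<^sub>2 \<sigma>2 \<Longrightarrow> r \<ge> 0 \<Longrightarrow> majorant (f :: 'n cfun) r \<le> C3 * A_norm \<rho>\<^sub>2 \<sigma>2 f * exp (\<sigma>3 * G2 r)"
    using majorant_growth[OF po2 pos2 u2(1)] by metis
  obtain K B where KB: "K > 0" "B \<ge> 0" "\<And>r. 0 \<le> r \<Longrightarrow> G1 r \<le> K * G2 r + B"
    using growth_bigo[OF po bigo] by metis
  define C where "C = ?K * C3 * C2 * C1 * exp (\<sigma>1 * B)"
  define \<sigma>' where "\<sigma>' = \<sigma>3 + \<sigma>1 * K"
  have "norm ((u m \<odot>\<^sub>L multi_deriv m f) x) \<le> (C * A_norm \<rho>\<^sub>1 \<sigma> f * exp (\<sigma>' * G2 (norm x))) * multi_weight m"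
    if f: "f \<in> A_step \<rho>\<^sub>1 \<sigma>" for f :: "'n cfun" and m x
  proof -
    let ?r = "norm x" and ?q = "multi_abs m" and ?N = "A_norm \<rho>\<^sub>1 \<sigma> f"
    note N = A_norm_bound(2)[OF f] and mon = A_step_monogenic[OF f]
    let ?a = "C3 * (C2 * (\<Phi> ?q / E ^ ?q / multi_fact m) * \<mu> ^ ?q) * exp (\<sigma>3 * G2 ?r)"
    let ?b = "C1 * ?N * (multi_fact m * s ^ ?q / \<Phi> ?q) * exp (\<sigma>1 * (K * G2 ?r + B))"
    have a: "majorant (u m) ?r \<le> ?a"
    proof -
      have "majorant (u m) ?r \<le> C3 * A_norm \<rho>\<^sub>2 \<sigma>2 (u m) * exp (\<sigma>3 * G2 ?r)"
        by (intro m3 u2) simp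
      also have "\<dots> \<le> ?a"
        using u2(4)[of m] m3(2) by (intro mult_right_mono mult_left_mono) (auto simp: G_coeff_eq E_def)
      finally show ?thesis .
    qed
    have b: "majorant (multi_deriv m f) ?r \<le> ?b"
    proof -
      have "majorant (multi_deriv m f) ?r \<le> C1 * ?N * (multi_fact m * s ^ ?q / \<Phi> ?q) * exp (\<sigma>1 * G1 ?r)"
        by (intro s f) simp
      also have "\<dots> \<le> ?b"
        using KB(3)[of ?r] s N multi_fact_pos[of m] Phi_pos[of ?q]
        by (intro mult_left_mono) (auto intro!: mult_nonneg_nonneg divide_nonneg_nonneg)
      finally show ?thesis .
    qed
    have "norm ((u m \<odot>\<^sub>L multi_deriv m f) x) \<le> ?K * majorant (u m) ?r * majorant (multi_deriv m f) ?r"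
      by (intro CK_prod_monogenic_bound monogenic_multi_deriv mon A_step_monogenic[OF u2(3)])
    also have "\<dots> \<le> ?K * ?a * ?b"
      using cmul_const(1)[where 'n = 'n] m3 u2 \<mu> E Phi_pos[of ?q] multi_fact_pos[of m]
      by (intro mult_mono a b mult_left_mono majorant_nonneg mult_nonneg_nonneg) (auto intro!: mult_nonneg_nonneg divide_nonneg_nonneg)
    also have "\<dots> = (C * ?N * exp (\<sigma>' * G2 ?r)) * multi_weight m"
    proof -
      have w: "(1 / E ^ ?q) * \<mu> ^ ?q * s ^ ?q = multi_weight m"
        using E s by (simp add: \<mu>_def multi_weight_def power_divide power_mult_distrib)
      have e: "exp (\<sigma>3 * G2 ?r) * exp (\<sigma>1 * (K * G2 ?r + B)) = exp (\<sigma>1 * B) * exp (\<sigma>' * G2 ?r)"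
        by (simp add: \<sigma>'_def exp_add[symmetric] algebra_simps)
      have "?K * ?a * ?b = (?K * C3 * C2 * C1) * ?N * ((1 / E ^ ?q) * \<mu> ^ ?q * s ^ ?q) *
          (exp (\<sigma>3 * G2 ?r) * exp (\<sigma>1 * (K * G2 ?r + B)))"
        using multi_fact_pos[of m] Phi_pos[of ?q] by simp
      then show ?thesis unfolding w e by (simp add: C_def mult_ac)
    qed
    finally show ?thesis .
  qed
  moreover have "C > 0" unfolding C_def using cmul_const(1)[where 'n = 'n] m3 u2 s by simp
  moreover have "\<sigma>' > 0" unfolding \<sigma>'_def using m3 s KB by (simp add: add_pos_pos)
  ultimately show ?thesis using that by blast
qed

end

section \<open>Continuity for the inductive limit topologies\<close>

lemma A_space_step:
  assumes "f \<in> A_space \<rho>" obtains \<sigma> where "\<sigma> > 0" "f \<in> A_step \<rho> \<sigma>"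
  using assms by (auto simp: A_space_def)

lemma
  assumes F: "right_linear_hom A B F"
  shows hom_maps: "f \<in> A \<Longrightarrow> F f \<in> B"
    and hom_add: "f \<in> A \<Longrightarrow> g \<in> A \<Longrightarrow> F (\<lambda>x. f x + g x) = (\<lambda>x. F f x + F g x)"
    and hom_cmul_right: "f \<in> A \<Longrightarrow> F (\<lambda>x. f x \<cdot>\<^sub>c a) = (\<lambda>x. F f x \<cdot>\<^sub>c a)"
  using F unfolding right_linear_hom_def by simp_all

text \<open>A real scalar acts as right multiplication by \<open>c *\<^sub>R cl_one\<close>, so real
  homogeneity is a case of right linearity.\<close>

lemma hom_scaleR:
  assumes F: "right_linear_hom A B F" and f: "f \<in> A"
  shows "F (\<lambda>x. c *\<^sub>R f x) = (\<lambda>x. c *\<^sub>R F f x)"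
proof -
  have e: "g x \<cdot>\<^sub>c (c *\<^sub>R cl_one) = c *\<^sub>R g x" for g :: "'a cfun" and x
    by (simp add: cmul.scaleR_right cmul_cl_one)
  have "F (\<lambda>x. f x \<cdot>\<^sub>c (c *\<^sub>R cl_one)) = (\<lambda>x. F f x \<cdot>\<^sub>c (c *\<^sub>R cl_one))"
    by (rule hom_cmul_right[OF F f])
  then show ?thesis unfolding e .
qed

lemma hom_lincomb:
  assumes F: "right_linear_hom (A_space \<rho>) B F" and f: "f \<in> A_space \<rho>" and g: "g \<in> A_space \<rho>"
  shows "F (\<lambda>x. s *\<^sub>R f x + t *\<^sub>R g x) = (\<lambda>x. s *\<^sub>R F f x + t *\<^sub>R F g x)"
proof -
  have sf: "(\<lambda>x. s *\<^sub>R f x) \<in> A_space \<rho>" using A_space_lincomb[OF f f, of s 0] by simp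
  have tg: "(\<lambda>x. t *\<^sub>R g x) \<in> A_space \<rho>" using A_space_lincomb[OF g g, of t 0] by simp
  have "F (\<lambda>x. s *\<^sub>R f x + t *\<^sub>R g x) = (\<lambda>x. F (\<lambda>x. s *\<^sub>R f x) x + F (\<lambda>x. t *\<^sub>R g x) x)"
    by (rule hom_add[OF F sf tg])
  then show ?thesis unfolding hom_scaleR[OF F f] hom_scaleR[OF F g] .
qed

text \<open>Each step is mapped boundedly into a single step. For homomorphisms between these spaces
  this is equivalent to continuity, by the two lemmas on continuity below.\<close>

definition graded_bounded ::
  "(real \<Rightarrow> real) \<Rightarrow> (real \<Rightarrow> real) \<Rightarrow> ('n::{finite,linorder} cfun \<Rightarrow> 'n cfun) \<Rightarrow> bool" where
  "graded_bounded \<rho>\<^sub>1 \<rho>\<^sub>2 F \<longleftrightarrow> (\<forall>\<sigma>>0. \<exists>\<sigma>'>0. \<exists>C>0. \<forall>f\<in>A_step \<rho>\<^sub>1 \<sigma>.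
     F f \<in> A_step \<rho>\<^sub>2 \<sigma>' \<and> A_norm \<rho>\<^sub>2 \<sigma>' (F f) \<le> C * A_norm \<rho>\<^sub>1 \<sigma> f)"

lemma graded_boundedE:
  assumes "graded_bounded \<rho>\<^sub>1 \<rho>\<^sub>2 F" "\<sigma> > 0"
  obtains \<sigma>' C where "\<sigma>' > 0" "C > 0" "\<And>f. f \<in> A_step \<rho>\<^sub>1 \<sigma> \<Longrightarrow> F f \<in> A_step \<rho>\<^sub>2 \<sigma>'"
    "\<And>f. f \<in> A_step \<rho>\<^sub>1 \<sigma> \<Longrightarrow> A_norm \<rho>\<^sub>2 \<sigma>' (F f) \<le> C * A_norm \<rho>\<^sub>1 \<sigma> f"
proof -
  obtain \<sigma>' C where "\<sigma>' > 0" "C > 0" "\<forall>f\<in>A_step \<rho>\<^sub>1 \<sigma>.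
     F f \<in> A_step \<rho>\<^sub>2 \<sigma>' \<and> A_norm \<rho>\<^sub>2 \<sigma>' (F f) \<le> C * A_norm \<rho>\<^sub>1 \<sigma> f"
    using assms unfolding graded_bounded_def by blast
  then show ?thesis by (intro that[of \<sigma>' C]) auto
qed

text \<open>The preimage of a basic neighbourhood of 0 is again one: absolute convexity is kept by
  linearity, and the trace condition on a step follows from the bound into the corresponding target
  step.\<close>

lemma graded_bounded_continuous:
  assumes F: "right_linear_hom (A_space \<rho>\<^sub>1) (A_space \<rho>\<^sub>2) F" and bd: "graded_bounded \<rho>\<^sub>1 \<rho>\<^sub>2 F"
  shows "continuous_map (A_top \<rho>\<^sub>1) (A_top \<rho>\<^sub>2) F"
proof -
  have maps: "F f \<in> A_space \<rho>\<^sub>2" if "f \<in> A_space \<rho>\<^sub>1" for f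
    by (rule hom_maps[OF F that])
  have nb: "A_nbhd \<rho>\<^sub>1 {g \<in> A_space \<rho>\<^sub>1. F g \<in> W}" if W: "A_nbhd \<rho>\<^sub>2 W" for W
    unfolding A_nbhd_def
  proof (intro conjI ballI allI impI)
    fix f g s t assume fg: "f \<in> {g \<in> A_space \<rho>\<^sub>1. F g \<in> W}" "g \<in> {g \<in> A_space \<rho>\<^sub>1. F g \<in> W}" and st: "\<bar>s\<bar> + \<bar>t\<bar> \<le> (1::real)"
    then have m: "f \<in> A_space \<rho>\<^sub>1" "g \<in> A_space \<rho>\<^sub>1" "F f \<in> W" "F g \<in> W" by auto
    have "(\<lambda>x. s *\<^sub>R F f x + t *\<^sub>R F g x) \<in> W"
      using W m(3,4) st unfolding A_nbhd_def by blast
    then show "(\<lambda>x. s *\<^sub>R f x + t *\<^sub>R g x) \<in> {g \<in> A_space \<rho>\<^sub>1. F g \<in> W}"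
      using hom_lincomb[OF F m(1,2)] A_space_lincomb[OF m(1,2)] by simp
  next
    fix \<sigma> :: real assume \<sigma>: "\<sigma> > 0"
    obtain \<sigma>' C where C: "\<sigma>' > 0" "C > 0" "\<And>f. f \<in> A_step \<rho>\<^sub>1 \<sigma> \<Longrightarrow> F f \<in> A_step \<rho>\<^sub>2 \<sigma>'"
        "\<And>f. f \<in> A_step \<rho>\<^sub>1 \<sigma> \<Longrightarrow> A_norm \<rho>\<^sub>2 \<sigma>' (F f) \<le> C * A_norm \<rho>\<^sub>1 \<sigma> f"
      using graded_boundedE[OF bd \<sigma>] by blast
    obtain e where e: "e > 0" "\<And>f. f \<in> A_step \<rho>\<^sub>2 \<sigma>' \<Longrightarrow> A_norm \<rho>\<^sub>2 \<sigma>' f < e \<Longrightarrow> f \<in> W"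
      using W C(1) unfolding A_nbhd_def by blast
    have "f \<in> {g \<in> A_space \<rho>\<^sub>1. F g \<in> W}" if f: "f \<in> A_step \<rho>\<^sub>1 \<sigma>" "A_norm \<rho>\<^sub>1 \<sigma> f < e / C" for f
    proof -
      have "C * A_norm \<rho>\<^sub>1 \<sigma> f < e" using f(2) C(2) by (simp add: field_simps)
      then have "F f \<in> W" using C(4)[OF f(1)] by (intro e(2) C(3) f(1)) auto
      then show ?thesis using A_step_space[OF f(1) \<sigma>] by simp
    qed
    then show "\<exists>\<epsilon>>0. \<forall>f\<in>A_step \<rho>\<^sub>1 \<sigma>. A_norm \<rho>\<^sub>1 \<sigma> f < \<epsilon> \<longrightarrow> f \<in> {g \<in> A_space \<rho>\<^sub>1. F g \<in> W}"
      using e(1) C(2) by (intro exI[of _ "e / C"]) auto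
  qed auto
  have "A_open \<rho>\<^sub>1 {f \<in> A_space \<rho>\<^sub>1. F f \<in> U}" if U: "A_open \<rho>\<^sub>2 U" for U
    unfolding A_open_def
  proof (intro conjI ballI)
    fix f assume f: "f \<in> {f \<in> A_space \<rho>\<^sub>1. F f \<in> U}"
    then obtain W where W: "A_nbhd \<rho>\<^sub>2 W" "\<forall>g\<in>W. (\<lambda>x. F f x + g x) \<in> U"
      using U unfolding A_open_def by blast
    have "(\<lambda>x. f x + g x) \<in> {f \<in> A_space \<rho>\<^sub>1. F f \<in> U}" if "g \<in> {g \<in> A_space \<rho>\<^sub>1. F g \<in> W}" for g
    proof -
      have fg: "f \<in> A_space \<rho>\<^sub>1" "g \<in> A_space \<rho>\<^sub>1" "F g \<in> W" using f that by auto
      then have "F (\<lambda>x. f x + g x) = (\<lambda>x. F f x + F g x)"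
        by (intro hom_add[OF F])
      moreover have "(\<lambda>x. f x + g x) \<in> A_space \<rho>\<^sub>1"
        using A_space_lincomb[OF fg(1,2), of 1 1] by simp
      ultimately show ?thesis using W(2) fg(3) by simp
    qed
    then show "\<exists>W. A_nbhd \<rho>\<^sub>1 W \<and> (\<forall>g\<in>W. (\<lambda>x. f x + g x) \<in> {f \<in> A_space \<rho>\<^sub>1. F f \<in> U})"
      using nb[OF W(1)] by blast
  qed auto
  then show ?thesis
    unfolding continuous_map_def openin_A_top topspace_A_top using maps by auto
qed

text \<open>
  The converse. If a bound failed for the norm of index \<open>\<sigma>\<close>, there would be \<open>f\<^sub>k \<rightarrow> 0\<close> in that norm and points
  \<open>x\<^sub>k\<close> at which \<open>F f\<^sub>k\<close> exceeds \<open>k exp (k growth (norm x\<^sub>k))\<close>; but the functions that stay below these values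
  form a neighbourhood of \<open>0\<close>, because each step imposes only finitely many genuine restrictions.
\<close>

lemma continuous_graded_bounded:
  fixes F :: "'n::{finite,linorder} cfun \<Rightarrow> 'n cfun"
  assumes F: "right_linear_hom (A_space \<rho>\<^sub>1) (A_space \<rho>\<^sub>2) F"
    and cont: "continuous_map (A_top \<rho>\<^sub>1) (A_top \<rho>\<^sub>2) F"
  shows "graded_bounded \<rho>\<^sub>1 \<rho>\<^sub>2 F"
proof (rule ccontr)
  assume "\<not> graded_bounded \<rho>\<^sub>1 \<rho>\<^sub>2 F"
  then obtain \<sigma> where \<sigma>: "\<sigma> > 0" and neg: "\<not> (\<exists>\<sigma>'>0. \<exists>C>0. \<forall>f\<in>A_step \<rho>\<^sub>1 \<sigma>.
     F f \<in> A_step \<rho>\<^sub>2 \<sigma>' \<and> A_norm \<rho>\<^sub>2 \<sigma>' (F f) \<le> C * A_norm \<rho>\<^sub>1 \<sigma> f)"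
    unfolding graded_bounded_def not_all not_imp by (elim exE conjE)
  have no: "\<exists>f\<in>A_step \<rho>\<^sub>1 \<sigma>. \<not> (F f \<in> A_step \<rho>\<^sub>2 \<sigma>' \<and> A_norm \<rho>\<^sub>2 \<sigma>' (F f) \<le> C * A_norm \<rho>\<^sub>1 \<sigma> f)"
    if "\<sigma>' > 0" "C > 0" for \<sigma>' C
  proof (rule ccontr)
    assume "\<not> ?thesis"
    with neg that show False by simp
  qed
  let ?N = "A_norm \<rho>\<^sub>1 \<sigma>"
  define c where "c k x = real (Suc k) * exp (real (Suc k) * growth \<rho>\<^sub>2 (norm x))" for k and x :: "'n paravector"
  have c0: "c k x > 0" for k x by (simp add: c_def)
  have "\<exists>f x. f \<in> A_step \<rho>\<^sub>1 \<sigma> \<and> ?N f \<le> 1 / real (Suc k) \<and> norm (F f x) > c k x" for k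
  proof -
    let ?k = "real (Suc k)"
    \<comment> \<open>The constant is k squared: after scaling f to norm at most 1/k, its image
      still exceeds k exp(k growth) at some point.\<close>
    obtain f where f: "f \<in> A_step \<rho>\<^sub>1 \<sigma>"
      and bad: "\<not> (F f \<in> A_step \<rho>\<^sub>2 ?k \<and> A_norm \<rho>\<^sub>2 ?k (F f) \<le> (?k * ?k) * ?N f)"
      using no[of ?k "?k * ?k"] by auto
    note N0 = A_norm_bound(2)[OF f]
    have fA: "f \<in> A_space \<rho>\<^sub>1" using f \<sigma> by (rule A_step_space)
    then have Ff: "monogenic (F f)"
      by (rule A_space_monogenic[OF hom_maps[OF F]])
    have "\<exists>x. norm (F f x) > (?k * ?k) * ?N f * exp (?k * growth \<rho>\<^sub>2 (norm x))"
    proof (rule ccontr)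
      assume "\<not> ?thesis"
      then have "norm (F f x) \<le> (?k * ?k) * ?N f * exp (?k * growth \<rho>\<^sub>2 (norm x))" for x
        by (meson not_le)
      then have "F f \<in> A_step \<rho>\<^sub>2 ?k" "A_norm \<rho>\<^sub>2 ?k (F f) \<le> (?k * ?k) * ?N f"
        using Ff N0 by (intro A_stepI[of "F f" "(?k * ?k) * ?N f"] mult_nonneg_nonneg; simp)+
      then show False using bad by blast
    qed
    then obtain x where x: "norm (F f x) > (?k * ?k) * ?N f * exp (?k * growth \<rho>\<^sub>2 (norm x))" by blast
    have Npos: "?N f > 0"
    proof (rule ccontr)
      assume "\<not> ?N f > 0"
      then have "?N f = 0" using N0 by simp
      then have "norm (f y) \<le> 0" for y using A_norm_bound(1)[OF f, of y] by simp
      then have "f = (\<lambda>x. 0 *\<^sub>R f x)" by (auto simp: fun_eq_iff)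
      then have "F f = (\<lambda>x. 0 *\<^sub>R F f x)" using hom_scaleR[OF F fA, of 0] by simp
      then have "F f x = 0" by (metis scaleR_zero_left)
      then show False using x \<open>?N f = 0\<close> by simp
    qed
    define t where "t = 1 / (?k * ?N f)"
    have t: "t > 0" using Npos by (simp add: t_def)
    define g where "g = (\<lambda>x. t *\<^sub>R f x)"
    have "norm (g y) \<le> (1 / ?k) * exp (\<sigma> * growth \<rho>\<^sub>1 (norm y))" for y
    proof -
      have "norm (g y) \<le> t * (?N f * exp (\<sigma> * growth \<rho>\<^sub>1 (norm y)))"
        unfolding g_def using A_norm_bound(1)[OF f, of y] t by simp
      also have "\<dots> = (1 / ?k) * exp (\<sigma> * growth \<rho>\<^sub>1 (norm y))" using Npos by (simp add: t_def)
      finally show ?thesis .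
    qed
    then have "g \<in> A_step \<rho>\<^sub>1 \<sigma>" "?N g \<le> 1 / ?k"
      unfolding g_def using monogenic_scaleR[OF A_step_monogenic[OF f], of t]
      by (intro A_stepI[where C = "1 / ?k"]; simp)+
    moreover have "norm (F g x) > c k x"
    proof -
      have "F g x = t *\<^sub>R F f x" using hom_scaleR[OF F fA, of t] by (simp add: g_def)
      then have "norm (F g x) = t * norm (F f x)" using t by simp
      also have "\<dots> > t * ((?k * ?k) * ?N f * exp (?k * growth \<rho>\<^sub>2 (norm x)))"
        using x t by (rule mult_strict_left_mono)
      also have "t * ((?k * ?k) * ?N f * exp (?k * growth \<rho>\<^sub>2 (norm x))) = c k x"
        using Npos by (simp add: t_def c_def)
      finally show ?thesis .
    qed
    ultimately show ?thesis by blast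
  qed
  then obtain f x where fx: "\<And>k. f k \<in> A_step \<rho>\<^sub>1 \<sigma>" "\<And>k. ?N (f k) \<le> 1 / real (Suc k)" "\<And>k. norm (F (f k) (x k)) > c k (x k)"
    by metis
  define W where "W s = {g \<in> A_space \<rho>\<^sub>2. \<forall>k. norm (g (x k)) \<le> s * c k (x k)}" for s :: real
  have Wnb: "A_nbhd \<rho>\<^sub>2 (W s)" if s: "s > 0" for s
    unfolding A_nbhd_def
  proof (intro conjI ballI allI impI)
    fix g h a b assume gh: "g \<in> W s" "h \<in> W s" and ab: "\<bar>a\<bar> + \<bar>b\<bar> \<le> (1::real)"
    have "norm (a *\<^sub>R g (x k) + b *\<^sub>R h (x k)) \<le> s * c k (x k)" for k
    proof -
      have "norm (a *\<^sub>R g (x k) + b *\<^sub>R h (x k)) \<le> \<bar>a\<bar> * norm (g (x k)) + \<bar>b\<bar> * norm (h (x k))"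
        by (rule order_trans[OF norm_triangle_ineq]) simp
      also have "\<dots> \<le> \<bar>a\<bar> * (s * c k (x k)) + \<bar>b\<bar> * (s * c k (x k))"
        using gh by (intro add_mono mult_left_mono) (auto simp: W_def)
      also have "\<dots> = (\<bar>a\<bar> + \<bar>b\<bar>) * (s * c k (x k))" by (simp add: distrib_right)
      also have "\<dots> \<le> 1 * (s * c k (x k))" using ab s c0[of k "x k"] by (intro mult_right_mono) auto
      finally show ?thesis by simp
    qed
    then show "(\<lambda>y. a *\<^sub>R g y + b *\<^sub>R h y) \<in> W s"
      using gh A_space_lincomb[of g \<rho>\<^sub>2 h] by (simp add: W_def)
  next
    fix \<tau> :: real assume \<tau>: "\<tau> > 0"
    \<comment> \<open>From \<open>k0\<close> on the exponent in \<open>c\<close> dominates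
      \<open>\<tau>\<close>, so only the points with smaller index enter the minimum
      \<open>e\<close>.\<close>
    obtain k0 where k0: "\<tau> \<le> real k0" using real_arch_simple by blast
    define e where "e = Min (insert s ((\<lambda>k. s * c k (x k) / exp (\<tau> * growth \<rho>\<^sub>2 (norm (x k)))) ` {..<k0}))"
    have e: "e > 0" "e \<le> s" "\<And>k. k < k0 \<Longrightarrow> e \<le> s * c k (x k) / exp (\<tau> * growth \<rho>\<^sub>2 (norm (x k)))"
      unfolding e_def using s c0 by (auto simp: Min_gr_iff intro!: Min_le)
    have "g \<in> W s" if g: "g \<in> A_step \<rho>\<^sub>2 \<tau>" "A_norm \<rho>\<^sub>2 \<tau> g < e" for g
    proof -
      have "norm (g (x k)) \<le> s * c k (x k)" for k
      proof -
        let ?E = "exp (\<tau> * growth \<rho>\<^sub>2 (norm (x k)))"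
        have "norm (g (x k)) \<le> A_norm \<rho>\<^sub>2 \<tau> g * ?E" by (rule A_norm_bound[OF g(1)])
        also have "\<dots> \<le> e * ?E" using g(2) by (intro mult_right_mono) auto
        also have "\<dots> \<le> s * c k (x k)"
        proof (cases "k < k0")
          case True
          from e(3)[OF this] show ?thesis by (simp add: field_simps)
        next
          case False
          have "?E \<le> exp (real (Suc k) * growth \<rho>\<^sub>2 (norm (x k)))"
            using False k0 growth_nonneg[of \<rho>\<^sub>2 "norm (x k)"] by (auto intro!: mult_right_mono)
          also have "\<dots> = 1 * exp (real (Suc k) * growth \<rho>\<^sub>2 (norm (x k)))" by simp
          also have "\<dots> \<le> c k (x k)" unfolding c_def by (intro mult_right_mono) auto
          finally show ?thesis using e s by (intro mult_mono) auto
        qed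
        finally show ?thesis .
      qed
      then show ?thesis using A_step_space[OF g(1) \<tau>] by (simp add: W_def)
    qed
    then show "\<exists>\<epsilon>>0. \<forall>g\<in>A_step \<rho>\<^sub>2 \<tau>. A_norm \<rho>\<^sub>2 \<tau> g < \<epsilon> \<longrightarrow> g \<in> W s" using e(1) by blast
  qed (auto simp: W_def)
  \<comment> \<open>The slack below 1 makes the union open: adding an element of
    \<open>W ((1 - s) / 2)\<close> takes \<open>W s\<close> into
    \<open>W ((1 + s) / 2)\<close>.\<close>
  define U where "U = (\<Union>s\<in>{0<..<1}. W s)"
  have "A_open \<rho>\<^sub>2 U"
    unfolding A_open_def
  proof (intro conjI ballI)
    fix g assume "g \<in> U"
    then obtain s where s: "0 < s" "s < 1" "g \<in> W s" by (auto simp: U_def)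
    have "(\<lambda>y. g y + h y) \<in> U" if h: "h \<in> W ((1 - s) / 2)" for h
    proof -
      have "norm (g (x k) + h (x k)) \<le> ((1 + s) / 2) * c k (x k)" for k
      proof -
        have "norm (g (x k) + h (x k)) \<le> s * c k (x k) + ((1 - s) / 2) * c k (x k)"
          using s(3) h by (intro order_trans[OF norm_triangle_ineq] add_mono) (auto simp: W_def)
        then show ?thesis by (simp add: field_simps)
      qed
      then have "(\<lambda>y. g y + h y) \<in> W ((1 + s) / 2)"
        using s(3) h A_space_lincomb[of g \<rho>\<^sub>2 h 1 1] by (simp add: W_def)
      then show ?thesis using s by (auto simp: U_def intro!: bexI[of _ "(1 + s) / 2"])
    qed
    then show "\<exists>V. A_nbhd \<rho>\<^sub>2 V \<and> (\<forall>h\<in>V. (\<lambda>y. g y + h y) \<in> U)"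
      using s by (intro exI[of _ "W ((1 - s) / 2)"]) (auto intro!: Wnb)
  qed (auto simp: U_def W_def)
  then have "A_open \<rho>\<^sub>1 {f \<in> A_space \<rho>\<^sub>1. F f \<in> U}"
    using cont unfolding continuous_map_def openin_A_top topspace_A_top by blast
  \<comment> \<open>The zero function, written as a multiple of a known element so that
    \<open>hom_scaleR\<close> gives its image.\<close>
  moreover have "(\<lambda>y. 0 *\<^sub>R f 0 y) \<in> {f \<in> A_space \<rho>\<^sub>1. F f \<in> U}"
  proof -
    have f0: "f 0 \<in> A_space \<rho>\<^sub>1" using fx(1) \<sigma> by (rule A_step_space)
    then have Ff0: "F (f 0) \<in> A_space \<rho>\<^sub>2" by (rule hom_maps[OF F])
    have "(\<lambda>y. 0 *\<^sub>R F (f 0) y) \<in> W (1/2)"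
      using A_space_lincomb[OF Ff0 Ff0, of 0 0] c0 by (auto simp: W_def less_imp_le)
    then have "F (\<lambda>y. 0 *\<^sub>R f 0 y) \<in> U"
      unfolding hom_scaleR[OF F f0] by (auto simp: U_def intro!: bexI[of _ "1/2"])
    then show ?thesis using A_space_lincomb[OF f0 f0, of 0 0] by simp
  qed
  ultimately obtain V where V: "A_nbhd \<rho>\<^sub>1 V" "\<forall>g\<in>V. (\<lambda>y. 0 *\<^sub>R f 0 y + g y) \<in> {f \<in> A_space \<rho>\<^sub>1. F f \<in> U}"
    unfolding A_open_def by blast
  obtain e where e: "e > 0" "\<forall>f\<in>A_step \<rho>\<^sub>1 \<sigma>. ?N f < e \<longrightarrow> f \<in> V"
    using V(1) \<sigma> unfolding A_nbhd_def by blast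
  obtain k where k: "1 / real (Suc k) < e" using nat_approx_posE[OF e(1)] by auto
  have "f k \<in> V" using e(2) fx(1,2)[of k] k by (meson le_less_trans)
  then have "(\<lambda>y. 0 *\<^sub>R f 0 y + f k y) \<in> {f \<in> A_space \<rho>\<^sub>1. F f \<in> U}" using V(2) by blast
  then have "F (f k) \<in> U" by simp
  then obtain s where s: "0 < s" "s < 1" "F (f k) \<in> W s" by (auto simp: U_def)
  have "norm (F (f k) (x k)) \<le> s * c k (x k)" using s(3) by (simp add: W_def)
  also have "\<dots> \<le> 1 * c k (x k)" using s(2) c0[of k "x k"] by (intro mult_right_mono) auto
  finally show False using fx(3)[of k] by simp
qed

section \<open>The action of an operator\<close>

lemma finite_le_multi [simp]: "finite {l :: 'n::finite multi. l \<le> m}"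
proof -
  have "{l. l \<le> m} = PiE UNIV (\<lambda>i. {..m i})" by (auto simp: le_fun_def PiE_def)
  then show ?thesis by (simp add: finite_PiE)
qed

text \<open>The one-variable binomial theorem divided by n!, multiplied over the coordinates; the
  multi-indices below m form a product of ranges.\<close>

lemma mpow_binomial:
  "(\<Sum>l | l \<le> m. mpow a l / multi_fact l * (mpow b (\<lambda>i. m i - l i) / multi_fact (\<lambda>i. m i - l i))) =
    mpow (a + b) m / multi_fact m"
proof -
  have bin: "(\<Sum>k\<le>n. s ^ k / fact k * (t ^ (n - k) / fact (n - k))) = (s + t) ^ n / fact n" for s t :: real and n
  proof -
    have "(s + t) ^ n / fact n = (\<Sum>k\<le>n. real (n choose k) * s ^ k * t ^ (n - k) / fact n)"
      by (simp add: binomial_ring sum_divide_distrib)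
    also have "\<dots> = (\<Sum>k\<le>n. s ^ k / fact k * (t ^ (n - k) / fact (n - k)))"
      by (intro sum.cong refl) (simp add: binomial_fact)
    finally show ?thesis ..
  qed
  have "mpow (a + b) m / multi_fact m =
      (\<Prod>i\<in>UNIV. \<Sum>k\<in>{..m i}. (a $ i) ^ k / fact k * ((b $ i) ^ (m i - k) / fact (m i - k)))"
    unfolding bin by (simp add: mpow_def multi_fact_def prod_dividef)
  also have "\<dots> = (\<Sum>l\<in>PiE UNIV (\<lambda>i. {..m i}). \<Prod>i\<in>UNIV. (a $ i) ^ l i / fact (l i) * ((b $ i) ^ (m i - l i) / fact (m i - l i)))"
    by (rule prod_sum_PiE) auto
  also have "PiE UNIV (\<lambda>i. {..m i}) = {l. l \<le> m}" by (auto simp: le_fun_def PiE_def)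
  finally show ?thesis
    by (simp add: mpow_def multi_fact_def prod_dividef prod.distrib)
qed

lemma fueter_as_cmul: "(\<lambda>x. fueter m x \<cdot>\<^sub>c cl_one) = fueter m"
  by (simp add: cmul_cl_one)

lemma monogenic_fueter': "monogenic (fueter m)"
  using monogenic_fueter[of m cl_one] by (simp add: fueter_as_cmul)

lemma majorant_fueter':
  "majorant (fueter m) r = (fueter_const TYPE('n) * r) ^ multi_abs (m :: 'n::{finite,linorder} multi)"
  using majorant_fueter[of m cl_one r] by (simp add: fueter_as_cmul)

lemma multi_deriv_fueter':
  "multi_deriv l (fueter m) =
    (\<lambda>x. if l \<le> m then (multi_fact m / multi_fact (\<lambda>i. m i - l i)) *\<^sub>R fueter (\<lambda>i. m i - l i) x else 0)"
  using multi_deriv_fueter[of l m cl_one] by (simp add: fueter_as_cmul cmul_cl_one cong: if_cong)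

context operator_setting
begin

lemma D_opsD:
  assumes "u \<in> D_ops \<rho>\<^sub>1' o\<^sub>1 \<rho>\<^sub>2" shows "u m \<in> A_space \<rho>\<^sub>2" "monogenic (u m)"
  using assms A_space_monogenic unfolding D_ops_def by blast+

lemma operator_term_monogenic:
  assumes "u \<in> D_ops \<rho>\<^sub>1' o\<^sub>1 \<rho>\<^sub>2" "monogenic f"
  shows "monogenic (u m \<odot>\<^sub>L multi_deriv m f)"
  by (intro CK_prod_monogenic_bound(1) D_opsD(2)[OF assms(1)] monogenic_multi_deriv assms(2))

text \<open>Summability, the norm bound and the tail estimate are kept in one statement because they
  share \<open>\<sigma>'\<close> and \<open>C\<close>, both independent of f within its
  step.\<close>

lemma op_apply_bound:
  fixes u :: "'n::{finite,linorder} multi \<Rightarrow> 'n cfun"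
  assumes u: "u \<in> D_ops \<rho>\<^sub>1' o\<^sub>1 \<rho>\<^sub>2" and \<sigma>: "\<sigma> > 0"
  shows "\<exists>\<sigma>'>0. \<exists>C>0. \<forall>f\<in>A_step \<rho>\<^sub>1 \<sigma>.
    (\<forall>x. (\<lambda>m. (u m \<odot>\<^sub>L multi_deriv m f) x) summable_on UNIV) \<and>
    op_apply u f \<in> A_step \<rho>\<^sub>2 \<sigma>' \<and> A_norm \<rho>\<^sub>2 \<sigma>' (op_apply u f) \<le> C * A_norm \<rho>\<^sub>1 \<sigma> f \<and>
    (\<forall>M x. finite M \<longrightarrow> norm ((\<Sum>m\<in>M. (u m \<odot>\<^sub>L multi_deriv m f) x) - op_apply u f x) \<le>
       C * A_norm \<rho>\<^sub>1 \<sigma> f * weight_tail M * exp (\<sigma>' * G2 (norm x)))"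
proof -
  obtain \<sigma>' C where C: "\<sigma>' > 0" "C > 0" "\<And>f m x. f \<in> A_step \<rho>\<^sub>1 \<sigma> \<Longrightarrow>
      norm ((u m \<odot>\<^sub>L multi_deriv m f) x) \<le> (C * A_norm \<rho>\<^sub>1 \<sigma> f * exp (\<sigma>' * G2 (norm x))) * multi_weight m"
    using operator_term_bound[OF u \<sigma>] by metis
  have mon: "monogenic (op_apply u f)" if f: "f \<in> A_step \<rho>\<^sub>1 \<sigma>" for f
  proof -
    \<comment> \<open>Growth is bounded on each ball, which makes the termwise estimate locally
      uniform, as \<open>monogenic_infsum\<close> requires.\<close>
    have "\<exists>B. \<forall>s. 0 \<le> s \<longrightarrow> s \<le> R \<longrightarrow> G2 s \<le> B" for R
      using growth_bounded[OF po2, of R] by metis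
    then obtain B where B: "\<And>R s. 0 \<le> s \<Longrightarrow> s \<le> R \<Longrightarrow> G2 s \<le> B R" by metis
    define w where "w R m = (C * A_norm \<rho>\<^sub>1 \<sigma> f * exp (\<sigma>' * B R)) * multi_weight m" for R :: real and m :: "'n multi"
    have "monogenic (\<lambda>x. \<Sum>\<^sub>\<infinity>m. (u m \<odot>\<^sub>L multi_deriv m f) x)"
    proof (rule monogenic_infsum[where w = w])
      show "monogenic (u m \<odot>\<^sub>L multi_deriv m f)" for m
        by (rule operator_term_monogenic[OF u A_step_monogenic[OF f]])
      show "w R summable_on UNIV" for R
        unfolding w_def by (rule summable_on_cmult_right[OF summable_multi_weight])
      show "norm ((u m \<odot>\<^sub>L multi_deriv m f) x) \<le> w R m" if "norm x \<le> R" for R m x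
      proof -
        have "norm ((u m \<odot>\<^sub>L multi_deriv m f) x) \<le> (C * A_norm \<rho>\<^sub>1 \<sigma> f * exp (\<sigma>' * G2 (norm x))) * multi_weight m"
          by (rule C(3)[OF f])
        also have "\<dots> \<le> w R m"
          unfolding w_def using B[OF norm_ge_zero that] C A_norm_bound(2)[OF f]
          by (intro mult_right_mono mult_left_mono multi_weight_nonneg) auto
        finally show ?thesis .
      qed
    qed
    then show ?thesis by (simp add: op_apply_def[abs_def])
  qed
  have st: "op_apply u f \<in> A_step \<rho>\<^sub>2 \<sigma>'" "A_norm \<rho>\<^sub>2 \<sigma>' (op_apply u f) \<le> (2 * C) * A_norm \<rho>\<^sub>1 \<sigma> f"
    if f: "f \<in> A_step \<rho>\<^sub>1 \<sigma>" for f
  proof -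
    have 1: "norm (op_apply u f x) \<le> ((2 * C) * A_norm \<rho>\<^sub>1 \<sigma> f) * exp (\<sigma>' * G2 (norm x))" for x
      using weight_dominated(2)[OF C(3)[OF f, of _ x]] by (simp add: op_apply_def)
    have 2: "(2 * C) * A_norm \<rho>\<^sub>1 \<sigma> f \<ge> 0" using C A_norm_bound(2)[OF f] by simp
    show "op_apply u f \<in> A_step \<rho>\<^sub>2 \<sigma>'" "A_norm \<rho>\<^sub>2 \<sigma>' (op_apply u f) \<le> (2 * C) * A_norm \<rho>\<^sub>1 \<sigma> f"
      by (rule A_stepI[OF mon[OF f] 2 1])+
  qed
  have tl: "norm ((\<Sum>m\<in>M. (u m \<odot>\<^sub>L multi_deriv m f) x) - op_apply u f x) \<le>
         2 * C * A_norm \<rho>\<^sub>1 \<sigma> f * weight_tail M * exp (\<sigma>' * G2 (norm x))"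
    if f: "f \<in> A_step \<rho>\<^sub>1 \<sigma>" and M: "finite M" for f M x
  proof -
    let ?z = "C * A_norm \<rho>\<^sub>1 \<sigma> f * exp (\<sigma>' * G2 (norm x)) * weight_tail M"
    have z: "norm ((\<Sum>m\<in>M. (u m \<odot>\<^sub>L multi_deriv m f) x) - op_apply u f x) \<le> ?z"
      using weight_dominated(3)[OF C(3)[OF f, of _ x] M] by (simp add: op_apply_def)
    then have "?z \<ge> 0" by (rule order_trans[OF norm_ge_zero])
    moreover have "2 * C * A_norm \<rho>\<^sub>1 \<sigma> f * weight_tail M * exp (\<sigma>' * G2 (norm x)) = 2 * ?z"
      by simp
    ultimately show ?thesis using z by linarith
  qed
  have "2 * C > 0" using C(2) by simp
  then show ?thesis
    using C(1) weight_dominated(1)[OF C(3)] st tl by blast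
qed

lemma op_apply_graded_bounded:
  assumes "u \<in> D_ops \<rho>\<^sub>1' o\<^sub>1 \<rho>\<^sub>2" shows "graded_bounded \<rho>\<^sub>1 \<rho>\<^sub>2 (op_apply u)"
  unfolding graded_bounded_def using op_apply_bound[OF assms] by meson

lemma op_apply_summable:
  fixes u :: "'n::{finite,linorder} multi \<Rightarrow> 'n cfun"
  assumes "u \<in> D_ops \<rho>\<^sub>1' o\<^sub>1 \<rho>\<^sub>2" "f \<in> A_space \<rho>\<^sub>1"
  shows "(\<lambda>m. (u m \<odot>\<^sub>L multi_deriv m f) x) summable_on UNIV" and "op_apply u f \<in> A_space \<rho>\<^sub>2"
proof -
  obtain \<sigma> where \<sigma>: "\<sigma> > 0" "f \<in> A_step \<rho>\<^sub>1 \<sigma>" using A_space_step[OF assms(2)] by blast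
  show "(\<lambda>m. (u m \<odot>\<^sub>L multi_deriv m f) x) summable_on UNIV"
    using op_apply_bound[OF assms(1) \<sigma>(1)] \<sigma>(2) by blast
  show "op_apply u f \<in> A_space \<rho>\<^sub>2"
    using op_apply_bound[OF assms(1) \<sigma>(1)] \<sigma>(2) A_step_space by blast
qed

text \<open>All errors lie in one step, with norm at most a multiple of \<open>weight_tail\<close>,
  and every basic neighbourhood contains a small ball of that step.\<close>

lemma op_apply_limitin:
  fixes u :: "'n::{finite,linorder} multi \<Rightarrow> 'n cfun"
  assumes u: "u \<in> D_ops \<rho>\<^sub>1' o\<^sub>1 \<rho>\<^sub>2" and f: "f \<in> A_space \<rho>\<^sub>1"
  shows "limitin (A_top \<rho>\<^sub>2) (\<lambda>M x. \<Sum>m\<in>M. (u m \<odot>\<^sub>L multi_deriv m f) x) (op_apply u f)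
                 (finite_subsets_at_top UNIV)"
  unfolding limitin_def topspace_A_top openin_A_top
proof (intro conjI allI impI)
  let ?S = "\<lambda>M x. \<Sum>m\<in>M. (u m \<odot>\<^sub>L multi_deriv m f) x"
  show opA: "op_apply u f \<in> A_space \<rho>\<^sub>2" by (rule op_apply_summable[OF u f])
  fix U assume "A_open \<rho>\<^sub>2 U \<and> op_apply u f \<in> U"
  then obtain W where W: "A_nbhd \<rho>\<^sub>2 W" "\<forall>g\<in>W. (\<lambda>x. op_apply u f x + g x) \<in> U"
    unfolding A_open_def by blast
  obtain \<sigma> where \<sigma>: "\<sigma> > 0" "f \<in> A_step \<rho>\<^sub>1 \<sigma>" using A_space_step[OF f] by blast
  obtain \<sigma>' C where C: "\<sigma>' > 0" "C > 0"
    "\<And>M x. finite M \<Longrightarrow> norm (?S M x - op_apply u f x) \<le> C * A_norm \<rho>\<^sub>1 \<sigma> f * weight_tail M * exp (\<sigma>' * G2 (norm x))"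
    using op_apply_bound[OF u \<sigma>(1)] \<sigma>(2) by blast
  obtain e where e: "e > 0" "\<And>g. g \<in> A_step \<rho>\<^sub>2 \<sigma>' \<Longrightarrow> A_norm \<rho>\<^sub>2 \<sigma>' g < e \<Longrightarrow> g \<in> W"
    using W(1) C(1) unfolding A_nbhd_def by blast
  let ?c = "C * A_norm \<rho>\<^sub>1 \<sigma> f"
  have "((\<lambda>M. ?c * weight_tail M) \<longlongrightarrow> ?c * 0) (finite_subsets_at_top (UNIV :: 'n multi set))"
    by (intro tendsto_mult_left weight_tail_tendsto)
  then have "\<forall>\<^sub>F M in finite_subsets_at_top (UNIV :: 'n multi set). ?c * weight_tail M < e"
    using e(1) by (intro order_tendstoD(2)[of _ "?c * 0"]) auto
  moreover have "\<forall>\<^sub>F M in finite_subsets_at_top (UNIV :: 'n multi set). finite M"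
    by (rule eventually_finite_subsets_at_top_weakI) auto
  ultimately show "\<forall>\<^sub>F M in finite_subsets_at_top UNIV. ?S M \<in> U"
  proof eventually_elim
    case (elim M)
    let ?g = "\<lambda>x. ?S M x - op_apply u f x"
    have mg: "monogenic ?g"
      using monogenic_lincomb[of "?S M" "op_apply u f" 1 "-1"]
        monogenic_sum[of M "\<lambda>m. u m \<odot>\<^sub>L multi_deriv m f"]
        operator_term_monogenic[OF u A_space_monogenic[OF f]] A_space_monogenic[OF opA] by simp
    have c0: "0 \<le> ?c * weight_tail M"
      using order_trans[OF norm_ge_zero C(3)[OF elim(2), of 0]] exp_gt_zero by (simp add: zero_le_mult_iff not_le[symmetric])
    have "?g \<in> A_step \<rho>\<^sub>2 \<sigma>'" "A_norm \<rho>\<^sub>2 \<sigma>' ?g \<le> ?c * weight_tail M"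
      by (rule A_stepI[OF mg c0 C(3)[OF elim(2)]])+
    then have "?g \<in> W" using elim(1) by (intro e(2)) auto
    from bspec[OF W(2) this] show "?S M \<in> U" by simp
  qed
qed

lemma op_apply_hyperplane:
  fixes u :: "'n::{finite,linorder} multi \<Rightarrow> 'n cfun"
  assumes u: "u \<in> D_ops \<rho>\<^sub>1' o\<^sub>1 \<rho>\<^sub>2" and f: "f \<in> A_space \<rho>\<^sub>1"
  shows "((\<lambda>m. u m (0, y) \<cdot>\<^sub>c multi_deriv m f (0, y)) has_sum op_apply u f (0, y)) UNIV"
proof -
  have "((\<lambda>m. (u m \<odot>\<^sub>L multi_deriv m f) (0, y)) has_sum op_apply u f (0, y)) UNIV"
    unfolding op_apply_def by (rule has_sum_infsum[OF op_apply_summable(1)[OF u f]])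
  then show ?thesis
    by (simp add: CK_prod_hyperplane D_opsD(2)[OF u] monogenic_multi_deriv[OF A_space_monogenic[OF f]])
qed

text \<open>On the hyperplane the coefficients act by left multiplication, which by associativity
  commutes with right multiplication by \<open>a\<close>.\<close>

lemma op_apply_hom:
  fixes u :: "'n::{finite,linorder} multi \<Rightarrow> 'n cfun"
  assumes u: "u \<in> D_ops \<rho>\<^sub>1' o\<^sub>1 \<rho>\<^sub>2"
  shows "right_linear_hom (A_space \<rho>\<^sub>1) (A_space \<rho>\<^sub>2) (op_apply u)"
  unfolding right_linear_hom_def
proof (intro conjI ballI allI)
  fix f :: "'n cfun" assume f: "f \<in> A_space \<rho>\<^sub>1"
  show "op_apply u f \<in> A_space \<rho>\<^sub>2" by (rule op_apply_summable[OF u f])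
  note mf = A_space_monogenic[OF f]
  note mop = A_space_monogenic[OF op_apply_summable(2)[OF u]]
  {
    fix g :: "'n cfun" assume g: "g \<in> A_space \<rho>\<^sub>1"
    have fg: "(\<lambda>x. f x + g x) \<in> A_space \<rho>\<^sub>1" using A_space_lincomb[OF f g, of 1 1] by simp
    show "op_apply u (\<lambda>x. f x + g x) = (\<lambda>x. op_apply u f x + op_apply u g x)"
    proof (rule monogenic_eqI[OF mop[OF fg] monogenic_add[OF mop[OF f] mop[OF g]]])
      fix y
      have "multi_deriv m (\<lambda>x. f x + g x) = (\<lambda>x. multi_deriv m f x + multi_deriv m g x)" for m
        using multi_deriv_lincomb[OF mf A_space_monogenic[OF g], of m 1 1] by simp
      then have "((\<lambda>m. u m (0, y) \<cdot>\<^sub>c multi_deriv m f (0, y) + u m (0, y) \<cdot>\<^sub>c multi_deriv m g (0, y))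
          has_sum op_apply u (\<lambda>x. f x + g x) (0, y)) UNIV"
        using op_apply_hyperplane[OF u fg, of y] by (simp add: cmul.add_right)
      then show "op_apply u (\<lambda>x. f x + g x) (0, y) = op_apply u f (0, y) + op_apply u g (0, y)"
        using has_sum_add[OF op_apply_hyperplane[OF u f] op_apply_hyperplane[OF u g]]
        by (rule has_sum_unique)
    qed
  next
    fix a :: "'n clifford"
    have fa: "(\<lambda>x. f x \<cdot>\<^sub>c a) \<in> A_space \<rho>\<^sub>1" by (rule A_space_cmul_right[OF f])
    show "op_apply u (\<lambda>x. f x \<cdot>\<^sub>c a) = (\<lambda>x. op_apply u f x \<cdot>\<^sub>c a)"
    proof (rule monogenic_eqI[OF mop[OF fa] monogenic_cmul_right[OF mop[OF f]]])
      fix y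
      have "((\<lambda>m. (u m (0, y) \<cdot>\<^sub>c multi_deriv m f (0, y)) \<cdot>\<^sub>c a)
          has_sum op_apply u (\<lambda>x. f x \<cdot>\<^sub>c a) (0, y)) UNIV"
        using op_apply_hyperplane[OF u fa, of y] by (simp add: multi_deriv_cmul_right[OF mf] cmul_assoc)
      then show "op_apply u (\<lambda>x. f x \<cdot>\<^sub>c a) (0, y) = op_apply u f (0, y) \<cdot>\<^sub>c a"
        using has_sum_bounded_linear[OF cmul.bounded_linear_left op_apply_hyperplane[OF u f]]
        by (rule has_sum_unique)
    qed
  }
qed

end

section \<open>The operator of a homomorphism\<close>

lemma mpow_uminus: "mpow (- y) m = (- 1) ^ multi_abs m * mpow y m"
proof -
  have "mpow (- y) m = (\<Prod>i\<in>UNIV. (- 1) ^ m i * (y $ i) ^ m i)"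
    unfolding mpow_def by (rule prod.cong) (simp_all flip: power_mult_distrib)
  then show ?thesis by (simp add: prod.distrib mpow_def multi_abs_def power_sum)
qed

lemma mpow_0: "mpow 0 m = (if m = (\<lambda>_. 0) then 1 else 0)"
proof (cases "m = (\<lambda>_. 0)")
  case False
  then obtain i where "m i > 0" by auto
  then have "mpow 0 m = 0" by (auto simp: mpow_def intro!: bexI[of _ i])
  then show ?thesis using False by simp
qed (simp add: mpow_def)

lemma sum_inverse_multi_fact:
  "(\<Sum>l | l \<le> m. 1 / (multi_fact l * multi_fact (\<lambda>i. m i - l i))) = 2 ^ multi_abs m / multi_fact m"
proof -
  have one: "mpow (\<chi> i. 1) k = 1" for k :: "'a multi" by (simp add: mpow_def)
  have "mpow ((\<chi> i. 1) + (\<chi> i. 1)) m = 2 ^ multi_abs m"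
    by (simp add: mpow_def multi_abs_def power_sum)
  then show ?thesis using mpow_binomial[where m = m and a = "\<chi> i. 1" and b = "\<chi> i. 1"] by (simp add: one)
qed

text \<open>Nonemptiness supplies the zero function, needed for the empty sum, as 0 times any
  member.\<close>

lemma A_space_sum:
  fixes g :: "'i \<Rightarrow> 'n::{finite,linorder} cfun"
  assumes "A_space \<rho> \<noteq> ({} :: 'n cfun set)" "\<And>i. i \<in> M \<Longrightarrow> g i \<in> A_space \<rho>"
  shows "(\<lambda>x. \<Sum>i\<in>M. g i x) \<in> A_space \<rho>"
  using assms(2)
proof (induction M rule: infinite_finite_induct)
  case (insert i M)
  then show ?case using A_space_lincomb[of "g i" \<rho> "\<lambda>x. \<Sum>i\<in>M. g i x" 1 1] by simp
next
  case empty
  obtain h :: "'n cfun" where "h \<in> A_space \<rho>" using assms(1) by blast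
  then show ?case using A_space_lincomb[of h \<rho> h 0 0] by simp
next
  case (infinite M)
  obtain h :: "'n cfun" where "h \<in> A_space \<rho>" using assms(1) by blast
  then show ?case using infinite(1) A_space_lincomb[of h \<rho> h 0 0] by simp
qed

lemma hom_sum:
  fixes g :: "'i \<Rightarrow> 'n::{finite,linorder} cfun"
  assumes F: "right_linear_hom (A_space \<rho>) B F" and ne: "A_space \<rho> \<noteq> ({} :: 'n cfun set)"
    and M: "finite M" and g: "\<And>i. i \<in> M \<Longrightarrow> g i \<in> A_space \<rho>"
  shows "F (\<lambda>x. \<Sum>i\<in>M. g i x) = (\<lambda>x. \<Sum>i\<in>M. F (g i) x)"
  using M g
proof (induction M)
  case empty
  obtain h :: "'n cfun" where "h \<in> A_space \<rho>" using ne by blast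
  then show ?case using hom_scaleR[OF F, of h 0] by simp
next
  case (insert i M)
  then show ?case
    using hom_add[OF F, of "g i" "\<lambda>x. \<Sum>i\<in>M. g i x"] A_space_sum[OF ne, of M g] by simp
qed

text \<open>On the hyperplane this is \<open>F\<close> applied to the polynomial (w - y)^m / m! in
  w, with y as a parameter, evaluated at w = y: expanding the power gives the sum. The CK-product
  with V_{m-l} extends the factor y^(m-l) off the hyperplane.\<close>

definition hom_symbol ::
  "('n::{finite,linorder} cfun \<Rightarrow> 'n cfun) \<Rightarrow> 'n multi \<Rightarrow> 'n cfun" where
  "hom_symbol F m x = (\<Sum>l | l \<le> m.
     ((- 1) ^ multi_abs (\<lambda>i. m i - l i) / (multi_fact l * multi_fact (\<lambda>i. m i - l i))) *\<^sub>R
     (F (fueter l) \<odot>\<^sub>L fueter (\<lambda>i. m i - l i)) x)"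

context operator_setting
begin

text \<open>\<open>power_le_Phi\<close> for the factor \<open>fueter_const\<close> divided by
  \<open>\<mu>\<close>: any geometric gain, however small \<open>\<mu>\<close> is, can be bought by
  choosing the step.\<close>

lemma fueter_step:
  assumes \<mu>: "\<mu> > 0"
  obtains \<sigma> C where "\<sigma> > 0" "C > 0"
    "\<And>q r. r \<ge> 0 \<Longrightarrow> (fueter_const TYPE('n::{finite,linorder}) * r) ^ q \<le> C * \<Phi> q * \<mu> ^ q * exp (\<sigma> * G1 r)"
    "\<And>m. fueter (m :: 'n multi) \<in> A_step \<rho>\<^sub>1 \<sigma>"
    "\<And>m. A_norm \<rho>\<^sub>1 \<sigma> (fueter (m :: 'n multi)) \<le> C * \<Phi> (multi_abs m) * \<mu> ^ multi_abs m"
proof -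
  let ?F = "fueter_const TYPE('n)"
  have "?F / \<mu> > 0" using \<mu> fueter_const_pos[where 'n = 'n] by simp
  then obtain \<sigma> C where C: "\<sigma> > 0" "C > 0" "\<And>q r. r \<ge> 0 \<Longrightarrow> ((?F / \<mu>) * r) ^ q \<le> C * \<Phi> q * exp (\<sigma> * G1 r)"
    using power_le_Phi by metis
  have b: "(?F * r) ^ q \<le> C * \<Phi> q * \<mu> ^ q * exp (\<sigma> * G1 r)" if "r \<ge> 0" for q r
  proof -
    have "(?F * r) ^ q = ((?F / \<mu>) * r) ^ q * \<mu> ^ q" using \<mu> by (simp add: power_mult_distrib power_divide)
    also have "\<dots> \<le> (C * \<Phi> q * exp (\<sigma> * G1 r)) * \<mu> ^ q" using \<mu> by (intro mult_right_mono C that) auto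
    finally show ?thesis by (simp add: mult_ac)
  qed
  have n: "norm (fueter m x) \<le> (C * \<Phi> (multi_abs m) * \<mu> ^ multi_abs m) * exp (\<sigma> * G1 (norm x))" for m :: "'n multi" and x
  proof -
    have "norm (fueter m x) \<le> (?F * norm x) ^ multi_abs m"
      using fueter_bound[of m x cl_one] by (simp add: cmul_cl_one)
    then show ?thesis using b[of "norm x" "multi_abs m"] by simp
  qed
  have p: "C * \<Phi> q * \<mu> ^ q \<ge> 0" for q using C \<mu> Phi_pos[of q] by simp
  show ?thesis by (rule that[OF C(1,2) b A_stepI[OF monogenic_fueter' p n]])
qed

lemma fueter_space: "fueter (m :: 'n::{finite,linorder} multi) \<in> A_space \<rho>\<^sub>1"
  using fueter_step[OF zero_less_one, where 'n = 'n] A_step_space by metis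

text \<open>The Taylor partial sums converge to f in the norm of a step whose index may differ from
  that of f. Boundedness of \<open>F\<close> transports this convergence and right linearity pulls
  out the coefficients, so \<open>F\<close> is determined by its values on Fueter
  polynomials.\<close>

lemma hom_taylor_has_sum:
  fixes F :: "'n::{finite,linorder} cfun \<Rightarrow> 'n cfun"
  assumes F: "right_linear_hom (A_space \<rho>\<^sub>1) (A_space \<rho>\<^sub>2) F" and bd: "graded_bounded \<rho>\<^sub>1 \<rho>\<^sub>2 F"
    and f: "f \<in> A_space \<rho>\<^sub>1"
  shows "((\<lambda>m. F (fueter m) x \<cdot>\<^sub>c taylor_coeff f m) has_sum F f x) UNIV"
proof -
  obtain \<sigma> where \<sigma>: "\<sigma> > 0" "f \<in> A_step \<rho>\<^sub>1 \<sigma>" using A_space_step[OF f] by blast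
  let ?N = "A_norm \<rho>\<^sub>1 \<sigma> f" and ?v = "\<lambda>m x. fueter m x \<cdot>\<^sub>c taylor_coeff f m"
  note mf = A_space_monogenic[OF f]
  obtain s C where C: "s > 0" "C > 0"
    "\<And>m. norm (taylor_coeff f m) \<le> C * ?N * s ^ multi_abs m / \<Phi> (multi_abs m)"
    using coeff_bound[OF \<sigma>(1), where 'n = 'n] \<sigma>(2) by metis
  obtain \<sigma>' C' where C': "\<sigma>' > 0" "C' > 0"
    "\<And>l r. r \<ge> 0 \<Longrightarrow> s ^ multi_abs l / \<Phi> (multi_abs l) * (fueter_const TYPE('n) * r) ^ multi_abs (l :: 'n multi)
       \<le> C' * exp (\<sigma>' * G1 r) * multi_weight l"
    using coeff_weight_bound[OF C(1), where 'n = 'n] by metis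
  have N: "?N \<ge> 0" by (rule A_norm_bound(2)[OF \<sigma>(2)])
  have v: "norm (?v m y) \<le> ((C * ?N * C') * exp (\<sigma>' * G1 (norm y))) * multi_weight m" for m y
  proof -
    let ?q = "multi_abs m"
    have "norm (?v m y) \<le> norm (taylor_coeff f m) * (fueter_const TYPE('n) * norm y) ^ ?q"
      by (rule fueter_taylor_bound)
    also have "\<dots> \<le> (C * ?N * s ^ ?q / \<Phi> ?q) * (fueter_const TYPE('n) * norm y) ^ ?q"
      using fueter_const_pos[where 'n = 'n] by (intro mult_right_mono C) auto
    also have "\<dots> = (C * ?N) * (s ^ ?q / \<Phi> ?q * (fueter_const TYPE('n) * norm y) ^ ?q)" by simp
    also have "\<dots> \<le> (C * ?N) * (C' * exp (\<sigma>' * G1 (norm y)) * multi_weight m)"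
      using C N by (intro mult_left_mono C') auto
    finally show ?thesis by (simp add: mult_ac)
  qed
  obtain \<tau> D where D: "\<tau> > 0" "D > 0" "\<And>g. g \<in> A_step \<rho>\<^sub>1 \<sigma>' \<Longrightarrow> F g \<in> A_step \<rho>\<^sub>2 \<tau>"
    "\<And>g. g \<in> A_step \<rho>\<^sub>1 \<sigma>' \<Longrightarrow> A_norm \<rho>\<^sub>2 \<tau> (F g) \<le> D * A_norm \<rho>\<^sub>1 \<sigma>' g"
    using graded_boundedE[OF bd C'(1)] by blast
  let ?c = "C * ?N * C'"
  have main: "norm ((\<Sum>m\<in>M. F (fueter m) x \<cdot>\<^sub>c taylor_coeff f m) - F f x) \<le> (D * ?c * exp (\<tau> * G2 (norm x))) * weight_tail M"
    if M: "finite M" for M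
  proof -
    let ?S = "\<lambda>y. \<Sum>m\<in>M. ?v m y" and ?d = "\<lambda>y. 1 *\<^sub>R (\<Sum>m\<in>M. ?v m y) + (- 1) *\<^sub>R f y"
    have vA: "?v m \<in> A_space \<rho>\<^sub>1" for m by (rule A_space_cmul_right[OF fueter_space])
    have ne: "A_space \<rho>\<^sub>1 \<noteq> ({} :: 'n cfun set)" using f by blast
    have SA: "?S \<in> A_space \<rho>\<^sub>1" by (rule A_space_sum[OF ne vA])
    have md: "monogenic ?d" by (intro monogenic_lincomb A_space_monogenic[OF SA] A_space_monogenic[OF f])
    have db: "norm (?d y) \<le> (?c * weight_tail M) * exp (\<sigma>' * G1 (norm y))" for y
      using weight_dominated(3)[OF v[of _ y] M] infsumI[OF taylor_has_sum[OF mf, of y]] by (simp add: mult_ac)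
    have c0: "?c * weight_tail M \<ge> 0"
      using order_trans[OF norm_ge_zero db[of 0]] by (simp add: zero_le_mult_iff not_le[symmetric])
    note st = A_stepI[OF md c0 db]
    have "F ?d = (\<lambda>y. 1 *\<^sub>R F ?S y + (- 1) *\<^sub>R F f y)" by (rule hom_lincomb[OF F SA f])
    moreover have "F ?S = (\<lambda>y. \<Sum>m\<in>M. F (?v m) y)" by (rule hom_sum[OF F ne M vA])
    moreover have "F (?v m) = (\<lambda>y. F (fueter m) y \<cdot>\<^sub>c taylor_coeff f m)" for m
      by (rule hom_cmul_right[OF F fueter_space])
    ultimately have "norm ((\<Sum>m\<in>M. F (fueter m) x \<cdot>\<^sub>c taylor_coeff f m) - F f x) = norm (F ?d x)" by simp
    also have "\<dots> \<le> A_norm \<rho>\<^sub>2 \<tau> (F ?d) * exp (\<tau> * G2 (norm x))"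
      by (rule A_norm_bound(1)[OF D(3)[OF st(1)]])
    also have "\<dots> \<le> (D * (?c * weight_tail M)) * exp (\<tau> * G2 (norm x))"
      using D(4)[OF st(1)] st(2) D(2) by (intro mult_right_mono order_trans[OF D(4)[OF st(1)]] mult_left_mono) auto
    finally show ?thesis by (simp add: mult_ac)
  qed
  have "((\<lambda>M. (\<Sum>m\<in>M. F (fueter m) x \<cdot>\<^sub>c taylor_coeff f m) - F f x) \<longlongrightarrow> 0) (finite_subsets_at_top UNIV)"
  proof (rule Lim_null_comparison)
    show "\<forall>\<^sub>F M in finite_subsets_at_top UNIV.
        norm ((\<Sum>m\<in>M. F (fueter m) x \<cdot>\<^sub>c taylor_coeff f m) - F f x) \<le> (D * ?c * exp (\<tau> * G2 (norm x))) * weight_tail M"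
      by (rule eventually_finite_subsets_at_top_weakI) (rule main)
    show "((\<lambda>M. (D * ?c * exp (\<tau> * G2 (norm x))) * weight_tail M) \<longlongrightarrow> 0) (finite_subsets_at_top (UNIV :: 'n multi set))"
      by (rule tendsto_mult_right_zero[OF weight_tail_tendsto])
  qed
  then show ?thesis unfolding has_sum_def by (rule LIM_zero_cancel)
qed

lemma hom_symbol_monogenic:
  assumes F: "right_linear_hom (A_space \<rho>\<^sub>1) (A_space \<rho>\<^sub>2) F"
  shows "monogenic (hom_symbol F m)"
  unfolding hom_symbol_def[abs_def]
  by (intro monogenic_sum monogenic_scaleR CK_prod_monogenic_bound(1) monogenic_fueter'
      A_space_monogenic[OF hom_maps[OF F fueter_space]])

lemma hom_symbol_hyperplane:
  assumes F: "right_linear_hom (A_space \<rho>\<^sub>1) (A_space \<rho>\<^sub>2) F"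
  shows "hom_symbol F m (0, y) = (\<Sum>l | l \<le> m.
    (mpow (- y) (\<lambda>i. m i - l i) / (multi_fact l * multi_fact (\<lambda>i. m i - l i))) *\<^sub>R F (fueter l) (0, y))"
  unfolding hom_symbol_def
  by (intro sum.cong refl)
    (simp add: CK_prod_hyperplane monogenic_fueter' A_space_monogenic[OF hom_maps[OF F fueter_space]]
      fueter_hyperplane cmul.scaleR_right cmul_cl_one mpow_uminus)

lemma hom_symbol_bound:
  fixes F :: "'n::{finite,linorder} cfun \<Rightarrow> 'n cfun"
  assumes F: "right_linear_hom (A_space \<rho>\<^sub>1) (A_space \<rho>\<^sub>2) F" and bd: "graded_bounded \<rho>\<^sub>1 \<rho>\<^sub>2 F" and \<mu>: "\<mu> > 0"
  obtains \<tau> C where "\<tau> > 0" "C > 0" "\<And>m. hom_symbol F m \<in> A_step \<rho>\<^sub>2 \<tau>"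
    "\<And>m. A_norm \<rho>\<^sub>2 \<tau> (hom_symbol F m) \<le> C * (G_coeff \<rho>\<^sub>1' o\<^sub>1 (multi_abs m) / multi_fact m) * \<mu> ^ multi_abs m"
proof -
  let ?K = "cmul_const TYPE('n)" and ?F = "fueter_const TYPE('n)"
  define E where "E = (exp 1 * o\<^sub>1) powr (1 / o\<^sub>1)"
  have E: "E > 0" using pos by (simp add: E_def)
  \<comment> \<open>The 2 compensates the power of 2 in \<open>sum_inverse_multi_fact\<close>, and
    \<open>E\<close> converts \<open>\<Phi>\<close> into \<open>G_coeff\<close>.\<close>
  define \<nu> where "\<nu> = \<mu> / (2 * E)"
  have \<nu>: "\<nu> > 0" using \<mu> E by (simp add: \<nu>_def)
  obtain \<sigma> C where C: "\<sigma> > 0" "C > 0"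
    "\<And>q r. r \<ge> 0 \<Longrightarrow> (?F * r) ^ q \<le> C * \<Phi> q * \<nu> ^ q * exp (\<sigma> * G1 r)"
    "\<And>m. fueter (m :: 'n multi) \<in> A_step \<rho>\<^sub>1 \<sigma>"
    "\<And>m. A_norm \<rho>\<^sub>1 \<sigma> (fueter (m :: 'n multi)) \<le> C * \<Phi> (multi_abs m) * \<nu> ^ multi_abs m"
    using fueter_step[OF \<nu>, where 'n = 'n] by metis
  obtain \<sigma>1 C1 where C1: "\<sigma>1 > 0" "C1 > 0" "\<And>f. f \<in> A_step \<rho>\<^sub>1 \<sigma> \<Longrightarrow> F f \<in> A_step \<rho>\<^sub>2 \<sigma>1"
    "\<And>f. f \<in> A_step \<rho>\<^sub>1 \<sigma> \<Longrightarrow> A_norm \<rho>\<^sub>2 \<sigma>1 (F f) \<le> C1 * A_norm \<rho>\<^sub>1 \<sigma> f"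
    using graded_boundedE[OF bd C(1)] by blast
  obtain \<sigma>2 C2 where C2: "\<sigma>2 > 0" "C2 > 0"
    "\<And>f r. f \<in> A_step \<rho>\<^sub>2 \<sigma>1 \<Longrightarrow> r \<ge> 0 \<Longrightarrow> majorant (f :: 'n cfun) r \<le> C2 * A_norm \<rho>\<^sub>2 \<sigma>1 f * exp (\<sigma>2 * G2 r)"
    using majorant_growth[OF po2 pos2 C1(1)] by metis
  obtain K B where KB: "K > 0" "B \<ge> 0" "\<And>r. 0 \<le> r \<Longrightarrow> G1 r \<le> K * G2 r + B"
    using growth_bigo[OF po bigo] by metis
  define c where "c = ?K * C2 * C1 * C * C * exp (\<sigma> * B)"
  define \<tau> where "\<tau> = \<sigma>2 + \<sigma> * K"
  have c: "c > 0" unfolding c_def using cmul_const(1)[where 'n = 'n] C1 C2 C by simp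
  have \<tau>: "\<tau> > 0" unfolding \<tau>_def using C2 C KB by (simp add: add_pos_pos)
  have bnd: "norm ((F (fueter l) \<odot>\<^sub>L fueter (\<lambda>i. m i - l i)) x) \<le> c * \<Phi> (multi_abs m) * \<nu> ^ multi_abs m * exp (\<tau> * G2 (norm x))"
    if l: "l \<le> m" for l m x
  proof -
    let ?d = "\<lambda>i. m i - l i" and ?r = "norm x"
    let ?p = "multi_abs l" and ?q = "multi_abs ?d"
    have pq: "multi_abs m = ?p + ?q"
      using l by (simp add: multi_abs_def sum.distrib[symmetric] le_fun_def)
    let ?a = "C2 * (C1 * (C * \<Phi> ?p * \<nu> ^ ?p)) * exp (\<sigma>2 * G2 ?r)"
    let ?b = "C * \<Phi> ?q * \<nu> ^ ?q * exp (\<sigma> * (K * G2 ?r + B))"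
    have a: "majorant (F (fueter l)) ?r \<le> ?a"
    proof -
      have "A_norm \<rho>\<^sub>2 \<sigma>1 (F (fueter l)) \<le> C1 * (C * \<Phi> ?p * \<nu> ^ ?p)"
        using C1(2) by (intro order_trans[OF C1(4)[OF C(4)]] mult_left_mono C(5)) auto
      then show ?thesis
        using C2(2) by (intro order_trans[OF C2(3)[OF C1(3)[OF C(4)]]] mult_right_mono mult_left_mono) auto
    qed
    have b: "majorant (fueter ?d) ?r \<le> ?b"
    proof -
      have "majorant (fueter ?d) ?r \<le> C * \<Phi> ?q * \<nu> ^ ?q * exp (\<sigma> * G1 ?r)"
        unfolding majorant_fueter' by (rule C(3)) simp
      also have "\<dots> \<le> ?b"
        using KB(3)[of ?r] C \<nu> Phi_pos[of ?q] by (intro mult_left_mono) auto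
      finally show ?thesis .
    qed
    have "norm ((F (fueter l) \<odot>\<^sub>L fueter ?d) x) \<le> ?K * majorant (F (fueter l)) ?r * majorant (fueter ?d) ?r"
      by (intro CK_prod_monogenic_bound(2) monogenic_fueter' A_step_monogenic[OF C1(3)[OF C(4)]])
    also have "\<dots> \<le> ?K * ?a * ?b"
      using cmul_const(1)[where 'n = 'n] C1 C2 C \<nu> Phi_pos[of ?p]
      by (intro mult_mono a b mult_left_mono majorant_nonneg) auto
    also have "\<dots> = c * (\<Phi> ?p * \<Phi> ?q) * \<nu> ^ (?p + ?q) * exp (\<tau> * G2 ?r)"
    proof -
      have e: "exp (\<sigma>2 * G2 ?r) * exp (\<sigma> * (K * G2 ?r + B)) = exp (\<sigma> * B) * exp (\<tau> * G2 ?r)"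
        by (simp add: \<tau>_def exp_add[symmetric] algebra_simps)
      have "?K * ?a * ?b = (?K * C2 * C1 * C * C) * (\<Phi> ?p * \<Phi> ?q) * \<nu> ^ (?p + ?q) *
          (exp (\<sigma>2 * G2 ?r) * exp (\<sigma> * (K * G2 ?r + B)))"
        by (simp add: power_add)
      then show ?thesis unfolding e by (simp add: c_def mult_ac)
    qed
    also have "\<dots> \<le> c * \<Phi> (?p + ?q) * \<nu> ^ (?p + ?q) * exp (\<tau> * G2 ?r)"
      using c \<nu> Phi_mult_le[of ?p ?q] by (intro mult_right_mono mult_left_mono) auto
    finally show ?thesis unfolding pq .
  qed
  have b: "norm (hom_symbol F m x) \<le> (c * (G_coeff \<rho>\<^sub>1' o\<^sub>1 (multi_abs m) / multi_fact m) * \<mu> ^ multi_abs m) * exp (\<tau> * G2 (norm x))" for m x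
  proof -
    let ?q = "multi_abs m"
    let ?T = "c * \<Phi> ?q * \<nu> ^ ?q * exp (\<tau> * G2 (norm x))"
    have "norm (hom_symbol F m x) \<le> (\<Sum>l | l \<le> m. (1 / (multi_fact l * multi_fact (\<lambda>i. m i - l i))) * ?T)"
      unfolding hom_symbol_def
    proof (rule sum_norm_le)
      fix l assume "l \<in> {l. l \<le> m}"
      then have l: "l \<le> m" by simp
      have nn: "norm ((- 1) ^ k / (multi_fact a * multi_fact b) :: real) = 1 / (multi_fact a * multi_fact b)" for k and a b :: "'n multi"
        using multi_fact_pos[of a] multi_fact_pos[of b] by (simp add: abs_mult)
      show "norm (((- 1) ^ multi_abs (\<lambda>i. m i - l i) / (multi_fact l * multi_fact (\<lambda>i. m i - l i))) *\<^sub>R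
          (F (fueter l) \<odot>\<^sub>L fueter (\<lambda>i. m i - l i)) x) \<le> (1 / (multi_fact l * multi_fact (\<lambda>i. m i - l i))) * ?T"
        unfolding norm_scaleR nn[unfolded real_norm_def]
        using multi_fact_pos[of l] multi_fact_pos[of "\<lambda>i. m i - l i"]
        by (intro mult_left_mono bnd[OF l]) auto
    qed
    also have "\<dots> = 2 ^ ?q / multi_fact m * ?T"
      by (simp only: sum_distrib_right[symmetric] sum_inverse_multi_fact)
    also have "\<dots> = (c * (G_coeff \<rho>\<^sub>1' o\<^sub>1 ?q / multi_fact m) * \<mu> ^ ?q) * exp (\<tau> * G2 (norm x))"
    proof -
      have "G_coeff \<rho>\<^sub>1' o\<^sub>1 ?q = \<Phi> ?q / E ^ ?q" by (simp add: G_coeff_eq E_def)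
      then show ?thesis using E by (simp add: \<nu>_def power_divide power_mult_distrib mult_ac)
    qed
    finally show ?thesis .
  qed
  have nn: "c * (G_coeff \<rho>\<^sub>1' o\<^sub>1 (multi_abs m) / multi_fact m) * \<mu> ^ multi_abs m \<ge> 0" for m :: "'n multi"
    using c \<mu> E Phi_pos[of "multi_abs m"] multi_fact_pos[of m] by (simp add: G_coeff_eq E_def[symmetric])
  show ?thesis by (rule that[OF \<tau> c A_stepI[OF hom_symbol_monogenic[OF F] nn b]])
qed

lemma hom_symbol_D_ops:
  assumes "right_linear_hom (A_space \<rho>\<^sub>1) (A_space \<rho>\<^sub>2) F" and "graded_bounded \<rho>\<^sub>1 \<rho>\<^sub>2 F"
  shows "hom_symbol F \<in> D_ops \<rho>\<^sub>1' o\<^sub>1 \<rho>\<^sub>2"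
  unfolding D_ops_def
proof (intro CollectI conjI allI impI)
  show "hom_symbol F m \<in> A_space \<rho>\<^sub>2" for m
    using hom_symbol_bound[OF assms zero_less_one] A_step_space by metis
  fix \<mu> :: real assume "\<mu> > 0"
  from hom_symbol_bound[OF assms this]
  show "\<exists>\<sigma>>0. \<exists>C>0. \<forall>m. hom_symbol F m \<in> A_step \<rho>\<^sub>2 \<sigma> \<and>
        A_norm \<rho>\<^sub>2 \<sigma> (hom_symbol F m) \<le> C * (G_coeff \<rho>\<^sub>1' o\<^sub>1 (multi_abs m) / multi_fact m) * \<mu> ^ multi_abs m"
    by metis
qed

text \<open>Derivatives of \<open>fueter p\<close> vanish unless \<open>m \<le> p\<close>, so the
  series is finite and the coefficients enter in triangular form.\<close>

lemma op_apply_fueter_hyperplane: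
  fixes u :: "'n::{finite,linorder} multi \<Rightarrow> 'n cfun"
  assumes u: "u \<in> D_ops \<rho>\<^sub>1' o\<^sub>1 \<rho>\<^sub>2"
  shows "op_apply u (fueter p) (0, y) = (\<Sum>m | m \<le> p.
    (multi_fact p / multi_fact (\<lambda>i. p i - m i) * mpow y (\<lambda>i. p i - m i)) *\<^sub>R u m (0, y))"
proof -
  have "((\<lambda>m. u m (0, y) \<cdot>\<^sub>c multi_deriv m (fueter p) (0, y)) has_sum (\<Sum>m | m \<le> p.
    (multi_fact p / multi_fact (\<lambda>i. p i - m i) * mpow y (\<lambda>i. p i - m i)) *\<^sub>R u m (0, y))) UNIV"
    by (rule has_sum_finite_neutralI[of "{m. m \<le> p}"])
      (auto simp: multi_deriv_fueter' cmul.zero_right fueter_hyperplane cmul.scaleR_right cmul_cl_one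
        intro!: sum.cong)
  with op_apply_hyperplane[OF u fueter_space] show ?thesis by (rule has_sum_unique)
qed

text \<open>Inverting the triangular system by the binomial theorem for \<open>(y - y)\<^bsup>p - l\<^esup>\<close>.\<close>

lemma op_apply_hom_symbol_fueter:
  fixes F :: "'n::{finite,linorder} cfun \<Rightarrow> 'n cfun"
  assumes F: "right_linear_hom (A_space \<rho>\<^sub>1) (A_space \<rho>\<^sub>2) F" and bd: "graded_bounded \<rho>\<^sub>1 \<rho>\<^sub>2 F"
  shows "op_apply (hom_symbol F) (fueter p) = F (fueter p)"
proof (rule monogenic_eqI)
  note D = hom_symbol_D_ops[OF F bd]
  show "monogenic (op_apply (hom_symbol F) (fueter p))"
    by (rule A_space_monogenic[OF op_apply_summable(2)[OF D fueter_space]])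
  show "monogenic (F (fueter p))" by (rule A_space_monogenic[OF hom_maps[OF F fueter_space]])
  fix y :: "(real, 'n) vec"
  let ?w = "\<lambda>l. F (fueter l) (0, y)" and ?df = "\<lambda>m l :: 'n multi. \<lambda>i. m i - l i"
  let ?c = "\<lambda>m l. (multi_fact p / multi_fact l) *
     (mpow (- y) (?df m l) / multi_fact (?df m l) * (mpow y (?df p m) / multi_fact (?df p m)))"
  have inner: "(\<Sum>m | m \<in> {m. m \<le> p} \<and> l \<le> m. ?c m l) = (if l = p then 1 else 0)" if l: "l \<le> p" for l
  proof -
    \<comment> \<open>The substitution m = k + l puts the inner sum into the form of
      \<open>mpow_binomial\<close>.\<close>
    have bij: "bij_betw (\<lambda>k. mshift k l) {k. k \<le> ?df p l} {m. m \<in> {m. m \<le> p} \<and> l \<le> m}"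
    proof (rule bij_betwI[where g = "\<lambda>m. ?df m l"])
      show "(\<lambda>k. mshift k l) \<in> {k. k \<le> ?df p l} \<rightarrow> {m. m \<in> {m. m \<le> p} \<and> l \<le> m}"
        using l by (auto simp: mshift_def le_fun_def le_diff_conv2)
      show "(\<lambda>m. ?df m l) \<in> {m. m \<in> {m. m \<le> p} \<and> l \<le> m} \<rightarrow> {k. k \<le> ?df p l}"
        by (auto simp: le_fun_def diff_le_mono)
    qed (auto simp: mshift_def le_fun_def fun_eq_iff)
    have "(\<Sum>m | m \<in> {m. m \<le> p} \<and> l \<le> m. ?c m l) = (\<Sum>k | k \<le> ?df p l. ?c (mshift k l) l)"
      by (rule sum.reindex_bij_betw[OF bij, symmetric])
    also have "\<dots> = (multi_fact p / multi_fact l) * (\<Sum>k | k \<le> ?df p l. mpow (- y) k / multi_fact k *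
        (mpow y (?df (?df p l) k) / multi_fact (?df (?df p l) k)))"
      by (simp add: sum_distrib_left mshift_def add.commute)
    also have "\<dots> = (multi_fact p / multi_fact l) * (mpow 0 (?df p l) / multi_fact (?df p l))"
      unfolding mpow_binomial by simp
    also have "\<dots> = (if l = p then 1 else 0)"
    proof (cases "l = p")
      case True
      then show ?thesis using multi_fact_pos[of p] by (simp add: mpow_0 multi_fact_def)
    next
      case False
      have "?df p l \<noteq> (\<lambda>_. 0)"
      proof
        assume "?df p l = (\<lambda>_. 0)"
        from fun_cong[OF this] have "p \<le> l" by (simp add: le_fun_def)
        then show False using l False by simp
      qed
      then show ?thesis using False by (simp add: mpow_0)
    qed
    finally show ?thesis .
  qed
  have "op_apply (hom_symbol F) (fueter p) (0, y) =
      (\<Sum>m\<in>{m. m \<le> p}. \<Sum>l | l \<in> {l. l \<le> p} \<and> l \<le> m. ?c m l *\<^sub>R ?w l)"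
    unfolding op_apply_fueter_hyperplane[OF D] hom_symbol_hyperplane[OF F] scaleR_sum_right
  proof (intro sum.cong refl)
    fix m assume "m \<in> {m. m \<le> p}"
    then show "{l. l \<le> m} = {l. l \<in> {l. l \<le> p} \<and> l \<le> m}" by (auto intro: order_trans)
  qed (simp add: mult_ac)
  also have "\<dots> = (\<Sum>l\<in>{l. l \<le> p}. \<Sum>m | m \<in> {m. m \<le> p} \<and> l \<le> m. ?c m l *\<^sub>R ?w l)"
    by (rule sum.swap_restrict) simp_all
  also have "\<dots> = (\<Sum>l\<in>{l. l \<le> p}. (if l = p then 1 else 0) *\<^sub>R ?w l)"
    unfolding scaleR_sum_left[symmetric]
  proof (rule sum.cong[OF refl])
    fix l assume "l \<in> {l. l \<le> p}"
    then have "l \<le> p" by simp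
    from inner[OF this]
    show "(\<Sum>m | m \<in> {m. m \<le> p} \<and> l \<le> m. ?c m l) *\<^sub>R ?w l = (if l = p then 1 else 0) *\<^sub>R ?w l"
      by (rule arg_cong)
  qed
  also have "\<dots> = (\<Sum>l\<in>{l. l \<le> p}. if l = p then ?w l else 0)" by (rule sum.cong) auto
  also have "\<dots> = ?w p" by simp
  finally show "op_apply (hom_symbol F) (fueter p) (0, y) = F (fueter p) (0, y)" .
qed

text \<open>Both sides are bounded homomorphisms that agree on Fueter polynomials, hence have the
  same expansion by \<open>hom_taylor_has_sum\<close>.\<close>

lemma op_apply_hom_symbol:
  assumes F: "right_linear_hom (A_space \<rho>\<^sub>1) (A_space \<rho>\<^sub>2) F" and bd: "graded_bounded \<rho>\<^sub>1 \<rho>\<^sub>2 F"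
    and f: "f \<in> A_space \<rho>\<^sub>1"
  shows "op_apply (hom_symbol F) f = F f"
proof
  fix x
  note D = hom_symbol_D_ops[OF F bd]
  show "op_apply (hom_symbol F) f x = F f x"
    using hom_taylor_has_sum[OF op_apply_hom[OF D] op_apply_graded_bounded[OF D] f, of x]
      hom_taylor_has_sum[OF F bd f, of x]
    unfolding op_apply_hom_symbol_fueter[OF F bd] by (rule has_sum_unique)
qed

text \<open>The triangular system of \<open>op_apply_fueter_hyperplane\<close> has the diagonal
  entry p!, so the coefficients are recovered by induction on the degree.\<close>

lemma D_ops_unique:
  fixes u v :: "'n::{finite,linorder} multi \<Rightarrow> 'n cfun"
  assumes u: "u \<in> D_ops \<rho>\<^sub>1' o\<^sub>1 \<rho>\<^sub>2" and v: "v \<in> D_ops \<rho>\<^sub>1' o\<^sub>1 \<rho>\<^sub>2"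
    and eq: "\<And>m. op_apply u (fueter m) = op_apply v (fueter m)"
  shows "u = v"
proof
  fix p
  show "u p = v p"
  proof (induction "multi_abs p" arbitrary: p rule: less_induct)
    case less
    show ?case
    proof (rule monogenic_eqI[OF D_opsD(2)[OF u] D_opsD(2)[OF v]])
      fix y :: "(real, 'n) vec"
      let ?c = "\<lambda>m. multi_fact p / multi_fact (\<lambda>i. p i - m i) * mpow y (\<lambda>i. p i - m i)"
      have split: "(\<Sum>m | m \<le> p. ?c m *\<^sub>R w m) = ?c p *\<^sub>R w p + (\<Sum>m\<in>{m. m \<le> p} - {p}. ?c m *\<^sub>R w m)"
        for w :: "'n multi \<Rightarrow> 'n clifford"
        by (rule sum.remove) auto
      have lt: "u m = v m" if m: "m \<in> {m. m \<le> p} - {p}" for m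
      proof (rule less)
        have "m < p" using m by (simp add: order_less_le)
        then obtain i where "m i < p i" "\<And>i. m i \<le> p i" by (auto simp: less_fun_def le_fun_def not_le)
        then show "multi_abs m < multi_abs p" unfolding multi_abs_def by (intro sum_strict_mono_ex1) auto
      qed
      have "(\<Sum>m | m \<le> p. ?c m *\<^sub>R u m (0, y)) = (\<Sum>m | m \<le> p. ?c m *\<^sub>R v m (0, y))"
        using fun_cong[OF eq[of p], of "(0, y)"]
        unfolding op_apply_fueter_hyperplane[OF u] op_apply_fueter_hyperplane[OF v] .
      then have "?c p *\<^sub>R u p (0, y) = ?c p *\<^sub>R v p (0, y)"
        unfolding split by (simp add: lt cong: sum.cong_simp)
      moreover have "?c p \<noteq> 0" using multi_fact_pos[of p] by (simp add: mpow_def multi_fact_def)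
      ultimately show "u p (0, y) = v p (0, y)" by simp
    qed
  qed
qed

end

theorem theorem4p4:
  fixes \<rho>\<^sub>1 \<rho>\<^sub>2 \<rho>\<^sub>1' :: "real \<Rightarrow> real" and o\<^sub>1 o\<^sub>2 :: real
  assumes "o\<^sub>1 > 0" and "o\<^sub>2 > 0"
    and "proximate_order \<rho>\<^sub>1 o\<^sub>1" and "proximate_order \<rho>\<^sub>2 o\<^sub>2"
    and "(\<lambda>r. r powr \<rho>\<^sub>1 r) \<in> O[at_top](\<lambda>r. r powr \<rho>\<^sub>2 r)"
    and "normalization \<rho>\<^sub>1' \<rho>\<^sub>1 o\<^sub>1"
  shows "(\<forall>u :: 'n::{finite,linorder} multi \<Rightarrow> 'n cfun. u \<in> D_ops \<rho>\<^sub>1' o\<^sub>1 \<rho>\<^sub>2 \<longrightarrow>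
            (\<forall>f\<in>A_space \<rho>\<^sub>1.
               (\<forall>x. (\<lambda>m. (u m \<odot>\<^sub>L multi_deriv m f) x) summable_on UNIV) \<and>
               limitin (A_top \<rho>\<^sub>2) (\<lambda>M x. \<Sum>m\<in>M. (u m \<odot>\<^sub>L multi_deriv m f) x) (op_apply u f)
                 (finite_subsets_at_top UNIV) \<and>
               op_apply u f \<in> A_space \<rho>\<^sub>2) \<and>
            right_linear_hom (A_space \<rho>\<^sub>1) (A_space \<rho>\<^sub>2) (op_apply u) \<and>
            continuous_map (A_top \<rho>\<^sub>1) (A_top \<rho>\<^sub>2) (op_apply u)) \<and>
         (\<forall>F :: 'n cfun \<Rightarrow> 'n cfun.
            right_linear_hom (A_space \<rho>\<^sub>1) (A_space \<rho>\<^sub>2) F \<and>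
            continuous_map (A_top \<rho>\<^sub>1) (A_top \<rho>\<^sub>2) F \<longrightarrow>
            (\<exists>!u. u \<in> D_ops \<rho>\<^sub>1' o\<^sub>1 \<rho>\<^sub>2 \<and> (\<forall>f\<in>A_space \<rho>\<^sub>1. F f = op_apply u f)))"
proof -
  interpret operator_setting \<rho>\<^sub>1' \<rho>\<^sub>1 o\<^sub>1 \<rho>\<^sub>2 o\<^sub>2
    using assms by unfold_locales (simp_all add: growth_def[abs_def])
  show ?thesis
  proof (intro conjI allI impI ballI)
    fix u :: "'n multi \<Rightarrow> 'n cfun" assume u: "u \<in> D_ops \<rho>\<^sub>1' o\<^sub>1 \<rho>\<^sub>2"
    show "right_linear_hom (A_space \<rho>\<^sub>1) (A_space \<rho>\<^sub>2) (op_apply u)" by (rule op_apply_hom[OF u])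
    show "continuous_map (A_top \<rho>\<^sub>1) (A_top \<rho>\<^sub>2) (op_apply u)"
      by (rule graded_bounded_continuous[OF op_apply_hom[OF u] op_apply_graded_bounded[OF u]])
    fix f :: "'n cfun" assume f: "f \<in> A_space \<rho>\<^sub>1"
    show "(\<lambda>m. (u m \<odot>\<^sub>L multi_deriv m f) x) summable_on UNIV" for x by (rule op_apply_summable(1)[OF u f])
    show "op_apply u f \<in> A_space \<rho>\<^sub>2" by (rule op_apply_summable(2)[OF u f])
    show "limitin (A_top \<rho>\<^sub>2) (\<lambda>M x. \<Sum>m\<in>M. (u m \<odot>\<^sub>L multi_deriv m f) x) (op_apply u f)
        (finite_subsets_at_top UNIV)"
      by (rule op_apply_limitin[OF u f])
  next
    fix F :: "'n cfun \<Rightarrow> 'n cfun"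
    assume "right_linear_hom (A_space \<rho>\<^sub>1) (A_space \<rho>\<^sub>2) F \<and> continuous_map (A_top \<rho>\<^sub>1) (A_top \<rho>\<^sub>2) F"
    \<comment> \<open>From here on, continuity enters only through boundedness between
      steps.\<close>
    then have F: "right_linear_hom (A_space \<rho>\<^sub>1) (A_space \<rho>\<^sub>2) F" and bd: "graded_bounded \<rho>\<^sub>1 \<rho>\<^sub>2 F"
      using continuous_graded_bounded by blast+
    show "\<exists>!u. u \<in> D_ops \<rho>\<^sub>1' o\<^sub>1 \<rho>\<^sub>2 \<and> (\<forall>f\<in>A_space \<rho>\<^sub>1. F f = op_apply u f)"
    proof (rule ex1I[of _ "hom_symbol F"])
      show "hom_symbol F \<in> D_ops \<rho>\<^sub>1' o\<^sub>1 \<rho>\<^sub>2 \<and> (\<forall>f\<in>A_space \<rho>\<^sub>1. F f = op_apply (hom_symbol F) f)"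
        using hom_symbol_D_ops[OF F bd] op_apply_hom_symbol[OF F bd] by simp
      fix u assume u: "u \<in> D_ops \<rho>\<^sub>1' o\<^sub>1 \<rho>\<^sub>2 \<and> (\<forall>f\<in>A_space \<rho>\<^sub>1. F f = op_apply u f)"
      show "u = hom_symbol F"
      proof (rule D_ops_unique)
        show "op_apply u (fueter m) = op_apply (hom_symbol F) (fueter m)" for m
          using u fueter_space op_apply_hom_symbol[OF F bd fueter_space] by metis
      qed (use u hom_symbol_D_ops[OF F bd] in auto)
    qed
  qed
qed

end
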